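(* Let $$\mathcal A:=\mathcal L^T_{m_1}\oplus\dots\oplus\mathcal L^T_{m_{\underline s}}\oplus\bigoplus_{i=1}^{t}\Big(\mathcal D_{k_{i1}}(\lambda_i)\oplus\dots\oplus\mathcal D_{k_{is_i}}(\lambda_i)\Big)\oplus\mathcal L_{n_{\overline s}}\oplus\mathcal L_{n_{\overline s-1}}\oplus\dots\oplus\mathcal L_{n_1},$$ in which $m_1\le\cdots\le m_{\underline s}$, $k_{i1}\le\cdots\le k_{is_i}$ $(i=1,\dots,t)$, $n_1\le\cdots\le n_{\overline s}$, and $\lambda_1,\dots,\lambda_t\in\mathbb C\cup\{\infty\}$ are distinct (summands of any of the types may be absent). Let $\mathcal A=([A_{ij}],[A'_{ij}])$ be partitioned such that the pairs of diagonal blocks $(A_{11},A'_{11}),(A_{22},A'_{22}),\dots$ are the direct summands $$\mathcal L^T_{m_1},\dots,\mathcal L^T_{m_{\underline s}},\ \mathcal D_{k_{11}}(\lambda_1),\dots,\mathcal D_{k_{1s_1}}(\lambda_1),\ \dots,\ \mathcal D_{k_{t1}}(\lambda_t),\dots,\mathcal D_{k_{ts_t}}(\lambda_t),\ \mathcal L_{n_{\overline s}},\dots,\mathcal L_{n_1}$$ of $\mathcal A$. Write $$\mathcal D_i:=\mathcal D_{k_{i1}}(\lambda_i)\oplus\dots\oplus\mathcal D_{k_{is_i}}(\lambda_i),\qquad i=1,\dots,t.$$ Then each immediate successor of $\langle\mathcal A\rangle$ is the orbit of some matrix pair obtained from $\mathcal A$ by an arbitrarily small perturbation of only one pair $(A_{ij},A'_{ij})$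 with $i<j$ that is not contained in $\mathcal D_1,\dots,\mathcal D_t$, or of only one pair $(A_{ij},A'_{ij})$ from $\mathcal D_1,\dots,\mathcal D_t$.
   Context: All matrices are complex, and both matrices in each matrix pair have the same size; sizes with zero rows or zero columns are allowed. Two pairs $(A,B)$ and $(A',B')$ are equivalent if $(A',B')=(SAR,SBR)$ for some nonsingular $S,R$. The orbit $\langle\mathcal A\rangle$ is the set of all pairs equivalent to $\mathcal A$. One writes $\langle\mathcal A\rangle\le\langle\mathcal B\rangle$ if $\langle\mathcal A\rangle$ is contained in the closure of $\langle\mathcal B\rangle$, and $\langle\mathcal A\rangle<\langle\mathcal B\rangle$ if in addition the orbits are different. $\langle\mathcal B\rangle$ is an immediate successor of $\langle\mathcal A\rangle$ if $\langle\mathcal A\rangle<\langle\mathcal B\rangle$ and there is no $\langle\mathcal C\rangle$ with $\langle\mathcal A\rangle<\langle\mathcal C\rangle<\langle\mathcal B\rangle$. Direct sums of pairs are taken componentwise. "Obtained by an arbitrarily small perturbation of only one pair of blocks" means: for every $\delta>0$, the orbit contains a pair that differs from $\mathcal A$ only in the blocks $A_{ij}$ and $A'_{ij}$ (at one position $(i,j)$) and whose distance from $\mathcal A$ is less than $\delta$. A pair $(A_{ij},A'_{ij})$ is contained in (is from) $\mathcal D_l$ if both the $i$th horizontal strip and the $j$th vertical strip correspond to direct summands $\mathcal D_{k_{l1}}(\lambda_l),\dots,\mathcal D_{k_{ls_l}}(\lambda_l)$ of $\mathcal D_l$. For $n\ge1$, $L_n$ and $R_n$ are the $(n-1)\times n$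 matrices $L_n=[I_{n-1}\;0]$ and $R_n=[0\;I_{n-1}]$; $L_1=R_1$ is the $0\times1$ matrix. $J_n(\lambda)$ is the $n\times n$ upper triangular Jordan block with eigenvalue $\lambda$. $\mathcal L_n:=(L_n,R_n)$, $\mathcal L_n^T:=(L_n^T,R_n^T)$, $\mathcal D_n(\lambda):=(I_n,J_n(\lambda))$ for $\lambda\in\mathbb C$, and $\mathcal D_n(\infty):=(J_n(0),I_n)$, where $n\ge1$. *)

theory Defs
  imports
    "HOL-Analysis.Abstract_Metric_Spaces"
    "HOL-Analysis.L2_Norm"
    "Jordan_Normal_Form.Jordan_Normal_Form"
begin

section \<open>Matrix pairs, orbits and the closure order\<close>

type_synonym matrix_pair = "complex mat \<times> complex mat"

definition pair_space :: "nat \<Rightarrow> nat \<Rightarrow> matrix_pair set" where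
  "pair_space m n = carrier_mat m n \<times> carrier_mat m n"

definition mat_dist :: "nat \<Rightarrow> nat \<Rightarrow> complex mat \<Rightarrow> complex mat \<Rightarrow> real" where
  "mat_dist m n A B = L2_set (\<lambda>(r, c). cmod (A $$ (r, c) - B $$ (r, c))) ({..<m} \<times> {..<n})"

definition pair_dist :: "nat \<Rightarrow> nat \<Rightarrow> matrix_pair \<Rightarrow> matrix_pair \<Rightarrow> real" where
  "pair_dist m n = prod_dist (mat_dist m n) (mat_dist m n)"

text \<open>The type of matrices carries no topology; each space of \<open>m \<times> n\<close> pairs is
  given its usual Euclidean one, through the Frobenius distance.\<close>

definition pair_topology :: "nat \<Rightarrow> nat \<Rightarrow> matrix_pair topology" where
  "pair_topology m n = Metric_space.mtopology (pair_space m n) (pair_dist m n)"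

lemma Metric_space_mat: "Metric_space (carrier_mat m n) (mat_dist m n)"
proof
  fix A B :: "complex mat"
  show "0 \<le> mat_dist m n A B"
    by (simp add: mat_dist_def L2_set_nonneg)
  show "mat_dist m n A B = mat_dist m n B A"
    by (simp add: mat_dist_def norm_minus_commute)
  assume "A \<in> carrier_mat m n" "B \<in> carrier_mat m n"
  then show "mat_dist m n A B = 0 \<longleftrightarrow> A = B"
    by (auto simp: mat_dist_def L2_set_eq_0_iff intro!: eq_matI)
next
  fix A B C :: "complex mat"
  let ?I = "{..<m} \<times> {..<n}"
  let ?f = "\<lambda>(X :: complex mat) (Y :: complex mat) (r, c). cmod (X $$ (r, c) - Y $$ (r, c))"
  have "L2_set (?f A C) ?I \<le> L2_set (\<lambda>x. ?f A B x + ?f B C x) ?I"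
  proof (rule L2_set_mono)
    fix x assume "x \<in> ?I"
    obtain r c where x: "x = (r, c)" by fastforce
    show "?f A C x \<le> ?f A B x + ?f B C x"
      using norm_triangle_ineq[of "A $$ (r, c) - B $$ (r, c)" "B $$ (r, c) - C $$ (r, c)"]
      by (simp add: x)
    show "0 \<le> ?f A C x" by (simp add: x)
  qed
  also have "\<dots> \<le> L2_set (?f A B) ?I + L2_set (?f B C) ?I"
    by (rule L2_set_triangle_ineq)
  finally show "mat_dist m n A C \<le> mat_dist m n A B + mat_dist m n B C"
    by (simp add: mat_dist_def)
qed

lemma Metric_space_pair: "Metric_space (pair_space m n) (pair_dist m n)"
  unfolding pair_space_def pair_dist_def
  by (intro Metric_space12.prod_metric Metric_space12.intro Metric_space_mat)

definition pair_orbit :: "matrix_pair \<Rightarrow> matrix_pair set" where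
  "pair_orbit P = {(S * fst P * R, S * snd P * R) | S R.
     S \<in> carrier_mat (dim_row (fst P)) (dim_row (fst P)) \<and> invertible_mat S \<and>
     R \<in> carrier_mat (dim_col (fst P)) (dim_col (fst P)) \<and> invertible_mat R}"

definition orbit_le :: "nat \<Rightarrow> nat \<Rightarrow> matrix_pair \<Rightarrow> matrix_pair \<Rightarrow> bool" where
  "orbit_le m n P Q \<longleftrightarrow> pair_orbit P \<subseteq> pair_topology m n closure_of pair_orbit Q"

definition orbit_less :: "nat \<Rightarrow> nat \<Rightarrow> matrix_pair \<Rightarrow> matrix_pair \<Rightarrow> bool" where
  "orbit_less m n P Q \<longleftrightarrow> orbit_le m n P Q \<and> pair_orbit P \<noteq> pair_orbit Q"

text \<open>The orbit of \<open>Q\<close> is an immediate successor of the orbit of \<open>P\<close>.\<close>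

definition immediate_successor :: "nat \<Rightarrow> nat \<Rightarrow> matrix_pair \<Rightarrow> matrix_pair \<Rightarrow> bool" where
  "immediate_successor m n P Q \<longleftrightarrow> orbit_less m n P Q \<and>
     \<not> (\<exists>C \<in> pair_space m n. orbit_less m n P C \<and> orbit_less m n C Q)"

section \<open>Kronecker canonical pairs\<close>

definition L_mat :: "nat \<Rightarrow> complex mat" where
  "L_mat n = mat (n - 1) n (\<lambda>(r, c). if c = r then 1 else 0)"

definition R_mat :: "nat \<Rightarrow> complex mat" where
  "R_mat n = mat (n - 1) n (\<lambda>(r, c). if c = Suc r then 1 else 0)"

datatype ext_complex = Finite complex | Infinite

datatype summand = LT nat | D ext_complex nat | L nat

fun summand_pair :: "summand \<Rightarrow> matrix_pair" where
  "summand_pair (LT n) = (transpose_mat (L_mat n), transpose_mat (R_mat n))"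
| "summand_pair (D (Finite a) n) = (1\<^sub>m n, jordan_block n a)"
| "summand_pair (D Infinite n) = (jordan_block n 0, 1\<^sub>m n)"
| "summand_pair (L n) = (L_mat n, R_mat n)"

text \<open>An entry \<open>(\<lambda>, [k\<^sub>1, \<dots>, k\<^sub>s])\<close> of the list of eigenvalue data stands for the group
  \<open>D\<^bsub>k\<^sub>1\<^esub>(\<lambda>) \<oplus> \<dots> \<oplus> D\<^bsub>k\<^sub>s\<^esub>(\<lambda>)\<close>.\<close>

fun D_summands :: "ext_complex \<times> nat list \<Rightarrow> summand list" where
  "D_summands (a, ks) = map (D a) ks"

definition canonical_summands ::
    "nat list \<Rightarrow> (ext_complex \<times> nat list) list \<Rightarrow> nat list \<Rightarrow> summand list" where
  "canonical_summands ms gs ns = map LT ms @ concat (map D_summands gs) @ map L (rev ns)"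

definition direct_sum :: "summand list \<Rightarrow> matrix_pair" where
  "direct_sum xs = (diag_block_mat (map (fst \<circ> summand_pair) xs),
                    diag_block_mat (map (snd \<circ> summand_pair) xs))"

definition row_count :: "summand list \<Rightarrow> nat" where
  "row_count xs = sum_list (map (dim_row \<circ> fst \<circ> summand_pair) xs)"

definition col_count :: "summand list \<Rightarrow> nat" where
  "col_count xs = sum_list (map (dim_col \<circ> fst \<circ> summand_pair) xs)"

lemma direct_sum_in_pair_space: "direct_sum xs \<in> pair_space (row_count xs) (col_count xs)"
proof -
  have "dim_row (snd (summand_pair x)) = dim_row (fst (summand_pair x)) \<and>
        dim_col (snd (summand_pair x)) = dim_col (fst (summand_pair x))" for x
    by (induction x rule: summand_pair.induct) (simp_all add: L_mat_def R_mat_def)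
  then show ?thesis
    by (auto simp: direct_sum_def pair_space_def row_count_def col_count_def
        dim_diag_block_mat o_def intro!: carrier_matI)
qed

section \<open>Perturbations of one pair of blocks\<close>

text \<open>Strips are numbered from \<open>0\<close>: \<open>block_positions xs i j\<close> is the set of index pairs
  of the intersection of the horizontal strip of \<open>xs ! i\<close> with the vertical strip of \<open>xs ! j\<close>.\<close>

definition block_positions :: "summand list \<Rightarrow> nat \<Rightarrow> nat \<Rightarrow> (nat \<times> nat) set" where
  "block_positions xs i j =
     {row_count (take i xs) ..< row_count (take (Suc i) xs)} \<times>
     {col_count (take j xs) ..< col_count (take (Suc j) xs)}"

definition differs_only_in_block :: "summand list \<Rightarrow> nat \<Rightarrow> nat \<Rightarrow> matrix_pair \<Rightarrow> bool" where
  "differs_only_in_block xs i j P \<longleftrightarrow>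
     P \<in> pair_space (row_count xs) (col_count xs) \<and>
     (\<forall>p \<in> {..<row_count xs} \<times> {..<col_count xs} - block_positions xs i j.
        fst P $$ p = fst (direct_sum xs) $$ p \<and> snd P $$ p = snd (direct_sum xs) $$ p)"

definition orbit_by_small_perturbation :: "summand list \<Rightarrow> nat \<Rightarrow> nat \<Rightarrow> matrix_pair \<Rightarrow> bool" where
  "orbit_by_small_perturbation xs i j Q \<longleftrightarrow>
     (\<forall>\<delta> > 0. \<exists>P \<in> pair_orbit Q. differs_only_in_block xs i j P \<and>
        pair_dist (row_count xs) (col_count xs) (direct_sum xs) P < \<delta>)"

text \<open>Distinct groups have distinct eigenvalues, so a summand belongs to at most one group.\<close>

definition block_from_D ::
    "summand list \<Rightarrow> (ext_complex \<times> nat list) list \<Rightarrow> nat \<Rightarrow> nat \<Rightarrow> bool" where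
  "block_from_D xs gs i j \<longleftrightarrow>
     (\<exists>g \<in> set gs. xs ! i \<in> set (D_summands g) \<and> xs ! j \<in> set (D_summands g))"

end

theory Submission
  imports Defs "Jordan_Normal_Form.Jordan_Normal_Form_Existence"
begin

hide_const (open) SumSpaces.direct_sum
hide_fact (open) SumSpaces.direct_sum_def

text \<open>The dimensions of the spaces of homomorphisms from indecomposable pairs are upper semicontinuous
  invariants of a pair, so they can only drop from \<open>A\<close> to a pair whose orbit closure contains \<open>A\<close>.
  Conversely, if all invariants of the canonical pair \<open>xs\<close> dominate those of \<open>ys\<close> and the two differ, then
  two summands of \<open>xs\<close> can be replaced by the middle term of an extension of one by the other so that
  the invariants still dominate those of \<open>ys\<close>. Scaling the extension class makes such a replacement
  an arbitrarily small perturbation of one off-diagonal block, and iterating it shows that dominance of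
  the invariants implies degeneration. Hence the first replacement on the way from \<open>A\<close> to an immediate
  successor already reaches it. The canonical order of the summands is such that the perturbed block
  lies above the diagonal.\<close>

section \<open>Equivalence of matrix pairs\<close>

text \<open>All extensions come from two constructions. Appending a column attaches a Jordan pair of
  size 1 at eigenvalue 0; its class lives in the cokernel of the second matrix, which for a
  canonical summand has dimension at most one. Normalising this class proves the existence of the
  Kronecker form by induction on the size, and reading such a matrix with another cut shows how one
  summand grows while another shrinks. An extension of \<open>L n\<close> by \<open>LT m\<close> has
  to realise every distribution of \<open>m + n - 1\<close> over distinct eigenvalues; a bidiagonal
  pencil does so, and its canonical form is recognised from the invariants alone.

  As functions of \<open>k\<close> the invariants are piecewise linear, and their second differences
  count summands. So a bounded range of \<open>k\<close> on which \<open>xs\<close> strictly exceeds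
  \<open>ys\<close> forces two summands of \<open>xs\<close> whose move lowers the invariant by one
  within that range. The obstacle are ranges without end. One for \<open>LT\<close> or
  \<open>L\<close> and one for an eigenvalue are used up in one move; otherwise total sizes exclude
  them, unless \<open>xs\<close> has more \<open>LT\<close> and \<open>L\<close> than
  \<open>ys\<close>, and then one of each is traded for Jordan blocks.\<close>

definition unit_mat :: "nat \<Rightarrow> complex mat \<Rightarrow> bool" where
  "unit_mat n S \<longleftrightarrow> S \<in> carrier_mat n n \<and> (\<exists>T \<in> carrier_mat n n. S * T = 1\<^sub>m n \<and> T * S = 1\<^sub>m n)"

text \<open>A morphism of representations of the Kronecker quiver: \<open>R\<close> acts on the
  column spaces and \<open>S\<close> on the row spaces. Written without inverses, it also makes
  sense between pairs of different sizes.\<close>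

definition pair_hom :: "matrix_pair \<Rightarrow> matrix_pair \<Rightarrow> complex mat \<Rightarrow> complex mat \<Rightarrow> bool" where
  "pair_hom P Q S R \<longleftrightarrow> S * fst P = fst Q * R \<and> S * snd P = snd Q * R"

definition pair_iso :: "nat \<Rightarrow> nat \<Rightarrow> matrix_pair \<Rightarrow> matrix_pair \<Rightarrow> bool" where
  "pair_iso m n P Q \<longleftrightarrow> P \<in> pair_space m n \<and> Q \<in> pair_space m n \<and>
     (\<exists>S R. unit_mat m S \<and> unit_mat n R \<and> pair_hom P Q S R)"

lemma pair_space_iff: "P \<in> pair_space m n \<longleftrightarrow> fst P \<in> carrier_mat m n \<and> snd P \<in> carrier_mat m n"
  by (cases P) (simp add: pair_space_def)

lemma unit_mat_carrier: "unit_mat n S \<Longrightarrow> S \<in> carrier_mat n n"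
  by (simp add: unit_mat_def)

lemma unit_mat_one [simp]: "unit_mat n (1\<^sub>m n)"
  by (auto simp: unit_mat_def intro!: bexI[of _ "1\<^sub>m n"])

lemma unit_matI:
  assumes "S \<in> carrier_mat n n" "T \<in> carrier_mat n n" "S * T = 1\<^sub>m n"
  shows "unit_mat n S"
  using assms mat_mult_left_right_inverse[OF assms] by (auto simp: unit_mat_def)

lemma unit_mat_iff_det: "unit_mat n S \<longleftrightarrow> S \<in> carrier_mat n n \<and> det S \<noteq> 0"
proof
  assume "unit_mat n S"
  then obtain T where S: "S \<in> carrier_mat n n" and T: "T \<in> carrier_mat n n" "S * T = 1\<^sub>m n"
    by (auto simp: unit_mat_def)
  then have "det S * det T = 1" using det_mult[OF S T(1)] by simp
  then show "S \<in> carrier_mat n n \<and> det S \<noteq> 0" using S by auto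
next
  assume *: "S \<in> carrier_mat n n \<and> det S \<noteq> 0"
  then show "unit_mat n S"
    using det_non_zero_imp_unit[of S n "()"]
    by (auto simp: unit_mat_def Units_def ring_mat_def)
qed

lemma unit_mat_iff_invertible: "unit_mat n S \<longleftrightarrow> S \<in> carrier_mat n n \<and> invertible_mat S"
proof
  assume "unit_mat n S"
  then show "S \<in> carrier_mat n n \<and> invertible_mat S"
    by (auto simp: unit_mat_def invertible_mat_def inverts_mat_def)
next
  assume *: "S \<in> carrier_mat n n \<and> invertible_mat S"
  then obtain T where S: "S \<in> carrier_mat n n" and T: "S * T = 1\<^sub>m n" "T * S = 1\<^sub>m (dim_row T)"
    by (auto simp: invertible_mat_def inverts_mat_def)
  have "dim_col T = n" using arg_cong[OF T(1), of dim_col] by simp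
  moreover have "dim_row T = n" using arg_cong[OF T(2), of dim_col] S by simp
  ultimately have "T \<in> carrier_mat n n" by auto
  then show "unit_mat n S" using S T(1) by (auto intro: unit_matI)
qed

lemma unit_mat_mult: "unit_mat n S \<Longrightarrow> unit_mat n T \<Longrightarrow> unit_mat n (S * T)"
  by (auto simp: unit_mat_iff_det det_mult)

lemma unit_mat_smult: "c \<noteq> 0 \<Longrightarrow> unit_mat n S \<Longrightarrow> unit_mat n (c \<cdot>\<^sub>m S)"
  by (auto simp: unit_mat_iff_det)

lemma unit_mat_transpose: "unit_mat n S \<Longrightarrow> unit_mat n (transpose_mat S)"
  by (auto simp: unit_mat_iff_det det_transpose)

lemma unit_mat_lower_block:
  assumes "unit_mat m S" "unit_mat n T" "Z \<in> carrier_mat n m"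
  shows "unit_mat (m + n) (four_block_mat S (0\<^sub>m m n) Z T)"
  using assms det_four_block_mat_upper_right_zero[of S m "0\<^sub>m m n" n Z T]
  by (auto simp: unit_mat_iff_det)

lemma unit_mat_upper_block:
  assumes "unit_mat m S" "unit_mat n T" "Z \<in> carrier_mat m n"
  shows "unit_mat (m + n) (four_block_mat S Z (0\<^sub>m n m) T)"
  using assms det_four_block_mat_lower_left_zero[of S m Z n "0\<^sub>m n m" T]
  by (auto simp: unit_mat_iff_det)

lemma pair_isoI:
  assumes "P \<in> pair_space m n" "Q \<in> pair_space m n" "unit_mat m S" "unit_mat n R" "pair_hom P Q S R"
  shows "pair_iso m n P Q"
  using assms by (auto simp: pair_iso_def)

lemma pair_iso_space: "pair_iso m n P Q \<Longrightarrow> P \<in> pair_space m n" "pair_iso m n P Q \<Longrightarrow> Q \<in> pair_space m n"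
  by (auto simp: pair_iso_def)

lemma pair_iso_refl: "P \<in> pair_space m n \<Longrightarrow> pair_iso m n P P"
  by (rule pair_isoI[of _ _ _ _ "1\<^sub>m m" "1\<^sub>m n"]) (auto simp: pair_hom_def pair_space_iff)

lemma intertwine_inverse:
  fixes A B R R' S S' :: "complex mat"
  assumes "A \<in> carrier_mat m n" "B \<in> carrier_mat m n" "S \<in> carrier_mat m m" "R \<in> carrier_mat n n"
    "S' \<in> carrier_mat m m" "R' \<in> carrier_mat n n" "S' * S = 1\<^sub>m m" "R * R' = 1\<^sub>m n"
    and eq: "S * A = B * R"
  shows "S' * B = A * R'"
proof -
  have "S' * B = S' * (B * (R * R'))" using assms(8) right_mult_one_mat[OF assms(2)] by simp
  also have "B * (R * R') = (S * A) * R'" using assms(1-6) by (simp add: eq assoc_mult_mat[of _ m n _ n _ n])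
  also have "S' * (S * A * R') = (S' * S) * A * R'"
    using assms(1-6) by (simp add: assoc_mult_mat[of _ m m _ n _ n] assoc_mult_mat[of _ m m _ m _ n])
  finally show ?thesis using assms(1,7) by simp
qed

lemma pair_iso_sym:
  assumes "pair_iso m n P Q" shows "pair_iso m n Q P"
proof -
  obtain S R where P: "P \<in> pair_space m n" and Q: "Q \<in> pair_space m n"
    and u: "unit_mat m S" "unit_mat n R" and h: "pair_hom P Q S R"
    using assms by (auto simp: pair_iso_def)
  obtain S' R' where S': "S' \<in> carrier_mat m m" "S * S' = 1\<^sub>m m" "S' * S = 1\<^sub>m m"
    and R': "R' \<in> carrier_mat n n" "R * R' = 1\<^sub>m n" "R' * R = 1\<^sub>m n"
    using u by (auto simp: unit_mat_def)
  have "unit_mat m S'" "unit_mat n R'"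
    using S' R' unit_mat_carrier[OF u(1)] unit_mat_carrier[OF u(2)] by (auto simp: unit_mat_def)
  moreover have "pair_hom Q P S' R'"
    using P Q h S' R' unit_mat_carrier[OF u(1)] unit_mat_carrier[OF u(2)]
    by (auto simp: pair_hom_def pair_space_iff intro!: intertwine_inverse[of _ m n _ S R])
  ultimately show ?thesis using P Q by (auto simp: pair_iso_def)
qed

lemma pair_hom_comp:
  assumes P: "P \<in> pair_space m n" and Q: "Q \<in> pair_space k l" and T: "T \<in> pair_space i j"
    and c: "S \<in> carrier_mat k m" "R \<in> carrier_mat l n" "S' \<in> carrier_mat i k" "R' \<in> carrier_mat j l"
    and h: "pair_hom P Q S R" "pair_hom Q T S' R'"
  shows "pair_hom P T (S' * S) (R' * R)"
proof -
  have *: "S' * S * A = C * (R' * R)"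
    if "A \<in> carrier_mat m n" "B \<in> carrier_mat k l" "C \<in> carrier_mat i j"
      and e: "S * A = B * R" "S' * B = C * R'" for A B C
  proof -
    have "S' * S * A = S' * (B * R)" using that c by (simp add: assoc_mult_mat[of _ i k _ m _ n])
    also have "\<dots> = C * R' * R" using that c
      by (simp add: assoc_mult_mat[of S' i k B l R n, symmetric])
    also have "\<dots> = C * (R' * R)" using that c by (simp add: assoc_mult_mat[of _ i j _ l _ n])
    finally show ?thesis .
  qed
  show ?thesis
    using P Q T h *[of "fst P" "fst Q" "fst T"] *[of "snd P" "snd Q" "snd T"]
    by (simp add: pair_hom_def pair_space_iff)
qed

lemma pair_iso_trans [trans]:
  assumes "pair_iso m n P Q" "pair_iso m n Q T" shows "pair_iso m n P T"
proof -
  obtain S R where P: "P \<in> pair_space m n" and Q: "Q \<in> pair_space m n"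
    and u: "unit_mat m S" "unit_mat n R" and h: "pair_hom P Q S R"
    using assms by (auto simp: pair_iso_def)
  obtain S' R' where T: "T \<in> pair_space m n"
    and u': "unit_mat m S'" "unit_mat n R'" and h': "pair_hom Q T S' R'"
    using assms by (auto simp: pair_iso_def)
  show ?thesis
    using pair_hom_comp[OF P Q T _ _ _ _ h h'] unit_mat_mult u u' P T
    by (auto intro!: pair_isoI[of _ _ _ _ "S' * S" "R' * R"] dest: unit_mat_carrier)
qed

lemma mem_pair_orbit_iff:
  assumes "P \<in> pair_space m n"
  shows "Q \<in> pair_orbit P \<longleftrightarrow> pair_iso m n P Q"
proof
  assume "Q \<in> pair_orbit P"
  then obtain S R where Q: "Q = (S * fst P * R, S * snd P * R)"
    and S: "unit_mat m S" and R: "unit_mat n R"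
    using assms by (auto simp: pair_orbit_def pair_space_iff unit_mat_iff_invertible)
  obtain R' where R': "R' \<in> carrier_mat n n" "R * R' = 1\<^sub>m n" "R' * R = 1\<^sub>m n"
    using R by (auto simp: unit_mat_def)
  note c = unit_mat_carrier[OF S] unit_mat_carrier[OF R]
  have "S * A * R * R' = S * A" if "A \<in> carrier_mat m n" for A
    using that c R' assoc_mult_mat[of "S * A" m n R n R' n] right_mult_one_mat[of "S * A" m n] by auto
  then have "pair_hom P Q S R'"
    using assms by (simp add: pair_hom_def Q pair_space_iff)
  moreover have "unit_mat n R'" using R' c by (auto simp: unit_mat_def)
  ultimately show "pair_iso m n P Q"
    using assms S c R' by (auto intro!: pair_isoI[of _ _ _ _ S R'] simp: Q pair_space_iff)
next
  assume "pair_iso m n P Q"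
  then obtain S R where Q: "Q \<in> pair_space m n"
    and u: "unit_mat m S" "unit_mat n R" and h: "pair_hom P Q S R"
    by (auto simp: pair_iso_def)
  obtain R' where R': "R' \<in> carrier_mat n n" "R * R' = 1\<^sub>m n" "R' * R = 1\<^sub>m n"
    using u by (auto simp: unit_mat_def)
  note c = unit_mat_carrier[OF u(1)] unit_mat_carrier[OF u(2)]
  have "S * fst P * R' = fst Q" "S * snd P * R' = snd Q"
    using h Q c R' by (auto simp: pair_hom_def pair_space_iff assoc_mult_mat[of _ m n _ n _ n])
  moreover have "unit_mat n R'" using R' c by (auto simp: unit_mat_def)
  ultimately show "Q \<in> pair_orbit P"
    using u assms unfolding pair_orbit_def mem_Collect_eq
    by (intro exI[of _ S] exI[of _ R']) (auto simp: pair_space_iff unit_mat_iff_invertible)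
qed

lemma pair_orbit_eq_iff:
  assumes "P \<in> pair_space m n" "Q \<in> pair_space m n"
  shows "pair_orbit P = pair_orbit Q \<longleftrightarrow> pair_iso m n P Q"
  using mem_pair_orbit_iff[OF assms(1)] mem_pair_orbit_iff[OF assms(2)] assms
  by (blast intro: pair_iso_refl pair_iso_sym pair_iso_trans)

text \<open>Permutation matrices do it. Most later regroupings of blocks are instances, which
  reduces them to comparing entries under an explicit index map.\<close>

lemma pair_iso_perm:
  assumes P: "P \<in> pair_space m n"
    and bij: "bij_betw \<pi> {..<m} {..<m}" "bij_betw \<sigma> {..<n} {..<n}"
    and Q: "Q \<in> pair_space m n"
    and fst: "\<And>i j. i < m \<Longrightarrow> j < n \<Longrightarrow> fst Q $$ (i, j) = fst P $$ (\<pi> i, \<sigma> j)"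
    and snd: "\<And>i j. i < m \<Longrightarrow> j < n \<Longrightarrow> snd Q $$ (i, j) = snd P $$ (\<pi> i, \<sigma> j)"
  shows "pair_iso m n P Q"
proof -
  define S :: "complex mat" where "S = mat m m (\<lambda>(i, k). if k = \<pi> i then 1 else 0)"
  define R :: "complex mat" where "R = mat n n (\<lambda>(j, k). if k = \<sigma> j then 1 else 0)"
  have unit: "unit_mat k (mat k k (\<lambda>(j, l). if l = \<rho> j then 1 else 0))"
    if \<rho>: "bij_betw \<rho> {..<k} {..<k}" for k \<rho>
  proof (rule unit_matI)
    let ?S = "mat k k (\<lambda>(j, l). if l = \<rho> j then 1 else 0) :: complex mat"
    show "?S * transpose_mat ?S = 1\<^sub>m k"
    proof (rule eq_matI, goal_cases)
      case (1 i j)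
      then have ij: "i < k" "j < k" by auto
      have in_k: "\<rho> i < k" using \<rho> ij by (auto dest: bij_betwE)
      have "(?S * transpose_mat ?S) $$ (i, j) =
          (\<Sum>l\<in>{0..<k}. (if l = \<rho> i then 1 else 0) * (if l = \<rho> j then 1 else 0))"
        using ij by (simp add: scalar_prod_def)
      also have "\<dots> = (\<Sum>l\<in>{0..<k}. if l = \<rho> i then (if \<rho> i = \<rho> j then 1 else 0) else 0)"
        by (rule sum.cong) auto
      also have "\<dots> = (if \<rho> i = \<rho> j then 1 else 0)" using in_k by simp
      also have "\<rho> i = \<rho> j \<longleftrightarrow> i = j" using \<rho> ij by (auto simp: bij_betw_def inj_on_def)
      finally show ?case using ij by simp
    qed auto
  qed auto
  have *: "S * A = B * R" if A: "A \<in> carrier_mat m n" and B: "B \<in> carrier_mat m n"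
    and AB: "\<And>i j. i < m \<Longrightarrow> j < n \<Longrightarrow> B $$ (i, j) = A $$ (\<pi> i, \<sigma> j)" for A B
  proof (rule eq_matI, goal_cases)
    case (1 i j)
    then have ij: "i < m" "j < n" using A B by (auto simp: R_def)
    have "(S * A) $$ (i, j) = (\<Sum>k\<in>{0..<m}. (if k = \<pi> i then 1 else 0) * A $$ (k, j))"
      using ij A by (auto simp: S_def scalar_prod_def)
    also have "\<dots> = (\<Sum>k\<in>{0..<m}. if k = \<pi> i then A $$ (\<pi> i, j) else 0)"
      by (rule sum.cong) auto
    also have "\<dots> = A $$ (\<pi> i, j)" using bij(1) ij by (auto dest: bij_betwE)
    finally have 1: "(S * A) $$ (i, j) = A $$ (\<pi> i, j)" .
    obtain j' where j': "j' < n" "j = \<sigma> j'"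
      using bij(2) ij by (auto simp: bij_betw_def image_def set_eq_iff)
    have "(B * R) $$ (i, j) = (\<Sum>k\<in>{0..<n}. B $$ (i, k) * (if j = \<sigma> k then 1 else 0))"
      using ij B by (auto simp: R_def scalar_prod_def)
    also have "\<dots> = (\<Sum>k\<in>{0..<n}. if k = j' then B $$ (i, k) else 0)"
      using j' bij(2) by (intro sum.cong) (auto simp: bij_betw_def inj_on_def)
    also have "\<dots> = B $$ (i, j')" using j' by simp
    finally show ?case using 1 AB[OF ij(1) j'(1)] j' by simp
  qed (use A B in \<open>auto simp: S_def R_def\<close>)
  have "pair_hom P Q S R"
    using P Q fst snd by (auto simp: pair_hom_def pair_space_iff intro!: *)
  then show ?thesis
    using P Q unit[OF bij(1)] unit[OF bij(2)] by (auto intro!: pair_isoI simp: S_def R_def)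
qed

text \<open>The extension with subobject \<open>P\<close> and quotient \<open>Q\<close>;
  \<open>X\<close> represents its class in Ext, and \<open>dsum\<close> is the split case.\<close>

definition ut :: "matrix_pair \<Rightarrow> matrix_pair \<Rightarrow> matrix_pair \<Rightarrow> matrix_pair" where
  "ut P X Q =
    (four_block_mat (fst P) (fst X) (0\<^sub>m (dim_row (fst Q)) (dim_col (fst P))) (fst Q),
     four_block_mat (snd P) (snd X) (0\<^sub>m (dim_row (snd Q)) (dim_col (snd P))) (snd Q))"

definition zero_pair :: "nat \<Rightarrow> nat \<Rightarrow> matrix_pair" where
  "zero_pair m n = (0\<^sub>m m n, 0\<^sub>m m n)"

definition dsum :: "matrix_pair \<Rightarrow> matrix_pair \<Rightarrow> matrix_pair" where
  "dsum P Q = ut P (zero_pair (dim_row (fst P)) (dim_col (fst Q))) Q"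

lemma zero_pair_space [simp]: "zero_pair m n \<in> pair_space m n"
  by (simp add: zero_pair_def pair_space_def)

lemma ut_space:
  "P \<in> pair_space a b \<Longrightarrow> Q \<in> pair_space c d \<Longrightarrow> ut P X Q \<in> pair_space (a + c) (b + d)"
  by (auto simp: ut_def pair_space_iff)

lemma dsum_space:
  "P \<in> pair_space a b \<Longrightarrow> Q \<in> pair_space c d \<Longrightarrow> dsum P Q \<in> pair_space (a + c) (b + d)"
  by (simp add: dsum_def ut_space)

lemma dsum_ut: "P \<in> pair_space a b \<Longrightarrow> Q \<in> pair_space c d \<Longrightarrow> dsum P Q = ut P (zero_pair a d) Q"
  by (auto simp: dsum_def pair_space_iff)

text \<open>Block multiplication leaves one new condition, in the upper right corner. The
  off-diagonal blocks \<open>Z\<close> and \<open>W\<close> contribute a coboundary there, so the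
  last two equations say that the classes correspond in Ext.\<close>

lemma ut_hom:
  assumes P: "P \<in> pair_space a b" "P' \<in> pair_space a' b'" and Q: "Q \<in> pair_space c d" "Q' \<in> pair_space c' d'"
    and X: "X \<in> pair_space a d" "X' \<in> pair_space a' d'"
    and c: "S1 \<in> carrier_mat a' a" "R1 \<in> carrier_mat b' b" "S2 \<in> carrier_mat c' c" "R2 \<in> carrier_mat d' d"
      "Z \<in> carrier_mat a' c" "W \<in> carrier_mat b' d"
    and h: "pair_hom P P' S1 R1" "pair_hom Q Q' S2 R2"
    and "S1 * fst X + Z * fst Q = fst P' * W + fst X' * R2"
    and "S1 * snd X + Z * snd Q = snd P' * W + snd X' * R2"
  shows "pair_hom (ut P X Q) (ut P' X' Q')
    (four_block_mat S1 Z (0\<^sub>m c' a) S2) (four_block_mat R1 W (0\<^sub>m d' b) R2)"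
proof -
  have *: "four_block_mat S1 Z (0\<^sub>m c' a) S2 * four_block_mat A Y (0\<^sub>m (dim_row B) (dim_col A)) B =
      four_block_mat A' Y' (0\<^sub>m (dim_row B') (dim_col A')) B' * four_block_mat R1 W (0\<^sub>m d' b) R2"
    if cc: "A \<in> carrier_mat a b" "A' \<in> carrier_mat a' b'" "B \<in> carrier_mat c d" "B' \<in> carrier_mat c' d'"
      "Y \<in> carrier_mat a d" "Y' \<in> carrier_mat a' d'"
      and e: "S1 * A = A' * R1" "S2 * B = B' * R2" "S1 * Y + Z * B = A' * W + Y' * R2"
    for A A' B B' Y Y'
  proof -
    have "four_block_mat S1 Z (0\<^sub>m c' a) S2 * four_block_mat A Y (0\<^sub>m c b) B =
        four_block_mat (S1 * A) (S1 * Y + Z * B) (0\<^sub>m c' b) (S2 * B)"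
      using c cc by (subst mult_four_block_mat[of _ a' a _ c _ c' _ _ b _ d]) auto
    moreover have "four_block_mat A' Y' (0\<^sub>m c' b') B' * four_block_mat R1 W (0\<^sub>m d' b) R2 =
        four_block_mat (A' * R1) (A' * W + Y' * R2) (0\<^sub>m c' b) (B' * R2)"
      using c cc by (subst mult_four_block_mat[of _ a' b' _ d' _ c' _ _ b _ d]) auto
    ultimately show ?thesis using e cc by simp
  qed
  show ?thesis
    using assms unfolding pair_hom_def ut_def fst_conv snd_conv
    by (intro conjI *) (auto simp: pair_space_iff pair_hom_def)
qed

lemma ut_iso:
  assumes P: "P \<in> pair_space a b" "P' \<in> pair_space a b" and Q: "Q \<in> pair_space c d" "Q' \<in> pair_space c d"
    and X: "X \<in> pair_space a d" "X' \<in> pair_space a d"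
    and u: "unit_mat a S1" "unit_mat b R1" "unit_mat c S2" "unit_mat d R2"
    and ZW: "Z \<in> carrier_mat a c" "W \<in> carrier_mat b d"
    and h: "pair_hom P P' S1 R1" "pair_hom Q Q' S2 R2"
    and e: "S1 * fst X + Z * fst Q = fst P' * W + fst X' * R2"
     "S1 * snd X + Z * snd Q = snd P' * W + snd X' * R2"
  shows "pair_iso (a + c) (b + d) (ut P X Q) (ut P' X' Q')"
proof (rule pair_isoI)
  show "pair_hom (ut P X Q) (ut P' X' Q')
    (four_block_mat S1 Z (0\<^sub>m c a) S2) (four_block_mat R1 W (0\<^sub>m d b) R2)"
    using u by (intro ut_hom[OF P Q X]) (auto simp: unit_mat_carrier h e ZW)
qed (use assms in \<open>auto simp: ut_space unit_mat_upper_block\<close>)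

lemma ut_cong:
  assumes "pair_iso a b P P'" "pair_iso c d Q Q'" "X \<in> pair_space a d"
  shows "\<exists>X' \<in> pair_space a d. pair_iso (a + c) (b + d) (ut P X Q) (ut P' X' Q')"
proof -
  obtain S1 R1 where P: "P \<in> pair_space a b" "P' \<in> pair_space a b"
    and u: "unit_mat a S1" "unit_mat b R1" and h: "pair_hom P P' S1 R1"
    using assms by (auto simp: pair_iso_def)
  obtain S2 R2 where Q: "Q \<in> pair_space c d" "Q' \<in> pair_space c d"
    and u': "unit_mat c S2" "unit_mat d R2" and h': "pair_hom Q Q' S2 R2"
    using assms by (auto simp: pair_iso_def)
  obtain T where T: "T \<in> carrier_mat d d" "R2 * T = 1\<^sub>m d" "T * R2 = 1\<^sub>m d"
    using u' by (auto simp: unit_mat_def)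
  \<comment> \<open>The class is pushed out along \<open>S1\<close> and pulled back along the
    inverse \<open>T\<close> of \<open>R2\<close>.\<close>
  define X' where "X' = (S1 * fst X * T, S1 * snd X * T)"
  have X': "X' \<in> pair_space a d" using assms T unit_mat_carrier[OF u(1)]
    by (auto simp: X'_def pair_space_iff)
  have "pair_iso (a + c) (b + d) (ut P X Q) (ut P' X' Q')"
    using P Q X' assms T u u' unit_mat_carrier[OF u'(2)] unit_mat_carrier[OF u(1)]
    by (intro ut_iso[OF P Q _ _ u u' _ _ h h', of _ _ "0\<^sub>m a c" "0\<^sub>m b d"])
      (auto simp: X'_def pair_space_iff assoc_mult_mat[of _ a d _ d _ d])
  then show ?thesis using X' by auto
qed

lemma dsum_cong:
  assumes "pair_iso a b P P'" "pair_iso c d Q Q'"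
  shows "pair_iso (a + c) (b + d) (dsum P Q) (dsum P' Q')"
proof -
  obtain S1 R1 where P: "P \<in> pair_space a b" "P' \<in> pair_space a b"
    and u: "unit_mat a S1" "unit_mat b R1" and h: "pair_hom P P' S1 R1"
    using assms by (auto simp: pair_iso_def)
  obtain S2 R2 where Q: "Q \<in> pair_space c d" "Q' \<in> pair_space c d"
    and u': "unit_mat c S2" "unit_mat d R2" and h': "pair_hom Q Q' S2 R2"
    using assms by (auto simp: pair_iso_def)
  show ?thesis unfolding dsum_ut[OF P(1) Q(1)] dsum_ut[OF P(2) Q(2)]
    using P Q unit_mat_carrier[OF u'(2)] unit_mat_carrier[OF u(1)]
    by (intro ut_iso[OF P Q _ _ u u' _ _ h h', of _ _ "0\<^sub>m a c" "0\<^sub>m b d"])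
      (auto simp: zero_pair_def pair_space_iff)
qed

lemma dsum_assoc: 
  assumes "P \<in> pair_space a b" "Q \<in> pair_space c d" "T \<in> pair_space e f"
  shows "dsum P (dsum Q T) = dsum (dsum P Q) T"
  using assms assoc_four_block_mat[of "fst P" "fst Q" "fst T"] assoc_four_block_mat[of "snd P" "snd Q" "snd T"]
  by (auto simp: dsum_def ut_def zero_pair_def pair_space_iff)

definition block_swap :: "nat \<Rightarrow> nat \<Rightarrow> nat \<Rightarrow> nat" where
  "block_swap a c i = (if i < c then a + i else i - c)"

lemma bij_block_swap: "bij_betw (block_swap a c) {..<a + c} {..<a + c}"
  by (rule bij_betw_byWitness[where f' = "block_swap c a"]) (auto simp: block_swap_def)

lemma four_block_swap:
  assumes "A \<in> carrier_mat a b" "E \<in> carrier_mat c d" "B \<in> carrier_mat a d" "C \<in> carrier_mat c b"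
    "A' \<in> carrier_mat a b" "E' \<in> carrier_mat c d" "B' \<in> carrier_mat a d" "C' \<in> carrier_mat c b"
  shows "pair_iso (a + c) (b + d) (four_block_mat A B C E, four_block_mat A' B' C' E')
     (four_block_mat E C B A, four_block_mat E' C' B' A')"
  using assms
  by (intro pair_iso_perm[where \<pi> = "block_swap a c" and \<sigma> = "block_swap b d"])
    (auto simp: pair_space_iff bij_block_swap block_swap_def)

lemma dsum_comm:
  assumes "P \<in> pair_space a b" "Q \<in> pair_space c d"
  shows "pair_iso (a + c) (b + d) (dsum P Q) (dsum Q P)"
  using assms unfolding dsum_def ut_def zero_pair_def
  by (auto simp: pair_space_iff intro!: four_block_swap)

section \<open>Direct sums\<close>

fun summand_rows :: "summand \<Rightarrow> nat" where
  "summand_rows (LT n) = n"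
| "summand_rows (D a n) = n"
| "summand_rows (L n) = n - 1"

fun summand_cols :: "summand \<Rightarrow> nat" where
  "summand_cols (LT n) = n - 1"
| "summand_cols (D a n) = n"
| "summand_cols (L n) = n"

lemma summand_space: "summand_pair x \<in> pair_space (summand_rows x) (summand_cols x)"
  by (induction x rule: summand_pair.induct) (auto simp: pair_space_iff L_mat_def R_mat_def)

lemma summand_dims [simp]:
  "dim_row (fst (summand_pair x)) = summand_rows x" "dim_row (snd (summand_pair x)) = summand_rows x"
  "dim_col (fst (summand_pair x)) = summand_cols x" "dim_col (snd (summand_pair x)) = summand_cols x"
  using summand_space[of x] by (auto simp: pair_space_iff)

lemma row_count_simps [simp]:
  "row_count [] = 0" "row_count (x # xs) = summand_rows x + row_count xs"
  "row_count (xs @ ys) = row_count xs + row_count ys"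
  by (simp_all add: row_count_def)

lemma col_count_simps [simp]:
  "col_count [] = 0" "col_count (x # xs) = summand_cols x + col_count xs"
  "col_count (xs @ ys) = col_count xs + col_count ys"
  by (simp_all add: col_count_def)

lemma direct_sum_dims [simp]:
  "dim_row (fst (direct_sum xs)) = row_count xs" "dim_row (snd (direct_sum xs)) = row_count xs"
  "dim_col (fst (direct_sum xs)) = col_count xs" "dim_col (snd (direct_sum xs)) = col_count xs"
  using direct_sum_in_pair_space[of xs] by (auto simp: pair_space_iff)

lemma direct_sum_Nil: "direct_sum [] = zero_pair 0 0"
  by (simp add: direct_sum_def zero_pair_def)

lemma direct_sum_Cons: "direct_sum (x # xs) = dsum (summand_pair x) (direct_sum xs)"
  by (simp add: direct_sum_def dsum_def ut_def zero_pair_def Let_def dim_diag_block_mat o_def)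

lemma dsum_zero_left: "P \<in> pair_space m n \<Longrightarrow> dsum (zero_pair 0 0) P = P"
  by (auto simp: dsum_def ut_def zero_pair_def pair_space_iff intro!: prod_eqI eq_matI)

lemma dsum_zero_right: "P \<in> pair_space m n \<Longrightarrow> dsum P (zero_pair 0 0) = P"
  by (auto simp: dsum_def ut_def zero_pair_def pair_space_iff intro!: prod_eqI eq_matI)

lemma direct_sum_single [simp]: "direct_sum [x] = summand_pair x"
  using dsum_zero_right[OF summand_space] by (simp add: direct_sum_Cons direct_sum_Nil)

lemma direct_sum_append: "direct_sum (xs @ ys) = dsum (direct_sum xs) (direct_sum ys)"
proof (induction xs)
  case Nil
  then show ?case using dsum_zero_left[OF direct_sum_in_pair_space] by (simp add: direct_sum_Nil)
next
  case (Cons x xs)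
  then show ?case
    using dsum_assoc[OF summand_space direct_sum_in_pair_space direct_sum_in_pair_space]
    by (simp add: direct_sum_Cons)
qed

lemma row_count_mset: "mset xs = mset ys \<Longrightarrow> row_count xs = row_count ys"
  unfolding row_count_def by (metis mset_map sum_mset_sum_list)

lemma col_count_mset: "mset xs = mset ys \<Longrightarrow> col_count xs = col_count ys"
  unfolding col_count_def by (metis mset_map sum_mset_sum_list)

lemma direct_sum_perm:
  assumes "mset xs = mset ys"
  shows "pair_iso (row_count xs) (col_count xs) (direct_sum xs) (direct_sum ys)"
  using assms
proof (induction xs arbitrary: ys)
  case Nil
  then show ?case by (simp add: direct_sum_Nil pair_iso_refl)
next
  case (Cons x xs)
  then have "x \<in> set ys" by (metis list.set_intros(1) set_mset_mset)
  then obtain us vs where ys: "ys = us @ x # vs" by (meson split_list)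
  note sp = summand_space[of x] direct_sum_in_pair_space[of us] direct_sum_in_pair_space[of vs]
  have *: "mset xs = mset (us @ vs)" using Cons.prems ys by simp
  have "pair_iso (row_count (x # xs)) (col_count (x # xs)) (direct_sum (x # xs))
      (dsum (summand_pair x) (direct_sum (us @ vs)))"
    using dsum_cong[OF pair_iso_refl[OF sp(1)] Cons.IH[OF *]] by (simp add: direct_sum_Cons)
  also have "dsum (summand_pair x) (direct_sum (us @ vs)) =
      dsum (dsum (summand_pair x) (direct_sum us)) (direct_sum vs)"
    using dsum_assoc[OF sp] by (simp add: direct_sum_append)
  also have "pair_iso (row_count (x # xs)) (col_count (x # xs)) \<dots>
      (dsum (dsum (direct_sum us) (summand_pair x)) (direct_sum vs))"
    using dsum_cong[OF dsum_comm[OF sp(1,2)] pair_iso_refl[OF sp(3)]]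
      row_count_mset[OF *] col_count_mset[OF *] by (simp add: add.assoc)
  also have "dsum (dsum (direct_sum us) (summand_pair x)) (direct_sum vs) = direct_sum ys"
    using dsum_assoc[OF sp(2,1,3)] by (simp add: ys direct_sum_append direct_sum_Cons)
  finally show ?case .
qed

definition point_pair :: matrix_pair where
  "point_pair = (1\<^sub>m 1, 0\<^sub>m 1 1)"

text \<open>An extension of the Jordan pair \<open>(1, 0)\<close> by \<open>P\<close>. In the first
  matrix the new column can always be cleared with the entry 1 of \<open>fst point_pair\<close>, so
  a class is given by the vector \<open>x\<close> alone.\<close>

definition colext :: "matrix_pair \<Rightarrow> complex vec \<Rightarrow> matrix_pair" where
  "colext P x = ut P (0\<^sub>m (dim_vec x) 1, mat (dim_vec x) 1 (\<lambda>(i, j). x $ i)) point_pair"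

lemma point_pair_space [simp]: "point_pair \<in> pair_space 1 1"
  by (simp add: point_pair_def pair_space_iff)

lemma colext_space: "P \<in> pair_space m n \<Longrightarrow> colext P x \<in> pair_space (m + 1) (n + 1)"
  unfolding colext_def by (intro ut_space point_pair_space)

text \<open>The first matrices force \<open>Z = fst Q * W\<close>, and then the second ones ask
  exactly for \<open>S x = y + snd Q t\<close>. What counts is therefore the class of the vector in
  the cokernel of \<open>snd Q\<close>.\<close>

lemma colext_iso:
  assumes P: "P \<in> pair_space m n" and Q: "Q \<in> pair_space m n"
    and u: "unit_mat m S" "unit_mat n R" and h: "pair_hom P Q S R"
    and v: "x \<in> carrier_vec m" "y \<in> carrier_vec m" "t \<in> carrier_vec n"
    and e: "S *\<^sub>v x = y + snd Q *\<^sub>v t"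
  shows "pair_iso (m + 1) (n + 1) (colext P x) (colext Q y)"
proof -
  define W where "W = mat n 1 (\<lambda>(i, j). t $ i)"
  have W: "W \<in> carrier_mat n 1" by (simp add: W_def)
  note cu = unit_mat_carrier[OF u(1)] unit_mat_carrier[OF u(2)]
  have colm: "A * mat k 1 (\<lambda>(i, j). z $ i) = mat m 1 (\<lambda>(i, j). (A *\<^sub>v z) $ i)"
    if "A \<in> carrier_mat m k" "z \<in> carrier_vec k" for A z k
    using that by (intro eq_matI) (auto simp: scalar_prod_def)
  have "pair_iso (m + 1) (n + 1) 
      (ut P (0\<^sub>m m 1, mat m 1 (\<lambda>(i, j). x $ i)) point_pair)
      (ut Q (0\<^sub>m m 1, mat m 1 (\<lambda>(i, j). y $ i)) point_pair)"
  proof (rule ut_iso[OF P Q point_pair_space point_pair_space _ _ u _ _ _ W h])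
    show "fst Q * W \<in> carrier_mat m 1" using Q W by (auto simp: pair_space_iff)
    show "unit_mat 1 (1\<^sub>m 1)" "unit_mat 1 (1\<^sub>m 1)" by simp_all
    show "pair_hom point_pair point_pair (1\<^sub>m 1) (1\<^sub>m 1)"
      by (auto simp: pair_hom_def point_pair_def intro!: eq_matI)
    show "S * fst (0\<^sub>m m 1, mat m 1 (\<lambda>(i, j). x $ i)) + fst Q * W * fst point_pair =
        fst Q * W + fst (0\<^sub>m m 1, mat m 1 (\<lambda>(i, j). y $ i)) * (1\<^sub>m 1)"
      using Q W cu by (auto simp: point_pair_def pair_space_iff)
    have "S * mat m 1 (\<lambda>(i, j). x $ i) + fst Q * W * 0\<^sub>m 1 1 = mat m 1 (\<lambda>(i, j). (S *\<^sub>v x) $ i)"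
      using Q W cu v by (auto simp: colm pair_space_iff simp del: One_nat_def)
    also have "\<dots> = snd Q * W + mat m 1 (\<lambda>(i, j). y $ i) * (1\<^sub>m 1)"
      unfolding W_def e using Q v by (subst colm) (auto simp: pair_space_iff intro!: eq_matI)
    finally show "S * snd (0\<^sub>m m 1, mat m 1 (\<lambda>(i, j). x $ i)) + fst Q * W * snd point_pair =
        snd Q * W + snd (0\<^sub>m m 1, mat m 1 (\<lambda>(i, j). y $ i)) * (1\<^sub>m 1)"
      by (simp add: point_pair_def)
  qed (auto simp: pair_space_iff)
  then show ?thesis using v by (simp add: colext_def)
qed

lemma colext_zero:
  assumes "P \<in> pair_space m n"
  shows "colext P (0\<^sub>v m) = dsum P point_pair"
proof -
  have "mat m 1 (\<lambda>(i, j). 0\<^sub>v m $ i) = (0\<^sub>m m 1 :: complex mat)" by (auto intro!: eq_matI)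
  then show ?thesis
    using assms by (simp add: colext_def dsum_ut[OF assms point_pair_space] zero_pair_def)
qed

lemma colext_dsum_left:
  assumes P: "P \<in> pair_space a b" and Q: "Q \<in> pair_space c d" and x: "x \<in> carrier_vec a"
  shows "pair_iso (a + c + 1) (b + d + 1) (colext (dsum P Q) (x @\<^sub>v 0\<^sub>v c)) (dsum (colext P x) Q)"
proof (rule pair_iso_perm)
  let ?s = "\<lambda>a c i. if i < a then i else a + block_swap c 1 (i - a)"
  have *: "bij_betw (?s a c) {..<a + c + 1} {..<a + c + 1}" for a c
    by (rule bij_betw_byWitness[where f' = "\<lambda>i. if i < a then i else a + block_swap 1 c (i - a)"])
      (auto simp: block_swap_def)
  show "bij_betw (?s a c) {..<a + c + 1} {..<a + c + 1}" "bij_betw (?s b d) {..<b + d + 1} {..<b + d + 1}"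
    by (rule *)+
  show "colext (dsum P Q) (x @\<^sub>v 0\<^sub>v c) \<in> pair_space (a + c + 1) (b + d + 1)"
    using assms by (intro colext_space dsum_space)
  show "dsum (colext P x) Q \<in> pair_space (a + c + 1) (b + d + 1)"
    using dsum_space[OF colext_space[OF P] Q, of x] by (simp add: ac_simps)
  fix i j assume ij: "i < a + c + 1" "j < b + d + 1"
  show "fst (dsum (colext P x) Q) $$ (i, j) = fst (colext (dsum P Q) (x @\<^sub>v 0\<^sub>v c)) $$ (?s a c i, ?s b d j)"
    using assms ij
    by (auto simp: colext_def dsum_def ut_def zero_pair_def point_pair_def pair_space_iff block_swap_def)
  show "snd (dsum (colext P x) Q) $$ (i, j) = snd (colext (dsum P Q) (x @\<^sub>v 0\<^sub>v c)) $$ (?s a c i, ?s b d j)"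
    using assms ij
    by (auto simp: colext_def dsum_def ut_def zero_pair_def point_pair_def pair_space_iff block_swap_def)
qed

section \<open>One-column extensions\<close>

text \<open>For growable \<open>x\<close>, the one-column extension of \<open>x\<close> by \<open>std x\<close> is equivalent to \<open>grow x\<close>.\<close>

fun std :: "summand \<Rightarrow> complex vec" where
  "std (LT m) = unit_vec m 0"
| "std (D a k) = unit_vec k (k - 1)"
| "std (L n) = 0\<^sub>v (n - 1)"

fun grow :: "summand \<Rightarrow> summand" where
  "grow (LT m) = LT (Suc m)"
| "grow (D a k) = D a (Suc k)"
| "grow (L n) = L n"

text \<open>Among valid summands these are the ones whose second matrix is not onto; its cokernel is
  then spanned by the class of \<open>std x\<close>. The empty block \<open>D (Finite 0) 0\<close>
  is included so that a block of size 1 arises by growing.\<close>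

fun growable :: "summand \<Rightarrow> bool" where
  "growable (LT m) = (1 \<le> m)"
| "growable (D (Finite a) k) = (a = 0)"
| "growable _ = False"

lemma std_carrier [simp]: "std x \<in> carrier_vec (summand_rows x)"
  by (cases x) auto

lemma dim_std [simp]: "dim_vec (std x) = summand_rows x"
  using std_carrier by auto

text \<open>For the nilpotent Jordan block the new row and column are simply the next ones. For
  \<open>LT m\<close> they have to be moved to the front, because \<open>std\<close> points at row
  0, the only row missed by the second matrix.\<close>

lemma colext_std:
  assumes "growable x"
  shows "pair_iso (summand_rows x + 1) (summand_cols x + 1) (colext (summand_pair x) (std x)) (summand_pair (grow x))"
  using assms
proof (induction x rule: growable.induct)
  case (1 m)
  show ?case
  proof (rule pair_iso_perm[where \<pi> = "block_swap m 1" and \<sigma> = "block_swap (m - 1) 1"])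
    show "colext (summand_pair (LT m)) (std (LT m)) \<in> pair_space (summand_rows (LT m) + 1) (summand_cols (LT m) + 1)"
      by (intro colext_space summand_space)
    show "summand_pair (grow (LT m)) \<in> pair_space (summand_rows (LT m) + 1) (summand_cols (LT m) + 1)"
      using summand_space[of "LT (Suc m)"] 1 by simp
  qed (use 1 bij_block_swap[of m 1] bij_block_swap[of "m - 1" 1] in
     \<open>auto simp: colext_def ut_def point_pair_def L_mat_def R_mat_def block_swap_def\<close>)
next
  case (2 a k)
  have "colext (summand_pair (D (Finite a) k)) (std (D (Finite a) k)) = summand_pair (grow (D (Finite a) k))"
    using 2 by (auto simp: colext_def ut_def point_pair_def jordan_block_def intro!: prod_eqI eq_matI)
  then show ?case using summand_space[of "D (Finite a) (Suc k)"] by (simp add: pair_iso_refl)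
qed auto

lemma select_mult_left:
  assumes "A \<in> carrier_mat m n" "i < p" "j < n"
  shows "(mat p m (\<lambda>(i, k). if h i k then 1 else 0) * A) $$ (i, j) =
    (\<Sum>k \<in> {k. k < m \<and> h i k}. A $$ (k, j) :: complex)"
proof -
  have "(mat p m (\<lambda>(i, k). if h i k then 1 else 0) * A) $$ (i, j) =
      (\<Sum>k \<in> {0..<m}. (if h i k then 1 else 0) * A $$ (k, j))"
    using assms by (auto simp: scalar_prod_def)
  also have "\<dots> = (\<Sum>k \<in> {0..<m}. if h i k then A $$ (k, j) else 0)" by (rule sum.cong) auto
  also have "\<dots> = (\<Sum>k \<in> {k. k < m \<and> h i k}. A $$ (k, j))"
    by (subst sum.inter_filter[symmetric]) auto
  finally show ?thesis .
qed

lemma select_mult_right: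
  assumes "A \<in> carrier_mat m n" "i < m" "j < p"
  shows "(A * mat n p (\<lambda>(k, j). if h k j then 1 else 0)) $$ (i, j) =
    (\<Sum>k \<in> {k. k < n \<and> h k j}. A $$ (i, k) :: complex)"
proof -
  have "(A * mat n p (\<lambda>(k, j). if h k j then 1 else 0)) $$ (i, j) =
      (\<Sum>k \<in> {0..<n}. A $$ (i, k) * (if h k j then 1 else 0))"
    using assms by (auto simp: scalar_prod_def)
  also have "\<dots> = (\<Sum>k \<in> {0..<n}. if h k j then A $$ (i, k) else 0)" by (rule sum.cong) auto
  also have "\<dots> = (\<Sum>k \<in> {k. k < n \<and> h k j}. A $$ (i, k))"
    by (subst sum.inter_filter[symmetric]) auto
  finally show ?thesis .
qed

lemma select_mult_unit:
  assumes "l < m"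
  shows "mat p m (\<lambda>(i, k). if h i k then 1 else 0) *\<^sub>v unit_vec m l = vec p (\<lambda>i. if h i l then 1 else (0 :: complex))"
  using assms by (intro eq_vecI) auto

text \<open>Made so that some homomorphism carries \<open>std x\<close> to \<open>std y\<close>
  (\<open>maps_to_hom\<close>) and any two growable summands are comparable
  (\<open>maps_to_total\<close>): of two nonzero classes in different summands, one can then always
  be cancelled with the other.\<close>

fun maps_to :: "summand \<Rightarrow> summand \<Rightarrow> bool" where
  "maps_to (LT a) (LT b) = (1 \<le> a \<and> a \<le> b)"
| "maps_to (LT a) (D (Finite c) k) = (1 \<le> a \<and> c = 0)"
| "maps_to (D (Finite c) k) (D (Finite d) l) = (c = 0 \<and> d = 0 \<and> l \<le> k)"
| "maps_to _ _ = False"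

lemma maps_to_growable: "maps_to x y \<Longrightarrow> growable x" "maps_to x y \<Longrightarrow> growable y"
  by (induction x y rule: maps_to.induct) auto

lemma maps_to_total:
  assumes "growable x" "growable y" shows "maps_to x y \<or> maps_to y x"
  using assms by (elim growable.elims(2)) auto

lemma LR_mat_dims [simp]:
  "dim_row (L_mat n) = n - Suc 0" "dim_col (L_mat n) = n"
  "dim_row (R_mat n) = n - Suc 0" "dim_col (R_mat n) = n"
  by (simp_all add: L_mat_def R_mat_def)

lemma LR_mat_index [simp]:
  "i < n - Suc 0 \<Longrightarrow> j < n \<Longrightarrow> L_mat n $$ (i, j) = (if j = i then 1 else 0)"
  "i < n - Suc 0 \<Longrightarrow> j < n \<Longrightarrow> R_mat n $$ (i, j) = (if j = Suc i then 1 else 0)"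
  by (simp_all add: L_mat_def R_mat_def)

lemma LR_mat_transpose_carrier:
  "transpose_mat (L_mat n) \<in> carrier_mat n (n - Suc 0)"
  "transpose_mat (R_mat n) \<in> carrier_mat n (n - Suc 0)"
  by auto

lemma maps_to_hom:
  assumes "maps_to x y"
  shows "\<exists>S R. S \<in> carrier_mat (summand_rows y) (summand_rows x) \<and>
    R \<in> carrier_mat (summand_cols y) (summand_cols x) \<and>
    pair_hom (summand_pair x) (summand_pair y) S R \<and> S *\<^sub>v std x = std y"
proof -
  have one: "{k. k < m \<and> k = a} = (if a < m then {a} else {})" for a m :: nat by auto
  have plus: "{k. k < m \<and> k + a = b} = (if a \<le> b \<and> b - a < m then {b - a} else {})"
    "{k. k < m \<and> a + k = b} = (if a \<le> b \<and> b - a < m then {b - a} else {})" for a b m :: nat by auto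
  have sucs: "{k. k < m \<and> Suc (k + a) = b} = (if Suc a \<le> b \<and> b - Suc a < m then {b - Suc a} else {})"
    for a b m :: nat by auto
  consider a b where "x = LT a" "y = LT b" "1 \<le> a" "a \<le> b"
    | a k where "x = LT a" "y = D (Finite 0) k" "1 \<le> a"
    | k l where "x = D (Finite 0) k" "y = D (Finite 0) l" "l \<le> k"
    using assms by (cases "(x, y)" rule: maps_to.cases) auto
  then show ?thesis
  proof cases
    case (1 a b)
    let ?S = "mat b a (\<lambda>(i, k). if k = i then 1 else 0) :: complex mat"
    let ?R = "mat (b - 1) (a - 1) (\<lambda>(k, j). if k = j then 1 else 0) :: complex mat"
    note c = LR_mat_transpose_carrier
    have "?S * transpose_mat (L_mat a) = transpose_mat (L_mat b) * ?R"
      using 1 by (intro eq_matI)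
       (auto simp del: index_mult_mat(1) simp: select_mult_left[OF c(1)] select_mult_right[OF c(1)] one)
    moreover have "?S * transpose_mat (R_mat a) = transpose_mat (R_mat b) * ?R"
      using 1 by (intro eq_matI)
       (auto simp del: index_mult_mat(1) simp: select_mult_left[OF c(2)] select_mult_right[OF c(2)] one)
    moreover have "?S *\<^sub>v std x = std y"
      using 1 by (auto simp: select_mult_unit intro!: eq_vecI)
    ultimately show ?thesis
      using 1 by (intro exI[of _ ?S] exI[of _ ?R]) (simp add: pair_hom_def)
  next
    case (2 a k)
    \<comment> \<open>In \<open>LT a\<close> the second matrix moves index \<open>j\<close> to
      \<open>j + 1\<close>, in the nilpotent block it moves \<open>j\<close> to
      \<open>j - 1\<close>. Hence the basis is reversed: \<open>j\<close> goes to
      \<open>k - 1 - j\<close>, and to zero if \<open>j\<close> is at least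
      \<open>k\<close>.\<close>
    let ?S = "mat k a (\<lambda>(i, j). if j + Suc i = k then 1 else 0) :: complex mat"
    let ?R = "mat k (a - 1) (\<lambda>(i, j). if i + Suc j = k then 1 else 0) :: complex mat"
    note c = LR_mat_transpose_carrier
    have "?S * transpose_mat (L_mat a) = 1\<^sub>m k * ?R"
      using 2 by (intro eq_matI)
       (auto simp del: index_mult_mat(1) simp: select_mult_left[OF c(1)] select_mult_right[OF one_carrier_mat] plus sucs)
    moreover have "?S * transpose_mat (R_mat a) = jordan_block k 0 * ?R"
      using 2 by (intro eq_matI)
       (auto simp del: index_mult_mat(1) simp: select_mult_left[OF c(2)] select_mult_right[OF jordan_block_carrier] plus sucs)
    moreover have "?S *\<^sub>v std x = std y"
      using 2 by (auto simp: select_mult_unit intro!: eq_vecI)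
    ultimately show ?thesis
      using 2 by (intro exI[of _ ?S] exI[of _ ?R]) (simp add: pair_hom_def)
  next
    case (3 k l)
    \<comment> \<open>The quotient map of the longer block by the span of its first
      \<open>k - l\<close> basis vectors.\<close>
    let ?S = "mat l k (\<lambda>(i, j). if i + k = j + l then 1 else 0) :: complex mat"
    have eq: "{j. j < k \<and> i + k = j + l} = (if i < l then {i + (k - l)} else {})"
      "{i. i < l \<and> i + k = j + l} = (if j < k \<and> k \<le> j + l then {j + l - k} else {})" for i j
      using 3 by auto
    have "?S * 1\<^sub>m k = 1\<^sub>m l * ?S" by simp
    moreover have "?S * jordan_block k 0 = jordan_block l 0 * ?S"
      using 3 by (intro eq_matI)
       (auto simp del: index_mult_mat(1) simp: select_mult_left[OF jordan_block_carrier] select_mult_right[OF jordan_block_carrier] eq)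
    moreover have "?S *\<^sub>v std x = std y"
      using 3 by (cases "k = 0") (auto simp: select_mult_unit intro!: eq_vecI)
    ultimately show ?thesis
      using 3 by (intro exI[of _ ?S] exI[of _ ?S]) (simp add: pair_hom_def)
  qed
qed

section \<open>Normal form of the class of a one-column extension\<close>

definition colred :: "nat \<Rightarrow> nat \<Rightarrow> matrix_pair \<Rightarrow> matrix_pair \<Rightarrow> complex vec \<Rightarrow> complex vec \<Rightarrow> bool" where
  "colred m n P Q x y \<longleftrightarrow> P \<in> pair_space m n \<and> Q \<in> pair_space m n \<and>
     x \<in> carrier_vec m \<and> y \<in> carrier_vec m \<and>
     (\<exists>S R t. unit_mat m S \<and> unit_mat n R \<and> pair_hom P Q S R \<and> t \<in> carrier_vec n \<and>
        S *\<^sub>v x = y + snd Q *\<^sub>v t)"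

lemma colredI:
  assumes "P \<in> pair_space m n" "Q \<in> pair_space m n" "x \<in> carrier_vec m" "y \<in> carrier_vec m"
    "unit_mat m S" "unit_mat n R" "pair_hom P Q S R" "t \<in> carrier_vec n" "S *\<^sub>v x = y + snd Q *\<^sub>v t"
  shows "colred m n P Q x y"
  using assms by (auto simp: colred_def)

lemma colred_exact:
  assumes "P \<in> pair_space m n" "Q \<in> pair_space m n" "x \<in> carrier_vec m"
    "unit_mat m S" "unit_mat n R" "pair_hom P Q S R" "S *\<^sub>v x = y"
  shows "colred m n P Q x y"
proof (rule colredI[where t = "0\<^sub>v n"])
  show "y \<in> carrier_vec m"
    using mult_mat_vec_carrier[OF unit_mat_carrier[OF assms(4)] assms(3)] assms(7) by simp
  moreover have "snd Q *\<^sub>v 0\<^sub>v n = 0\<^sub>v m" using assms(2) by (auto simp: pair_space_iff intro!: eq_vecI)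
  ultimately show "S *\<^sub>v x = y + snd Q *\<^sub>v 0\<^sub>v n" using assms(7) by simp
qed (use assms in auto)

text \<open>\<open>colred\<close> records how the pair and the class change together, so that
  reductions can be chained and added up; this extracts the resulting equivalence of
  extensions.\<close>

lemma colred_iso: "colred m n P Q x y \<Longrightarrow> pair_iso (m + 1) (n + 1) (colext P x) (colext Q y)"
  unfolding colred_def by (elim conjE exE) (rule colext_iso)

lemma colred_refl: "P \<in> pair_space m n \<Longrightarrow> x \<in> carrier_vec m \<Longrightarrow> colred m n P P x x"
  by (rule colred_exact[where S = "1\<^sub>m m" and R = "1\<^sub>m n"]) (auto simp: pair_hom_def pair_space_iff)

lemma colred_trans [trans]:
  assumes "colred m n P Q x y" "colred m n Q T y z"
  shows "colred m n P T x z"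
proof -
  obtain S R t where 1: "P \<in> pair_space m n" "Q \<in> pair_space m n" "x \<in> carrier_vec m"
    "unit_mat m S" "unit_mat n R" "pair_hom P Q S R" "t \<in> carrier_vec n" "S *\<^sub>v x = y + snd Q *\<^sub>v t"
    using assms(1) by (auto simp: colred_def)
  obtain S' R' t' where 2: "T \<in> pair_space m n" "y \<in> carrier_vec m" "z \<in> carrier_vec m"
    "unit_mat m S'" "unit_mat n R'" "pair_hom Q T S' R'" "t' \<in> carrier_vec n" "S' *\<^sub>v y = z + snd T *\<^sub>v t'"
    using assms(2) by (auto simp: colred_def)
  note c = unit_mat_carrier[OF 1(4)] unit_mat_carrier[OF 1(5)] unit_mat_carrier[OF 2(4)] unit_mat_carrier[OF 2(5)]
  have sQ: "snd Q \<in> carrier_mat m n" and sT: "snd T \<in> carrier_mat m n"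
    using 1 2 by (auto simp: pair_space_iff)
  have "(S' * S) *\<^sub>v x = S' *\<^sub>v (y + snd Q *\<^sub>v t)"
    using c 1(3,8) by (simp add: assoc_mult_mat_vec[of S' m m S m x])
  also have "\<dots> = S' *\<^sub>v y + S' *\<^sub>v (snd Q *\<^sub>v t)"
    using c sQ 1(7) 2(2) by (simp add: mult_add_distrib_mat_vec[of S' m m])
  also have "S' *\<^sub>v (snd Q *\<^sub>v t) = (S' * snd Q) *\<^sub>v t"
    using assoc_mult_mat_vec[OF c(3) sQ 1(7)] by simp
  also have "\<dots> = snd T *\<^sub>v (R' *\<^sub>v t)"
    using assoc_mult_mat_vec[OF sT c(4) 1(7)] 2(6) by (simp add: pair_hom_def)
  also have "S' *\<^sub>v y + snd T *\<^sub>v (R' *\<^sub>v t) = z + (snd T *\<^sub>v t' + snd T *\<^sub>v (R' *\<^sub>v t))"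
    using sT c(4) 1(7) 2(3,7,8) by (simp add: assoc_add_vec[of z m])
  also have "snd T *\<^sub>v t' + snd T *\<^sub>v (R' *\<^sub>v t) = snd T *\<^sub>v (t' + R' *\<^sub>v t)"
    using sT c(4) 1(7) 2(7) by (simp add: mult_add_distrib_mat_vec[of "snd T" m n])
  finally have "(S' * S) *\<^sub>v x = z + snd T *\<^sub>v (t' + R' *\<^sub>v t)" .
  moreover have "pair_hom P T (S' * S) (R' * R)"
    using pair_hom_comp[OF 1(1,2) 2(1) c 1(6) 2(6)] by simp
  ultimately show ?thesis
    using 1 2 c by (intro colredI[where S = "S' * S" and R = "R' * R" and t = "t' + R' *\<^sub>v t"] unit_mat_mult) auto
qed

lemma dsum_mat_vec:
  assumes "P \<in> pair_space a b" "Q \<in> pair_space c d" "s \<in> carrier_vec b" "t \<in> carrier_vec d"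
  shows "snd (dsum P Q) *\<^sub>v (s @\<^sub>v t) = (snd P *\<^sub>v s) @\<^sub>v (snd Q *\<^sub>v t)"
  using assms four_block_mat_mult_vec[of "snd P" a b "0\<^sub>m a d" d "0\<^sub>m c b" c "snd Q" s t]
  by (auto simp: dsum_def ut_def zero_pair_def pair_space_iff)

lemma dsum_hom:
  assumes P: "P \<in> pair_space a b" "P' \<in> pair_space a' b'" and Q: "Q \<in> pair_space c d" "Q' \<in> pair_space c' d'"
    and c: "S1 \<in> carrier_mat a' a" "R1 \<in> carrier_mat b' b" "S2 \<in> carrier_mat c' c" "R2 \<in> carrier_mat d' d"
    and h: "pair_hom P P' S1 R1" "pair_hom Q Q' S2 R2"
  shows "pair_hom (dsum P Q) (dsum P' Q')
    (four_block_mat S1 (0\<^sub>m a' c) (0\<^sub>m c' a) S2) (four_block_mat R1 (0\<^sub>m b' d) (0\<^sub>m d' b) R2)"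
  unfolding dsum_ut[OF P(1) Q(1)] dsum_ut[OF P(2) Q(2)]
  using P Q c by (intro ut_hom[OF P Q _ _ c _ _ h]) (auto simp: zero_pair_def pair_space_iff)

lemma colred_dsum:
  assumes "colred a b P P' x x'" "colred c d Q Q' y y'"
  shows "colred (a + c) (b + d) (dsum P Q) (dsum P' Q') (x @\<^sub>v y) (x' @\<^sub>v y')"
proof -
  obtain S R t where 1: "P \<in> pair_space a b" "P' \<in> pair_space a b" "x \<in> carrier_vec a" "x' \<in> carrier_vec a"
    "unit_mat a S" "unit_mat b R" "pair_hom P P' S R" "t \<in> carrier_vec b" "S *\<^sub>v x = x' + snd P' *\<^sub>v t"
    using assms(1) by (auto simp: colred_def)
  obtain S' R' t' where 2: "Q \<in> pair_space c d" "Q' \<in> pair_space c d" "y \<in> carrier_vec c" "y' \<in> carrier_vec c"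
    "unit_mat c S'" "unit_mat d R'" "pair_hom Q Q' S' R'" "t' \<in> carrier_vec d" "S' *\<^sub>v y = y' + snd Q' *\<^sub>v t'"
    using assms(2) by (auto simp: colred_def)
  note u = unit_mat_carrier[OF 1(5)] unit_mat_carrier[OF 1(6)] unit_mat_carrier[OF 2(5)] unit_mat_carrier[OF 2(6)]
  show ?thesis
  proof (rule colredI)
    show "unit_mat (a + c) (four_block_mat S (0\<^sub>m a c) (0\<^sub>m c a) S')"
      "unit_mat (b + d) (four_block_mat R (0\<^sub>m b d) (0\<^sub>m d b) R')"
      using 1 2 by (auto intro!: unit_mat_upper_block)
    show "pair_hom (dsum P Q) (dsum P' Q') (four_block_mat S (0\<^sub>m a c) (0\<^sub>m c a) S')
        (four_block_mat R (0\<^sub>m b d) (0\<^sub>m d b) R')"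
      by (rule dsum_hom) (use 1 2 u in auto)
    have "four_block_mat S (0\<^sub>m a c) (0\<^sub>m c a) S' *\<^sub>v (x @\<^sub>v y) = (S *\<^sub>v x) @\<^sub>v (S' *\<^sub>v y)"
      using 1(1-8) 2(1-8) u by (subst four_block_mat_mult_vec[of _ a a _ c _ c]) auto
    also have "\<dots> = (x' + snd P' *\<^sub>v t) @\<^sub>v (y' + snd Q' *\<^sub>v t')" using 1(9) 2(9) by simp
    also have "\<dots> = (x' @\<^sub>v y') + ((snd P' *\<^sub>v t) @\<^sub>v (snd Q' *\<^sub>v t'))"
      using 1 2 by (subst append_vec_add[of _ a _ _ c]) (auto simp: pair_space_iff)
    finally show "four_block_mat S (0\<^sub>m a c) (0\<^sub>m c a) S' *\<^sub>v (x @\<^sub>v y) =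
        (x' @\<^sub>v y') + snd (dsum P' Q') *\<^sub>v (t @\<^sub>v t')"
      using dsum_mat_vec[OF 1(2) 2(2) 1(8) 2(8)] by simp
  qed (use 1 2 in \<open>auto intro!: dsum_space\<close>)
qed

text \<open>A homomorphism from \<open>P\<close> to \<open>Q\<close> gives the shear with corners
  \<open>- F\<close> and \<open>- G\<close>, an automorphism of the direct sum that subtracts
  \<open>F x\<close> from the second component of the class.\<close>

lemma colred_kill_right:
  assumes P: "P \<in> pair_space a b" and Q: "Q \<in> pair_space c d"
    and c: "F \<in> carrier_mat c a" "G \<in> carrier_mat d b" and h: "pair_hom P Q F G"
    and v: "x \<in> carrier_vec a" and e: "F *\<^sub>v x = y"
  shows "colred (a + c) (b + d) (dsum P Q) (dsum P Q) (x @\<^sub>v y) (x @\<^sub>v 0\<^sub>v c)"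
proof (rule colred_exact)
  let ?S = "four_block_mat (1\<^sub>m a) (0\<^sub>m a c) (- F) (1\<^sub>m c)"
  let ?R = "four_block_mat (1\<^sub>m b) (0\<^sub>m b d) (- G) (1\<^sub>m d)"
  show "unit_mat (a + c) ?S" "unit_mat (b + d) ?R"
    using c by (auto intro!: unit_mat_lower_block)
  have *: "?S * four_block_mat A (0\<^sub>m a d) (0\<^sub>m c b) B = four_block_mat A (0\<^sub>m a d) (0\<^sub>m c b) B * ?R"
    if A: "A \<in> carrier_mat a b" and B: "B \<in> carrier_mat c d" and FG: "F * A = B * G" for A B
  proof -
    have "?S * four_block_mat A (0\<^sub>m a d) (0\<^sub>m c b) B = four_block_mat A (0\<^sub>m a d) (- (F * A)) B"
      using A B c by (subst mult_four_block_mat[of _ a a _ c _ c _ _ b _ d]) auto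
    moreover have "four_block_mat A (0\<^sub>m a d) (0\<^sub>m c b) B * ?R = four_block_mat A (0\<^sub>m a d) (- (B * G)) B"
      using A B c by (subst mult_four_block_mat[of _ a b _ d _ c _ _ b _ d]) auto
    ultimately show ?thesis using FG by simp
  qed
  show "pair_hom (dsum P Q) (dsum P Q) ?S ?R"
    using P Q h unfolding pair_hom_def dsum_def ut_def zero_pair_def
    by (auto simp: pair_space_iff intro!: *)
  have y: "y \<in> carrier_vec c" using c v e by auto
  then show "x @\<^sub>v y \<in> carrier_vec (a + c)" using v by auto
  have "- F *\<^sub>v x = - y" using c v e by auto
  then show "?S *\<^sub>v (x @\<^sub>v y) = x @\<^sub>v 0\<^sub>v c"
    using c v y by (subst four_block_mat_mult_vec[of _ a a _ c _ c]) auto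
qed (use P Q in \<open>auto intro: dsum_space\<close>)

lemma colred_swap:
  assumes P: "P \<in> pair_space a b" and Q: "Q \<in> pair_space c d"
    and v: "x \<in> carrier_vec a" "y \<in> carrier_vec c"
  shows "colred (a + c) (b + d) (dsum P Q) (dsum Q P) (x @\<^sub>v y) (y @\<^sub>v x)"
proof (rule colred_exact)
  let ?W = "\<lambda>a c. four_block_mat (0\<^sub>m c a) (1\<^sub>m c) (1\<^sub>m a) (0\<^sub>m a c) :: complex mat"
  have u: "unit_mat (a + c) (?W a c)" for a c
  proof (rule unit_matI)
    show "?W a c * ?W c a = 1\<^sub>m (a + c)"
      by (subst mult_four_block_mat[of _ c a _ c _ a _ _ c _ a]) (auto simp: add.commute)
    show "?W a c \<in> carrier_mat (a + c) (a + c)" "?W c a \<in> carrier_mat (a + c) (a + c)" by auto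
  qed
  show "unit_mat (a + c) (?W a c)" "unit_mat (b + d) (?W b d)" by (rule u)+
  have *: "?W a c * four_block_mat A (0\<^sub>m a d) (0\<^sub>m c b) B = four_block_mat B (0\<^sub>m c b) (0\<^sub>m a d) A * ?W b d"
    if A: "A \<in> carrier_mat a b" and B: "B \<in> carrier_mat c d" for A B
  proof -
    have "?W a c * four_block_mat A (0\<^sub>m a d) (0\<^sub>m c b) B = four_block_mat (0\<^sub>m c b) B A (0\<^sub>m a d)"
      using A B by (subst mult_four_block_mat[of _ c a _ c _ a _ _ b _ d]) auto
    moreover have "four_block_mat B (0\<^sub>m c b) (0\<^sub>m a d) A * ?W b d = four_block_mat (0\<^sub>m c b) B A (0\<^sub>m a d)"
      using A B by (subst mult_four_block_mat[of _ c d _ b _ a _ _ b _ d]) auto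
    ultimately show ?thesis by simp
  qed
  show "pair_hom (dsum P Q) (dsum Q P) (?W a c) (?W b d)"
    using P Q unfolding pair_hom_def dsum_def ut_def zero_pair_def
    by (auto simp: pair_space_iff intro!: *)
  show "?W a c *\<^sub>v (x @\<^sub>v y) = y @\<^sub>v x"
    using v by (subst four_block_mat_mult_vec[of _ c a _ c _ a]) auto
qed (use P Q v dsum_space[OF Q P] in \<open>auto intro: dsum_space simp: add.commute\<close>)

definition extension_of :: "nat \<Rightarrow> nat \<Rightarrow> nat \<Rightarrow> nat \<Rightarrow> matrix_pair \<Rightarrow> matrix_pair \<Rightarrow> matrix_pair \<Rightarrow> bool" where
  "extension_of a b c d P Q T \<longleftrightarrow> P \<in> pair_space a b \<and> Q \<in> pair_space c d \<and>
     (\<exists>X \<in> pair_space a d. pair_iso (a + c) (b + d) (ut P X Q) T)"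

lemma extension_cong:
  assumes "extension_of a b c d P Q T" "pair_iso a b P P'" "pair_iso c d Q Q'" "pair_iso (a + c) (b + d) T T'"
  shows "extension_of a b c d P' Q' T'"
proof -
  obtain X where X: "X \<in> pair_space a d" "pair_iso (a + c) (b + d) (ut P X Q) T"
    using assms(1) by (auto simp: extension_of_def)
  obtain X' where X': "X' \<in> pair_space a d" "pair_iso (a + c) (b + d) (ut P X Q) (ut P' X' Q')"
    using ut_cong[OF assms(2,3) X(1)] by auto
  have "pair_iso (a + c) (b + d) (ut P' X' Q') T'"
    using X X' assms(4) by (blast intro: pair_iso_sym pair_iso_trans)
  then show ?thesis using X' assms(2,3) by (auto simp: extension_of_def pair_iso_def)
qed

text \<open>If a homomorphism \<open>x \<rightarrow> y\<close> carries one distinguished vector to the other, then the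
  one-point extension of \<open>y\<close> can be traded for the one-point extension of \<open>x\<close>.\<close>

lemma growth_extension:
  assumes "maps_to x y"
  shows "extension_of (summand_rows x) (summand_cols x) (summand_rows (grow y)) (summand_cols (grow y))
    (summand_pair x) (summand_pair (grow y)) (direct_sum [grow x, y])"
proof -
  let ?P = "summand_pair x" and ?Q = "summand_pair y"
  let ?a = "summand_rows x" and ?b = "summand_cols x" and ?c = "summand_rows y" and ?d = "summand_cols y"
  have P: "?P \<in> pair_space ?a ?b" and Q: "?Q \<in> pair_space ?c ?d" by (rule summand_space)+
  note g = maps_to_growable[OF assms]
  have gd: "summand_rows (grow z) = summand_rows z + 1" "summand_cols (grow z) = summand_cols z + 1"
    if "growable z" for z using that by (induction z rule: growable.induct) auto
  obtain F G where FG: "F \<in> carrier_mat ?c ?a" "G \<in> carrier_mat ?d ?b" "pair_hom ?P ?Q F G" "F *\<^sub>v std x = std y"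
    using maps_to_hom[OF assms] by blast
  define X where "X = ((0\<^sub>m ?a (?d + 1), mat ?a (?d + 1) (\<lambda>(i, j). if j = ?d then std x $ i else 0)) :: matrix_pair)"
  have X: "X \<in> pair_space ?a (?d + 1)" by (simp add: X_def pair_space_iff)
  \<comment> \<open>The same matrices with two cuts: after the summand \<open>x\<close> they display
    an extension of \<open>colext ?Q (std y)\<close> by \<open>?P\<close>; before the last row and
    column they are a one-column extension of the direct sum with class
    \<open>(std x, std y)\<close>, whose second component the homomorphism cancels.\<close>
  have eq: "ut ?P X (colext ?Q (std y)) = colext (dsum ?P ?Q) (std x @\<^sub>v std y)"
    by (auto simp: X_def colext_def ut_def dsum_def zero_pair_def point_pair_def intro!: prod_eqI eq_matI)
  have "pair_iso (?a + ?c + 1) (?b + ?d + 1) (ut ?P X (colext ?Q (std y))) (colext (dsum ?P ?Q) (std x @\<^sub>v 0\<^sub>v ?c))"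
    unfolding eq using colred_iso[OF colred_kill_right[OF P Q FG(1,2,3) _ FG(4)]] by simp
  also have "pair_iso (?a + ?c + 1) (?b + ?d + 1) \<dots> (dsum (colext ?P (std x)) ?Q)"
    by (rule colext_dsum_left[OF P Q]) simp
  also have "pair_iso (?a + ?c + 1) (?b + ?d + 1) \<dots> (dsum (summand_pair (grow x)) ?Q)"
    using dsum_cong[OF colext_std[OF g(1)] pair_iso_refl[OF Q]] by (simp add: ac_simps)
  also have "dsum (summand_pair (grow x)) ?Q = direct_sum [grow x, y]"
    by (simp only: direct_sum_Cons[of "grow x"] direct_sum_single)
  finally have "extension_of ?a ?b (?c + 1) (?d + 1) ?P (colext ?Q (std y)) (direct_sum [grow x, y])"
    using P Q X colext_space[OF Q] unfolding extension_of_def by (auto simp: add.assoc)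
  then show ?thesis
    using extension_cong[OF _ pair_iso_refl[OF P] colext_std[OF g(2)] pair_iso_refl] gd[OF g(2)] gd[OF g(1)]
      direct_sum_in_pair_space[of "[grow x, y]"] by (simp add: add.assoc add.left_commute)
qed

fun valid_summand :: "summand \<Rightarrow> bool" where
  "valid_summand (LT m) = (1 \<le> m)"
| "valid_summand (D a k) = (1 \<le> k)"
| "valid_summand (L n) = (1 \<le> n)"

lemma unit_jordan_block: "a \<noteq> 0 \<Longrightarrow> unit_mat k (jordan_block k a)"
  using det_upper_triangular[of "jordan_block k a" k]
  by (auto simp: unit_mat_iff_det diag_mat_def upper_triangular_def o_def prod_list_zero_iff)

text \<open>For \<open>LT\<close> and the nilpotent block the image of the second matrix misses
  exactly the coordinate of \<open>std x\<close>, and shifting the other entries gives the preimage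
  \<open>t\<close>. In all other cases the second matrix is onto.\<close>

lemma summand_decompose:
  assumes "valid_summand x" "v \<in> carrier_vec (summand_rows x)"
  shows "\<exists>c t. t \<in> carrier_vec (summand_cols x) \<and> (c \<noteq> 0 \<longrightarrow> growable x) \<and>
    v = c \<cdot>\<^sub>v std x + snd (summand_pair x) *\<^sub>v t"
  using assms
proof (induction x rule: summand_pair.induct)
  case (1 m)
  define t where "t = vec (m - 1) (\<lambda>i. v $ Suc i)"
  have "(transpose_mat (R_mat m) *\<^sub>v t) $ i = (if i = 0 then 0 else v $ i)" if i: "i < m" for i
  proof -
    have "(transpose_mat (R_mat m) *\<^sub>v t) $ i =
        (\<Sum>j \<in> {0..<m - 1}. (if i = Suc j then 1 else 0) * t $ j)"
      using i by (auto simp: scalar_prod_def t_def intro!: sum.cong)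
    also have "\<dots> = (\<Sum>j \<in> {0..<m - 1}. if j = i - 1 then (if i = 0 then 0 else v $ i) else 0)"
      by (rule sum.cong) (auto simp: t_def)
    also have "\<dots> = (if i = 0 then 0 else v $ i)" using i by auto
    finally show ?thesis .
  qed
  then have "v = v $ 0 \<cdot>\<^sub>v std (LT m) + snd (summand_pair (LT m)) *\<^sub>v t"
    using 1 by (intro eq_vecI) auto
  then show ?case using 1 by (intro exI[of _ "v $ 0"] exI[of _ t]) (simp add: t_def)
next
  case (2 a n)
  show ?case
  proof (cases "a = 0")
    case True
    define t where "t = vec n (\<lambda>i. if i = 0 then 0 else v $ (i - 1))"
    have "(jordan_block n 0 *\<^sub>v t) $ i = (if i = n - 1 then 0 else v $ i)" if i: "i < n" for i
    proof -
      have "(jordan_block n 0 *\<^sub>v t) $ i = (\<Sum>j \<in> {0..<n}. (if Suc i = j then 1 else 0) * t $ j)"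
        using i by (auto simp: scalar_prod_def t_def intro!: sum.cong)
      also have "\<dots> = (\<Sum>j \<in> {0..<n}. if j = Suc i then v $ i else 0)"
        by (rule sum.cong) (auto simp: t_def)
      also have "\<dots> = (if i = n - 1 then 0 else v $ i)" using i by auto
      finally show ?thesis .
    qed
    then have "v = v $ (n - 1) \<cdot>\<^sub>v std (D (Finite a) n) + snd (summand_pair (D (Finite a) n)) *\<^sub>v t"
      using 2 True by (intro eq_vecI) auto
    then show ?thesis using True by (intro exI[of _ "v $ (n - 1)"] exI[of _ t]) (simp add: t_def)
  next
    case False
    then obtain T where T: "T \<in> carrier_mat n n" "jordan_block n a * T = 1\<^sub>m n"
      using unit_jordan_block[of a n] by (auto simp: unit_mat_def)
    have "jordan_block n a *\<^sub>v (T *\<^sub>v v) = v"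
      using T 2 assoc_mult_mat_vec[of "jordan_block n a" n n T n v] by simp
    then show ?thesis using T 2 by (intro exI[of _ 0] exI[of _ "T *\<^sub>v v"]) auto
  qed
next
  case (3 n)
  then show ?case by (intro exI[of _ 0] exI[of _ v]) auto
next
  case (4 n)
  define t where "t = vec n (\<lambda>i. if i = 0 then 0 else v $ (i - 1))"
  have "(R_mat n *\<^sub>v t) $ i = v $ i" if i: "i < n - 1" for i
  proof -
    have "(R_mat n *\<^sub>v t) $ i = (\<Sum>j \<in> {0..<n}. (if j = Suc i then 1 else 0) * t $ j)"
      using i by (auto simp: scalar_prod_def t_def intro!: sum.cong)
    also have "\<dots> = (\<Sum>j \<in> {0..<n}. if j = Suc i then v $ i else 0)"
      by (rule sum.cong) (auto simp: t_def)
    also have "\<dots> = v $ i" using i by auto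
    finally show ?thesis .
  qed
  then have "v = 0 \<cdot>\<^sub>v std (L n) + snd (summand_pair (L n)) *\<^sub>v t"
    using 4 by (intro eq_vecI) auto
  then show ?case by (intro exI[of _ 0] exI[of _ t]) (simp add: t_def)
qed

text \<open>Modulo the image of the second matrix only a multiple of \<open>std x\<close> remains,
  and nonzero scalars are automorphisms, so a nonzero coefficient becomes 1.\<close>

lemma summand_colred:
  assumes "valid_summand x" "v \<in> carrier_vec (summand_rows x)"
  shows "\<exists>y. colred (summand_rows x) (summand_cols x) (summand_pair x) (summand_pair x) v y \<and>
    (y = 0\<^sub>v (summand_rows x) \<or> growable x \<and> y = std x)"
proof -
  let ?m = "summand_rows x" and ?n = "summand_cols x"
  have P: "summand_pair x \<in> pair_space ?m ?n" by (rule summand_space)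
  then have sP: "fst (summand_pair x) \<in> carrier_mat ?m ?n" "snd (summand_pair x) \<in> carrier_mat ?m ?n"
    by (auto simp: pair_space_iff)
  obtain c t where t: "t \<in> carrier_vec ?n" and c: "c \<noteq> 0 \<Longrightarrow> growable x"
    and v: "v = c \<cdot>\<^sub>v std x + snd (summand_pair x) *\<^sub>v t"
    using summand_decompose[OF assms] by blast
  show ?thesis
  proof (cases "c = 0")
    case True
    have "colred ?m ?n (summand_pair x) (summand_pair x) v (0\<^sub>v ?m)"
    proof (rule colredI[where R = "1\<^sub>m ?n", OF P P assms(2)])
      show "1\<^sub>m ?m *\<^sub>v v = 0\<^sub>v ?m + snd (summand_pair x) *\<^sub>v t"
        using v sP t assms(2) True by (auto intro!: eq_vecI)
    qed (use P t in \<open>auto simp: pair_hom_def pair_space_iff\<close>)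
    then show ?thesis by blast
  next
    case False
    have "colred ?m ?n (summand_pair x) (summand_pair x) v (std x)"
    proof (rule colredI[where R = "1 / c \<cdot>\<^sub>m 1\<^sub>m ?n", OF P P assms(2)])
      have "snd (summand_pair x) *\<^sub>v (1 / c \<cdot>\<^sub>v t) = 1 / c \<cdot>\<^sub>v (snd (summand_pair x) *\<^sub>v t)"
        using sP t by (simp add: mult_mat_vec)
      moreover have "(1 / c \<cdot>\<^sub>m 1\<^sub>m ?m) *\<^sub>v v = 1 / c \<cdot>\<^sub>v v"
        using assms(2) by (intro eq_vecI) auto
      ultimately show "(1 / c \<cdot>\<^sub>m 1\<^sub>m ?m) *\<^sub>v v = std x + snd (summand_pair x) *\<^sub>v (1 / c \<cdot>\<^sub>v t)"
        using v sP t assms(2) False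
        by (simp add: smult_add_distrib_vec[of _ ?m] smult_smult_assoc)
    qed (use sP t False in \<open>auto simp: pair_hom_def intro!: unit_mat_smult\<close>)
    then show ?thesis using c False by blast
  qed
qed

lemma append_vec_assoc: "(u @\<^sub>v v) @\<^sub>v w = u @\<^sub>v (v @\<^sub>v w)"
  by (intro eq_vecI) auto

lemma append_zero_vec: "0\<^sub>v a @\<^sub>v 0\<^sub>v b = 0\<^sub>v (a + b)"
  by (intro eq_vecI) auto

text \<open>The induction keeps at most one summand with a nonzero class, and keeps it in front. A
  new head that also carries a class is compared with it by \<open>maps_to_total\<close>: the one
  that maps to the other cancels the class there, and \<open>zs\<close> reorders the summands so
  that the survivor comes first.\<close>

lemma direct_sum_colred:
  assumes "\<forall>x \<in> set ys. valid_summand x" "v \<in> carrier_vec (row_count ys)"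
  shows "\<exists>zs y. mset zs = mset ys \<and>
    colred (row_count ys) (col_count ys) (direct_sum ys) (direct_sum zs) v y \<and>
    (y = 0\<^sub>v (row_count ys) \<or>
      (\<exists>b zs'. zs = b # zs' \<and> growable b \<and> y = std b @\<^sub>v 0\<^sub>v (row_count zs')))"
  using assms
proof (induction ys arbitrary: v)
  case Nil
  then have "v = 0\<^sub>v 0" by auto
  then show ?case using colred_refl[OF direct_sum_in_pair_space, of v "[]"] Nil by auto
next
  case (Cons x ys)
  let ?m = "summand_rows x" and ?n = "summand_cols x" and ?k = "row_count ys" and ?l = "col_count ys"
  obtain v1 v2 where v: "v = v1 @\<^sub>v v2" "v1 \<in> carrier_vec ?m" "v2 \<in> carrier_vec ?k"
    using Cons.prems(2) vec_first_last_append[of v ?m ?k] by (metis row_count_simps(2) vec_first_carrier vec_last_carrier)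
  obtain w1 where w1: "colred ?m ?n (summand_pair x) (summand_pair x) v1 w1"
    "w1 = 0\<^sub>v ?m \<or> growable x \<and> w1 = std x"
    using summand_colred[OF _ v(2)] Cons.prems(1) by (meson list.set_intros(1))
  obtain zs w2 where zs: "mset zs = mset ys" and w2: "colred ?k ?l (direct_sum ys) (direct_sum zs) v2 w2"
    and w2': "w2 = 0\<^sub>v ?k \<or> (\<exists>b zs'. zs = b # zs' \<and> growable b \<and> w2 = std b @\<^sub>v 0\<^sub>v (row_count zs'))"
    using Cons.IH[OF _ v(3)] Cons.prems(1) by auto
  have base: "colred (row_count (x # ys)) (col_count (x # ys)) (direct_sum (x # ys)) (direct_sum (x # zs)) v (w1 @\<^sub>v w2)"
    using colred_dsum[OF w1(1) w2] by (simp add: direct_sum_Cons v)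
  note kc = row_count_mset[OF zs] col_count_mset[OF zs]
  show ?case
  proof (cases "w2 = 0\<^sub>v ?k")
    case True
    from w1(2) show ?thesis
    proof
      assume "w1 = 0\<^sub>v ?m"
      then show ?thesis using base zs True by (intro exI[of _ "x # zs"] exI[of _ "w1 @\<^sub>v w2"]) (simp add: append_zero_vec)
    next
      assume "growable x \<and> w1 = std x"
      then show ?thesis using base zs True kc by (intro exI[of _ "x # zs"] exI[of _ "w1 @\<^sub>v w2"]) simp
    qed
  next
    case False
    then obtain b zs' where b: "zs = b # zs'" "growable b" "w2 = std b @\<^sub>v 0\<^sub>v (row_count zs')"
      using w2' by auto
    let ?i = "summand_rows b" and ?j = "summand_cols b" and ?r = "row_count zs'" and ?s = "col_count zs'"
    note sp = summand_space[of x] summand_space[of b] direct_sum_in_pair_space[of zs']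
    have dims: "?m + ?i + ?r = row_count (x # ys)" "?n + ?j + ?s = col_count (x # ys)"
      using kc b by simp_all
    have lift: "colred (row_count (x # ys)) (col_count (x # ys)) (direct_sum (p # q # zs')) (direct_sum (p' # q' # zs'))
        (u @\<^sub>v 0\<^sub>v ?r) (u' @\<^sub>v 0\<^sub>v ?r)"
      if "colred (?m + ?i) (?n + ?j) (dsum (summand_pair p) (summand_pair q)) (dsum (summand_pair p') (summand_pair q')) u u'"
      for p q p' q' u u'
      using colred_dsum[OF that colred_refl[OF sp(3), of "0\<^sub>v ?r"]]
        dsum_assoc[OF summand_space[of p] summand_space[of q] sp(3)]
        dsum_assoc[OF summand_space[of p'] summand_space[of q'] sp(3)]
      unfolding dims[symmetric] by (simp add: direct_sum_Cons)
    have w1c: "w1 \<in> carrier_vec ?m" using w1(1) by (simp add: colred_def)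
    have vec: "w1 @\<^sub>v w2 = (w1 @\<^sub>v std b) @\<^sub>v 0\<^sub>v ?r" by (simp add: b append_vec_assoc)
    have swap: "colred (?m + ?i) (?n + ?j) (dsum (summand_pair x) (summand_pair b)) (dsum (summand_pair b) (summand_pair x))
        (w1 @\<^sub>v std b) (std b @\<^sub>v w1)"
      by (rule colred_swap[OF sp(1,2) w1c]) simp
    have fin1: ?thesis
      if "colred (?m + ?i) (?n + ?j) (dsum (summand_pair x) (summand_pair b)) (dsum (summand_pair x) (summand_pair b))
        (w1 @\<^sub>v std b) (std x @\<^sub>v 0\<^sub>v ?i)" "growable x"
      using colred_trans[OF base[unfolded vec b(1)] lift[OF that(1)]] that(2) zs b(1)
      by (intro exI[of _ "x # b # zs'"] exI[of _ "(std x @\<^sub>v 0\<^sub>v ?i) @\<^sub>v 0\<^sub>v ?r"])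
        (simp add: append_vec_assoc append_zero_vec)
    have fin2: ?thesis
      if "colred (?m + ?i) (?n + ?j) (dsum (summand_pair x) (summand_pair b)) (dsum (summand_pair b) (summand_pair x))
        (w1 @\<^sub>v std b) (std b @\<^sub>v 0\<^sub>v ?m)"
      using colred_trans[OF base[unfolded vec b(1)] lift[OF that(1)]] zs[symmetric] b(1,2)
      by (intro exI[of _ "b # x # zs'"] exI[of _ "(std b @\<^sub>v 0\<^sub>v ?m) @\<^sub>v 0\<^sub>v ?r"])
        (simp add: append_vec_assoc append_zero_vec add_mset_commute)
    have kill: "colred (summand_rows p + summand_rows q) (summand_cols p + summand_cols q)
        (dsum (summand_pair p) (summand_pair q)) (dsum (summand_pair p) (summand_pair q)) (std p @\<^sub>v std q) (std p @\<^sub>v 0\<^sub>v (summand_rows q))"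
      if pq: "maps_to p q" for p q
    proof -
      obtain F G where "F \<in> carrier_mat (summand_rows q) (summand_rows p)" "G \<in> carrier_mat (summand_cols q) (summand_cols p)"
        "pair_hom (summand_pair p) (summand_pair q) F G" "F *\<^sub>v std p = std q"
        using maps_to_hom[OF pq] by blast
      then show ?thesis by (intro colred_kill_right[OF summand_space summand_space]) auto
    qed
    from w1(2) show ?thesis
    proof
      assume "w1 = 0\<^sub>v ?m"
      then show ?thesis using fin2 swap by simp
    next
      assume w: "growable x \<and> w1 = std x"
      then consider "maps_to x b" | "maps_to b x" using maps_to_total b by blast
      then show ?thesis
      proof cases
        case 1
        then show ?thesis using fin1 kill[of x b] w by simp
      next
        case 2
        then show ?thesis using fin2 colred_trans[OF swap] kill[of b x] w by (simp add: add.commute)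
      qed
    qed
  qed
qed

lemma point_pair_summand: "point_pair = summand_pair (D (Finite 0) 1)"
  by (auto simp: point_pair_def intro!: eq_matI)

text \<open>The one summand that still carries a class grows; if the class is zero, a new block
  \<open>D (Finite 0) 1\<close> splits off.\<close>

lemma colext_direct_sum:
  assumes "\<forall>x \<in> set ys. valid_summand x" "v \<in> carrier_vec (row_count ys)"
  shows "\<exists>zs. (\<forall>x \<in> set zs. valid_summand x) \<and>
    pair_iso (row_count ys + 1) (col_count ys + 1) (colext (direct_sum ys) v) (direct_sum zs)"
proof -
  obtain zs y where zs: "mset zs = mset ys"
    and c: "colred (row_count ys) (col_count ys) (direct_sum ys) (direct_sum zs) v y"
    and y: "y = 0\<^sub>v (row_count ys) \<or> (\<exists>b zs'. zs = b # zs' \<and> growable b \<and> y = std b @\<^sub>v 0\<^sub>v (row_count zs'))"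
    using direct_sum_colred[OF assms] by blast
  have val: "\<forall>x \<in> set zs. valid_summand x" using assms(1) mset_eq_setD[OF zs] by simp
  note kc = row_count_mset[OF zs] col_count_mset[OF zs]
  note iso = colred_iso[OF c]
  from y show ?thesis
  proof
    assume "y = 0\<^sub>v (row_count ys)"
    then have "colext (direct_sum zs) y = direct_sum (zs @ [D (Finite 0) 1])"
      using colext_zero[OF direct_sum_in_pair_space, of zs] kc
      by (simp only: direct_sum_append direct_sum_single point_pair_summand)
    then show ?thesis using iso val by (intro exI[of _ "zs @ [D (Finite 0) 1]"]) auto
  next
    assume "\<exists>b zs'. zs = b # zs' \<and> growable b \<and> y = std b @\<^sub>v 0\<^sub>v (row_count zs')"
    then obtain b zs' where b: "zs = b # zs'" "growable b" "y = std b @\<^sub>v 0\<^sub>v (row_count zs')" by blast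
    have "pair_iso (row_count ys + 1) (col_count ys + 1) (colext (direct_sum zs) y)
        (dsum (colext (summand_pair b) (std b)) (direct_sum zs'))"
      using colext_dsum_left[OF summand_space direct_sum_in_pair_space std_carrier, of b zs'] b kc
      by (simp add: direct_sum_Cons)
    also have "pair_iso (row_count ys + 1) (col_count ys + 1) \<dots> (direct_sum (grow b # zs'))"
      using dsum_cong[OF colext_std[OF b(2)] pair_iso_refl[OF direct_sum_in_pair_space], of zs'] b kc
      by (simp add: direct_sum_Cons ac_simps)
    finally have "pair_iso (row_count ys + 1) (col_count ys + 1) (colext (direct_sum ys) v) (direct_sum (grow b # zs'))"
      using iso pair_iso_trans by blast
    moreover have "valid_summand (grow b)" using b val by (cases b) auto
    ultimately show ?thesis using val b by (intro exI[of _ "grow b # zs'"]) auto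
  qed
qed

section \<open>Duality by transposition\<close>

definition tr :: "matrix_pair \<Rightarrow> matrix_pair" where
  "tr P = (transpose_mat (fst P), transpose_mat (snd P))"

lemma tr_space: "P \<in> pair_space m n \<Longrightarrow> tr P \<in> pair_space n m"
  by (simp add: tr_def pair_space_iff)

lemma tr_tr [simp]: "tr (tr P) = P"
  by (simp add: tr_def)

lemma tr_iso:
  assumes "pair_iso m n P Q" shows "pair_iso n m (tr P) (tr Q)"
proof -
  obtain S R where 1: "P \<in> pair_space m n" "Q \<in> pair_space m n" "unit_mat m S" "unit_mat n R" "pair_hom P Q S R"
    using assms by (auto simp: pair_iso_def)
  note c = unit_mat_carrier[OF 1(3)] unit_mat_carrier[OF 1(4)]
  have *: "transpose_mat R * transpose_mat B = transpose_mat A * transpose_mat S"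
    if "A \<in> carrier_mat m n" "B \<in> carrier_mat m n" "S * A = B * R" for A B
    using that c transpose_mult[of S m m A n] transpose_mult[of B m n R n] by simp
  have "pair_iso n m (tr Q) (tr P)"
    using 1 *[of "fst P" "fst Q"] *[of "snd P" "snd Q"]
    by (intro pair_isoI[of _ _ _ _ "transpose_mat R" "transpose_mat S"])
      (auto simp: tr_space unit_mat_transpose pair_hom_def tr_def pair_space_iff)
  then show ?thesis by (rule pair_iso_sym)
qed

lemma tr_dsum:
  assumes "P \<in> pair_space a b" "Q \<in> pair_space c d"
  shows "tr (dsum P Q) = dsum (tr P) (tr Q)"
  using assms transpose_four_block_mat[of "fst P" a b "0\<^sub>m a d" d "0\<^sub>m c b" c "fst Q"]
    transpose_four_block_mat[of "snd P" a b "0\<^sub>m a d" d "0\<^sub>m c b" c "snd Q"]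
  by (auto simp: tr_def dsum_def ut_def zero_pair_def pair_space_iff)

text \<open>Transposition moves the class to the lower left corner; exchanging the block rows and
  columns then makes \<open>tr Q\<close> the subobject and \<open>tr P\<close> the quotient.\<close>

lemma tr_ut:
  assumes "P \<in> pair_space a b" "Q \<in> pair_space c d" "X \<in> pair_space a d"
  shows "pair_iso (d + b) (c + a) (tr (ut P X Q)) (ut (tr Q) (tr X) (tr P))"
proof -
  have "tr (ut P X Q) =
     (four_block_mat (transpose_mat (fst P)) (0\<^sub>m b c) (transpose_mat (fst X)) (transpose_mat (fst Q)),
      four_block_mat (transpose_mat (snd P)) (0\<^sub>m b c) (transpose_mat (snd X)) (transpose_mat (snd Q)))"
    using assms transpose_four_block_mat[of "fst P" a b "fst X" d "0\<^sub>m c b" c "fst Q"]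
      transpose_four_block_mat[of "snd P" a b "snd X" d "0\<^sub>m c b" c "snd Q"]
    by (auto simp: tr_def ut_def pair_space_iff)
  moreover have "ut (tr Q) (tr X) (tr P) =
     (four_block_mat (transpose_mat (fst Q)) (transpose_mat (fst X)) (0\<^sub>m b c) (transpose_mat (fst P)),
      four_block_mat (transpose_mat (snd Q)) (transpose_mat (snd X)) (0\<^sub>m b c) (transpose_mat (snd P)))"
    using assms by (auto simp: tr_def ut_def pair_space_iff)
  ultimately show ?thesis
    using assms four_block_swap[of "transpose_mat (fst P)" b a "transpose_mat (fst Q)" d c "0\<^sub>m b c" "transpose_mat (fst X)"
      "transpose_mat (snd P)" "transpose_mat (snd Q)" "0\<^sub>m b c" "transpose_mat (snd X)"]
    by (simp add: pair_space_iff add.commute)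
qed

lemma extension_tr:
  assumes "extension_of a b c d P Q T"
  shows "extension_of d c b a (tr Q) (tr P) (tr T)"
proof -
  obtain X where 1: "P \<in> pair_space a b" "Q \<in> pair_space c d" "X \<in> pair_space a d"
    "pair_iso (a + c) (b + d) (ut P X Q) T"
    using assms by (auto simp: extension_of_def)
  have "pair_iso (d + b) (c + a) (ut (tr Q) (tr X) (tr P)) (tr T)"
    using tr_ut[OF 1(1-3)] tr_iso[OF 1(4)] by (metis add.commute pair_iso_sym pair_iso_trans)
  then show ?thesis using 1 tr_space unfolding extension_of_def by blast
qed

fun dual :: "summand \<Rightarrow> summand" where
  "dual (LT n) = L n"
| "dual (D a k) = D a k"
| "dual (L n) = LT n"

lemma dual_dual [simp]: "dual (dual x) = x"
  by (cases x) auto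

lemma dual_dims [simp]: "summand_rows (dual x) = summand_cols x" "summand_cols (dual x) = summand_rows x"
  by (cases x; simp)+

lemma dual_counts [simp]: "row_count (map dual xs) = col_count xs" "col_count (map dual xs) = row_count xs"
  by (induction xs) auto

lemma valid_dual [simp]: "valid_summand (dual x) = valid_summand x"
  by (cases x) auto

lemma tr_summand: "pair_iso (summand_cols x) (summand_rows x) (tr (summand_pair x)) (summand_pair (dual x))"
proof (cases x)
  case (D a k)
  \<comment> \<open>Reversing the basis turns the transpose of a Jordan block back into the
    block.\<close>
  have "bij_betw (\<lambda>i. k - 1 - i) {..<k} {..<k}"
    by (rule bij_betw_byWitness[where f' = "\<lambda>i. k - 1 - i"]) auto
  moreover have "tr (summand_pair x) \<in> pair_space k k" "summand_pair x \<in> pair_space k k"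
    using D summand_space[of x] by (auto intro: tr_space)
  moreover have "transpose_mat (jordan_block k b) $$ (k - 1 - i, k - 1 - j) = jordan_block k b $$ (i, j)"
    "1\<^sub>m k $$ (k - 1 - i, k - 1 - j) = (1\<^sub>m k $$ (i, j) :: complex)"
    if "i < k" "j < k" for i j and b :: complex
    using that by auto
  ultimately show ?thesis
    using D by (cases a) (auto simp: tr_def intro!: pair_iso_perm[where \<pi> = "\<lambda>i. k - 1 - i" and \<sigma> = "\<lambda>i. k - 1 - i"])
next
  case (LT n)
  then show ?thesis using tr_space[OF summand_space[of x]] by (simp add: tr_def pair_iso_refl)
next
  case (L n)
  then show ?thesis using tr_space[OF summand_space[of x]] by (simp add: tr_def pair_iso_refl)
qed

lemma tr_direct_sum: "pair_iso (col_count xs) (row_count xs) (tr (direct_sum xs)) (direct_sum (map dual xs))"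
proof (induction xs)
  case Nil
  then show ?case using tr_space[OF direct_sum_in_pair_space[of "[]"]]
    by (simp add: tr_def direct_sum_Nil zero_pair_def pair_iso_refl)
next
  case (Cons x xs)
  then show ?case
    using dsum_cong[OF tr_summand[of x] Cons] tr_dsum[OF summand_space direct_sum_in_pair_space, of x xs]
    by (simp add: direct_sum_Cons)
qed

section \<open>Kernels and prescribed rows, from determinants\<close>

lemma unit_matI_kernel:
  assumes "S \<in> carrier_mat n n" "\<And>v. v \<in> carrier_vec n \<Longrightarrow> S *\<^sub>v v = 0\<^sub>v n \<Longrightarrow> v = 0\<^sub>v n"
  shows "unit_mat n S"
  using assms det_0_iff_vec_prod_zero[OF assms(1)] by (auto simp: unit_mat_iff_det)

lemma unit_mat_with_last_row:
  fixes v :: "complex vec"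
  assumes v: "v \<in> carrier_vec n" "v \<noteq> 0\<^sub>v n"
  shows "\<exists>S. unit_mat n S \<and> row S (n - 1) = v"
proof -
  obtain p where p: "p < n" "v $ p \<noteq> 0"
    using v by (metis carrier_vecD eq_vecI index_zero_vec)
  \<comment> \<open>Besides \<open>v\<close> in the last row, the rows are all unit vectors except
    the one at \<open>p\<close>, where \<open>v\<close> is nonzero: row \<open>p\<close> takes over
    the unit vector at \<open>n - 1\<close>, which \<open>v\<close> has displaced.\<close>
  define S where "S = mat n n (\<lambda>(i, j). if i = n - 1 then v $ j else if (if i = p then n - 1 else i) = j then 1 else 0)"
  have S: "S \<in> carrier_mat n n" by (simp add: S_def)
  have r: "row S (n - 1) = v" using v p by (auto simp: S_def intro!: eq_vecI)
  have "unit_mat n S"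
  proof (rule unit_matI_kernel[OF S])
    fix w assume w: "w \<in> carrier_vec n" "S *\<^sub>v w = 0\<^sub>v n"
    have "row S i \<bullet> w = w $ (if i = p then n - 1 else i)" if i: "i < n - 1" for i
    proof -
      have "row S i = unit_vec n (if i = p then n - 1 else i)"
        using i by (auto simp: S_def intro!: eq_vecI)
      then show ?thesis using w i by simp
    qed
    moreover have "row S i \<bullet> w = 0" if "i < n" for i
      using arg_cong[OF w(2), of "\<lambda>u. u $ i"] that S by simp
    ultimately have *: "w $ (if i = p then n - 1 else i) = 0" if "i < n - 1" for i
      using that by (metis less_imp_diff_less less_trans diff_le_self less_le_trans)
    have z: "w $ j = 0" if "j < n" "j \<noteq> p" for j
    proof (cases "j = n - 1")
      case True
      then show ?thesis using *[of p] that p by auto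
    next
      case False
      then show ?thesis using *[of j] that by auto
    qed
    have "v \<bullet> w = 0" using \<open>\<And>i. i < n \<Longrightarrow> row S i \<bullet> w = 0\<close>[of "n - 1"] r p by simp
    also have "v \<bullet> w = (\<Sum>j \<in> {0..<n}. if j = p then v $ p * w $ p else 0)"
      using w z unfolding scalar_prod_def by (intro sum.cong) auto
    also have "\<dots> = v $ p * w $ p" using p(1) by simp
    finally have "w $ p = 0" using p by simp
    then show "w = 0\<^sub>v n" using z w by (intro eq_vecI) (metis carrier_vecD index_zero_vec, simp_all)
  qed
  then show ?thesis using r by blast
qed

text \<open>Zero rows fill the matrix up to a singular square one with the same kernel. Dimension
  counts below, for non-square pairs and in \<open>card_coord_le\<close>, rest on this.\<close>

lemma wide_mat_kernel:
  fixes A :: "complex mat"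
  assumes A: "A \<in> carrier_mat n m" and "n < m"
  shows "\<exists>v \<in> carrier_vec m. v \<noteq> 0\<^sub>v m \<and> A *\<^sub>v v = 0\<^sub>v n"
proof -
  define B where "B = mat m m (\<lambda>(i, j). if i < n then A $$ (i, j) else 0)"
  have B: "B \<in> carrier_mat m m" by (simp add: B_def)
  have "transpose_mat B *\<^sub>v unit_vec m (m - 1) = 0\<^sub>v m"
    using assms by (intro eq_vecI) (auto simp: B_def)
  moreover have "unit_vec m (m - 1) \<noteq> (0\<^sub>v m :: complex vec)"
    using assms(2) arg_cong[of _ _ "\<lambda>u. u $ (m - 1)"] by fastforce
  ultimately have "det (transpose_mat B) = 0"
    using det_0_iff_vec_prod_zero[of "transpose_mat B" m] B by (metis transpose_carrier_mat unit_vec_carrier)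
  then have "det B = 0" using det_transpose[OF B] by simp
  then obtain v where v: "v \<in> carrier_vec m" "v \<noteq> 0\<^sub>v m" "B *\<^sub>v v = 0\<^sub>v m"
    using det_0_iff_vec_prod_zero[OF B] by auto
  have "A *\<^sub>v v = 0\<^sub>v n"
  proof (rule eq_vecI)
    fix i assume "i < dim_vec (0\<^sub>v n :: complex vec)"
    then have i: "i < n" by simp
    then have "row A i = row B i" using A assms(2) by (auto simp: B_def intro!: eq_vecI)
    then show "(A *\<^sub>v v) $ i = 0\<^sub>v n $ i"
      using arg_cong[OF v(3), of "\<lambda>u. u $ i"] i A B assms(2) by simp
  qed (use A in auto)
  then show ?thesis using v by blast
qed

section \<open>Kronecker canonical form\<close>

lemma last_row_zero_split:
  assumes P: "P \<in> pair_space m n" and m: "m \<noteq> 0"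
    and z: "row (fst P) (m - 1) = 0\<^sub>v n" "row (snd P) (m - 1) = 0\<^sub>v n"
  shows "\<exists>Q \<in> pair_space (m - 1) n. P = dsum Q (summand_pair (LT 1))"
proof -
  define Q where "Q = (mat (m - 1) n (\<lambda>ij. fst P $$ ij), mat (m - 1) n (\<lambda>ij. snd P $$ ij))"
  have e: "fst P $$ (i, j) = 0" "snd P $$ (i, j) = 0" if "i < m" "\<not> i < m - Suc 0" "j < n" for i j
  proof -
    have "i = m - 1" using that by simp
    then show "fst P $$ (i, j) = 0" "snd P $$ (i, j) = 0"
      using arg_cong[OF z(1), of "\<lambda>u. u $ j"] arg_cong[OF z(2), of "\<lambda>u. u $ j"] that P
      by (auto simp: pair_space_iff)
  qed
  have "P = dsum Q (summand_pair (LT 1))"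
    using P m by (auto simp: Q_def dsum_def ut_def zero_pair_def pair_space_iff e intro!: prod_eqI eq_matI)
  then show ?thesis by (auto simp: Q_def pair_space_iff)
qed

lemma last_row_unit_split:
  assumes P: "P \<in> pair_space m n" and m: "m \<noteq> 0" and n: "n \<noteq> 0"
    and z: "row (fst P) (m - 1) = unit_vec n (n - 1)" "row (snd P) (m - 1) = 0\<^sub>v n"
  shows "\<exists>Q \<in> pair_space (m - 1) (n - 1). \<exists>x \<in> carrier_vec (m - 1). pair_iso m n P (colext Q x)"
proof -
  define Q where "Q = (mat (m - 1) (n - 1) (\<lambda>ij. fst P $$ ij), mat (m - 1) (n - 1) (\<lambda>ij. snd P $$ ij))"
  define X where "X = (mat (m - 1) 1 (\<lambda>(i, j). fst P $$ (i, n - 1)), mat (m - 1) 1 (\<lambda>(i, j). snd P $$ (i, n - 1)))"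
  define x where "x = vec (m - 1) (\<lambda>i. snd P $$ (i, n - 1))"
  have Q: "Q \<in> pair_space (m - 1) (n - 1)" and X: "X \<in> pair_space (m - 1) 1"
    by (simp_all add: Q_def X_def pair_space_iff)
  have e: "fst P $$ (i, j) = (if j < n - Suc 0 then 0 else 1)" "snd P $$ (i, j) = 0"
    if "i < m" "\<not> i < m - Suc 0" "j < n" for i j
  proof -
    have "i = m - 1" using that by simp
    then show "fst P $$ (i, j) = (if j < n - Suc 0 then 0 else 1)" "snd P $$ (i, j) = 0"
      using arg_cong[OF z(1), of "\<lambda>u. u $ j"] arg_cong[OF z(2), of "\<lambda>u. u $ j"] that P
      by (auto simp: pair_space_iff)
  qed
  have e': "A $$ (i, n - Suc 0) = A $$ (i, j)" if "j < n" "\<not> j < n - Suc 0" for i j and A :: "complex mat"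
  proof -
    have "j = n - 1" using that by simp
    then show ?thesis by simp
  qed
  have P_eq: "P = ut Q X point_pair"
    using P m n
    by (auto simp: Q_def X_def ut_def point_pair_def pair_space_iff e intro!: prod_eqI eq_matI) (metis e')+
  have "pair_iso (m - 1 + 1) (n - 1 + 1) (ut Q X point_pair) (colext Q x)"
    unfolding colext_def
  \<comment> \<open>Multiples of the last row clear the last column of the first matrix; they leave
    the second matrix alone, since its last row is zero.\<close>
  proof (rule ut_iso[OF Q Q point_pair_space point_pair_space X, where Z = "- fst X" and W = "0\<^sub>m (n - 1) 1"])
    show "(0\<^sub>m (dim_vec x) 1, mat (dim_vec x) 1 (\<lambda>(i, j). x $ i)) \<in> pair_space (m - 1) 1"
      by (simp add: x_def pair_space_iff)
    show "unit_mat (m - 1) (1\<^sub>m (m - 1))" "unit_mat (n - 1) (1\<^sub>m (n - 1))" "unit_mat 1 (1\<^sub>m 1)" "unit_mat 1 (1\<^sub>m 1)"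
      by simp_all
  qed (use Q X in \<open>auto simp: pair_space_iff pair_hom_def point_pair_def x_def X_def intro!: eq_matI\<close>)
  then have "pair_iso m n P (colext Q x)" using P_eq m n by simp
  moreover have "x \<in> carrier_vec (m - 1)" by (simp add: x_def)
  ultimately show ?thesis using Q by blast
qed

lemma row_mult_mat:
  fixes A B :: "complex mat"
  shows "A \<in> carrier_mat m n \<Longrightarrow> B \<in> carrier_mat n p \<Longrightarrow> i < m \<Longrightarrow>
    row (A * B) i = transpose_mat B *\<^sub>v row A i"
  by (intro eq_vecI) (auto simp: comm_scalar_prod[of _ n])

text \<open>A left null vector \<open>v\<close> of \<open>snd P\<close> is the last row of some
  invertible \<open>S\<close>, so the last row of \<open>S * snd P\<close> vanishes. If the last row
  of \<open>S * fst P\<close> vanishes too, a zero row splits off, which is \<open>LT 1\<close>;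
  otherwise a change of columns makes it a unit vector and the pair becomes a one-column extension
  of a smaller one.\<close>

lemma cokernel_split:
  assumes P: "P \<in> pair_space m n" and v: "v \<in> carrier_vec m" "v \<noteq> 0\<^sub>v m"
    and z: "transpose_mat (snd P) *\<^sub>v v = 0\<^sub>v n"
  shows "(\<exists>Q \<in> pair_space (m - 1) n. pair_iso m n P (dsum Q (summand_pair (LT 1)))) \<or>
    n \<noteq> 0 \<and> (\<exists>Q \<in> pair_space (m - 1) (n - 1). \<exists>x \<in> carrier_vec (m - 1). pair_iso m n P (colext Q x))"
proof -
  have m: "m \<noteq> 0" using v by (cases m) auto
  obtain S where S: "unit_mat m S" "row S (m - 1) = v" using unit_mat_with_last_row[OF v] by blast
  note Sc = unit_mat_carrier[OF S(1)]
  define P1 where "P1 = (S * fst P, S * snd P)"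
  have P1: "P1 \<in> pair_space m n" using P Sc by (auto simp: P1_def pair_space_iff)
  have iso1: "pair_iso m n P P1"
    using P P1 S by (intro pair_isoI[of _ _ _ _ S "1\<^sub>m n"]) (auto simp: P1_def pair_hom_def pair_space_iff)
  have r1: "row (snd P1) (m - 1) = 0\<^sub>v n"
    using P Sc m S(2) z row_mult_mat[of S m m "snd P" n "m - 1"] by (simp add: P1_def pair_space_iff)
  define w where "w = row (fst P1) (m - 1)"
  have w: "w \<in> carrier_vec n" using P1 by (auto simp: w_def pair_space_iff)
  show ?thesis
  proof (cases "w = 0\<^sub>v n")
    case True
    then obtain Q where "Q \<in> pair_space (m - 1) n" "P1 = dsum Q (summand_pair (LT 1))"
      using last_row_zero_split[OF P1 m _ r1] unfolding w_def by blast
    then show ?thesis using iso1 by blast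
  next
    case False
    then have n: "n \<noteq> 0" using w by (cases n) auto
    obtain T where T: "unit_mat n T" "row T (n - 1) = w" using unit_mat_with_last_row[OF w False] by blast
    obtain R where R: "R \<in> carrier_mat n n" "T * R = 1\<^sub>m n" "R * T = 1\<^sub>m n"
      using T(1) by (auto simp: unit_mat_def)
    note Tc = unit_mat_carrier[OF T(1)]
    define P2 where "P2 = (fst P1 * R, snd P1 * R)"
    have P2: "P2 \<in> pair_space m n" using P1 R by (auto simp: P2_def pair_space_iff)
    have "1\<^sub>m m * A = A * R * T" if "A \<in> carrier_mat m n" for A
      using that R Tc assoc_mult_mat[of A m n R n T n] right_mult_one_mat[OF that] left_mult_one_mat[OF that] by simp
    then have "pair_hom P1 P2 (1\<^sub>m m) T"
      using P1 unfolding P2_def pair_hom_def pair_space_iff fst_conv snd_conv by blast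
    then have iso2: "pair_iso m n P1 P2"
      by (rule pair_isoI[OF P1 P2 unit_mat_one T(1)])
    have "row (snd P2) (m - 1) = 0\<^sub>v n"
    proof -
      have "transpose_mat R *\<^sub>v 0\<^sub>v n = 0\<^sub>v n" using R(1) by (intro eq_vecI) auto
      then show ?thesis
        using P1 R(1) m r1 row_mult_mat[of "snd P1" m n R n "m - 1"] by (simp add: P2_def pair_space_iff)
    qed
    moreover have "row (fst P2) (m - 1) = unit_vec n (n - 1)"
    proof -
      have "row (fst P2) (m - 1) = transpose_mat R *\<^sub>v w"
        using P1 R(1) m row_mult_mat[of "fst P1" m n R n "m - 1"] by (simp add: P2_def pair_space_iff w_def)
      also have "\<dots> = row (T * R) (n - 1)"
        using row_mult_mat[of T n n R n "n - 1"] Tc R(1) n T(2) by simp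
      also have "\<dots> = unit_vec n (n - 1)" using n unfolding R(2) by simp
      finally show ?thesis .
    qed
    ultimately obtain Q x where "Q \<in> pair_space (m - 1) (n - 1)" "x \<in> carrier_vec (m - 1)" "pair_iso m n P2 (colext Q x)"
      using last_row_unit_split[OF P2 m n] by blast
    then show ?thesis using iso1 iso2 n pair_iso_trans by blast
  qed
qed

lemma similar_pair_iso:
  fixes A B :: "complex mat"
  assumes "similar_mat A B" "A \<in> carrier_mat n n"
  shows "pair_iso n n (1\<^sub>m n, A) (1\<^sub>m n, B)" "pair_iso n n (A, 1\<^sub>m n) (B, 1\<^sub>m n)"
proof -
  obtain S T where "similar_mat_wit A B S T" using assms by (auto simp: similar_mat_def)
  then have 1: "B \<in> carrier_mat n n" "S \<in> carrier_mat n n" "T \<in> carrier_mat n n"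
    "S * T = 1\<^sub>m n" "T * S = 1\<^sub>m n" "A = S * B * T"
    using assms(2) by (auto simp: similar_mat_wit_def Let_def)
  have "T * A = T * (S * (B * T))"
    unfolding 1(6) using assoc_mult_mat[OF 1(2,1,3)] by simp
  also have "\<dots> = (T * S) * (B * T)"
    using assoc_mult_mat[OF 1(3,2), of "B * T" n] 1(1,3) by simp
  also have "\<dots> = B * T" using 1(1,3) unfolding 1(5) by simp
  finally have TA: "T * A = B * T" .
  have "unit_mat n T" using 1 by (auto simp: unit_mat_def)
  then show "pair_iso n n (1\<^sub>m n, A) (1\<^sub>m n, B)" "pair_iso n n (A, 1\<^sub>m n) (B, 1\<^sub>m n)"
    using TA 1(1,3) assms(2) by (auto intro!: pair_isoI[of _ _ _ _ T T] simp: pair_hom_def pair_space_iff)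
qed

lemma jordan_matrix_direct_sum:
  assumes "0 \<notin> fst ` set nas"
  shows "\<exists>ys. (\<forall>x \<in> set ys. valid_summand x) \<and>
    pair_iso (sum_list (map fst nas)) (sum_list (map fst nas))
      (1\<^sub>m (sum_list (map fst nas)), jordan_matrix nas) (direct_sum ys)"
proof (intro exI conjI)
  let ?ys = "map (\<lambda>(k, a). D (Finite a) k) nas"
  show "\<forall>x \<in> set ?ys. valid_summand x"
  proof
    fix x assume "x \<in> set ?ys"
    then obtain k a where "(k, a) \<in> set nas" "x = D (Finite a) k" by auto
    then show "valid_summand x" using assms by (cases k) force+
  qed
  have "direct_sum ?ys = (1\<^sub>m (sum_list (map fst nas)), jordan_matrix nas)"
  proof (induction nas)
    case Nil
    then show ?case by (auto simp: direct_sum_Nil zero_pair_def jordan_matrix_def intro!: eq_matI)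
  next
    case (Cons p nas)
    obtain k a where p: "p = (k, a)" by fastforce
    have "dim_row (jordan_matrix nas) = sum_list (map fst nas)" "dim_col (jordan_matrix nas) = sum_list (map fst nas)" by simp_all
    then have "(1\<^sub>m (sum_list (map fst (p # nas))), jordan_matrix (p # nas)) =
        dsum (summand_pair (D (Finite a) k)) (1\<^sub>m (sum_list (map fst nas)), jordan_matrix nas)"
      by (simp add: p dsum_def ut_def zero_pair_def jordan_matrix_Cons)
    also have "\<dots> = direct_sum (map (\<lambda>(k, a). D (Finite a) k) (p # nas))"
      unfolding Cons[symmetric] by (simp only: p list.map prod.case direct_sum_Cons)
    finally show ?case by simp
  qed
  then show "pair_iso (sum_list (map fst nas)) (sum_list (map fst nas))
      (1\<^sub>m (sum_list (map fst nas)), jordan_matrix nas) (direct_sum ?ys)"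
    by (simp add: pair_iso_refl pair_space_iff)
qed

lemma jordan_nf_complex_exists:
  fixes A :: "complex mat"
  assumes "A \<in> carrier_mat n n"
  shows "\<exists>nas. jordan_nf A nas"
  using char_poly_factorized[OF assms] by (elim exE conjE) (rule jordan_nf_exists[OF assms])

lemma jordan_matrix_dim_eq:
  fixes A :: "complex mat"
  assumes "similar_mat A (jordan_matrix nas)" "A \<in> carrier_mat n n"
  shows "sum_list (map fst nas) = n"
proof -
  have "jordan_matrix nas \<in> carrier_mat n n"
    using pair_iso_space(2)[OF similar_pair_iso(1)[OF assms]] unfolding pair_space_iff snd_conv by (rule conjunct2)
  from carrier_matD(1)[OF this] show ?thesis by simp
qed

lemma identity_pair_canonical:
  assumes A: "A \<in> carrier_mat n n"
  shows "\<exists>ys. (\<forall>x \<in> set ys. valid_summand x) \<and> pair_iso n n (1\<^sub>m n, A) (direct_sum ys)"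
proof -
  obtain nas where nas: "jordan_nf A nas" using jordan_nf_complex_exists[OF A] by (rule exE)
  then have sim: "similar_mat A (jordan_matrix nas)" and z: "0 \<notin> fst ` set nas"
    by (auto simp: jordan_nf_def)
  have n: "sum_list (map fst nas) = n"
    by (rule jordan_matrix_dim_eq[OF sim A])
  from jordan_matrix_direct_sum[OF z] obtain ys
    where "\<forall>x \<in> set ys. valid_summand x" "pair_iso n n (1\<^sub>m n, jordan_matrix nas) (direct_sum ys)"
    unfolding n by blast
  then show ?thesis using pair_iso_trans[OF similar_pair_iso(1)[OF sim A]] by blast
qed

text \<open>Jordan blocks of \<open>A\<close> for the eigenvalue 0 are the summands at infinity.
  Every other block \<open>J\<close> is invertible, and \<open>(J, 1)\<close> is equivalent to
  \<open>(1, T)\<close> with \<open>T\<close> the inverse of \<open>J\<close>, which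
  \<open>identity_pair_canonical\<close> handles.\<close>

lemma regular_pair_canonical:
  assumes A: "A \<in> carrier_mat n n"
  shows "\<exists>ys. (\<forall>x \<in> set ys. valid_summand x) \<and> pair_iso n n (A, 1\<^sub>m n) (direct_sum ys)"
proof -
  obtain nas where nas: "jordan_nf A nas" using jordan_nf_complex_exists[OF A] by (rule exE)
  then have sim: "similar_mat A (jordan_matrix nas)" and z: "0 \<notin> fst ` set nas"
    by (auto simp: jordan_nf_def)
  have n: "sum_list (map fst nas) = n"
    by (rule jordan_matrix_dim_eq[OF sim A])
  have block: "\<exists>ys. (\<forall>x \<in> set ys. valid_summand x) \<and> pair_iso k k (jordan_block k a, 1\<^sub>m k) (direct_sum ys)"
    if "k \<noteq> 0" for k and a :: complex
  proof (cases "a = 0")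
    case True
    then show ?thesis using that summand_space[of "D Infinite k"]
      by (intro exI[of _ "[D Infinite k]"]) (simp add: pair_iso_refl)
  next
    case False
    then obtain T where T: "T \<in> carrier_mat k k" "jordan_block k a * T = 1\<^sub>m k" "T * jordan_block k a = 1\<^sub>m k"
      using unit_jordan_block[of a k] by (auto simp: unit_mat_def)
    then have "unit_mat k T" by (auto simp: unit_mat_def)
    then have "pair_iso k k (jordan_block k a, 1\<^sub>m k) (1\<^sub>m k, T)"
      using T by (intro pair_isoI[of _ _ _ _ T "1\<^sub>m k"]) (auto simp: pair_hom_def pair_space_iff)
    then show ?thesis using identity_pair_canonical[OF T(1)] pair_iso_trans by blast
  qed
  have "\<exists>ys. (\<forall>x \<in> set ys. valid_summand x) \<and>
      pair_iso (sum_list (map fst nas)) (sum_list (map fst nas))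
        (jordan_matrix nas, 1\<^sub>m (sum_list (map fst nas))) (direct_sum ys)"
    using z
  proof (induction nas)
    case Nil
    have "(jordan_matrix [], 1\<^sub>m 0) = direct_sum []"
      by (auto simp: direct_sum_Nil zero_pair_def jordan_matrix_def intro!: eq_matI)
    then show ?case using direct_sum_in_pair_space[of "[]"] by (intro exI[of _ "[]"]) (simp add: pair_iso_refl)
  next
    case (Cons p nas)
    obtain k a where p: "p = (k, a)" by fastforce
    let ?n = "sum_list (map fst nas)"
    obtain ys where ys: "\<forall>x \<in> set ys. valid_summand x" "pair_iso ?n ?n (jordan_matrix nas, 1\<^sub>m ?n) (direct_sum ys)"
      using Cons by auto
    obtain zs where zs: "\<forall>x \<in> set zs. valid_summand x" "pair_iso k k (jordan_block k a, 1\<^sub>m k) (direct_sum zs)"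
      using block[of k a] Cons.prems p by auto
    have "dim_row (jordan_matrix nas) = ?n" "dim_col (jordan_matrix nas) = ?n" by simp_all
    then have "(jordan_matrix (p # nas), 1\<^sub>m (k + ?n)) = dsum (jordan_block k a, 1\<^sub>m k) (jordan_matrix nas, 1\<^sub>m ?n)"
      by (simp add: p dsum_def ut_def zero_pair_def jordan_matrix_Cons)
    then show ?case
      using dsum_cong[OF zs(2) ys(2)] zs(1) ys(1)
      by (intro exI[of _ "zs @ ys"]) (auto simp: p direct_sum_append)
  qed
  then show ?thesis
    using pair_iso_trans[OF similar_pair_iso(2)[OF sim A]] unfolding n by blast
qed

text \<open>Induction on the size. A left null vector of \<open>snd P\<close> allows
  \<open>cokernel_split\<close>, a right null vector allows it for the transpose; if there is
  neither, \<open>snd P\<close> is square and invertible and can be made the identity.\<close>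

theorem kronecker_canonical_form:
  assumes "P \<in> pair_space m n"
  shows "\<exists>ys. (\<forall>x \<in> set ys. valid_summand x) \<and> pair_iso m n P (direct_sum ys)"
  using assms
proof (induction "m + n" arbitrary: m n P rule: less_induct)
  case less
  \<comment> \<open>Stated for all \<open>k\<close>, \<open>l\<close> with the right sum, so that it
    applies to the transposed pair as well.\<close>
  have coker: "\<exists>ys. (\<forall>x \<in> set ys. valid_summand x) \<and> pair_iso k l P (direct_sum ys)"
    if kl: "k + l = m + n" and P: "P \<in> pair_space k l" and v: "v \<in> carrier_vec k" "v \<noteq> 0\<^sub>v k"
      and z: "transpose_mat (snd P) *\<^sub>v v = 0\<^sub>v l" for P k l v
  proof -
    have k: "k \<noteq> 0" using v by (cases k) auto
    then have lt: "k - 1 + l < m + n" "k - 1 + (l - 1) < m + n" using kl by simp_all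
    show ?thesis
      using cokernel_split[OF P v z]
    proof
      assume "\<exists>Q \<in> pair_space (k - 1) l. pair_iso k l P (dsum Q (summand_pair (LT 1)))"
      then obtain Q where Q: "Q \<in> pair_space (k - 1) l" "pair_iso k l P (dsum Q (summand_pair (LT 1)))" by blast
      obtain ys where ys: "\<forall>x \<in> set ys. valid_summand x" "pair_iso (k - 1) l Q (direct_sum ys)"
        using less.hyps[OF lt(1) Q(1)] by blast
      have "pair_iso k l (dsum Q (summand_pair (LT 1))) (direct_sum (ys @ [LT 1]))"
        using dsum_cong[OF ys(2) pair_iso_refl[OF summand_space[of "LT 1"]]] k
        by (simp add: direct_sum_append del: summand_pair.simps)
      from pair_iso_trans[OF Q(2) this] show ?thesis
        using ys(1) by (intro exI[of _ "ys @ [LT 1]"]) auto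
    next
      assume "l \<noteq> 0 \<and> (\<exists>Q \<in> pair_space (k - 1) (l - 1). \<exists>x \<in> carrier_vec (k - 1). pair_iso k l P (colext Q x))"
      then obtain Q x where l: "l \<noteq> 0" and Q: "Q \<in> pair_space (k - 1) (l - 1)" and x: "x \<in> carrier_vec (k - 1)"
        and iso: "pair_iso k l P (colext Q x)" by blast
      obtain ys where ys: "\<forall>x \<in> set ys. valid_summand x" "pair_iso (k - 1) (l - 1) Q (direct_sum ys)"
        using less.hyps[OF lt(2) Q] by blast
      obtain S R where SR: "unit_mat (k - 1) S" "unit_mat (l - 1) R" "pair_hom Q (direct_sum ys) S R"
        using ys(2) by (auto simp: pair_iso_def)
      have c: "row_count ys = k - 1" "col_count ys = l - 1"
        using pair_iso_space(2)[OF ys(2)] by (auto simp: pair_space_iff)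
      have "colred (k - 1) (l - 1) Q (direct_sum ys) x (S *\<^sub>v x)"
        by (rule colred_exact[OF Q pair_iso_space(2)[OF ys(2)] x SR refl])
      then have iso': "pair_iso k l (colext Q x) (colext (direct_sum ys) (S *\<^sub>v x))"
        using colred_iso[of "k - 1" "l - 1"] k l by simp
      obtain zs where "\<forall>x \<in> set zs. valid_summand x"
        "pair_iso k l (colext (direct_sum ys) (S *\<^sub>v x)) (direct_sum zs)"
        using colext_direct_sum[OF ys(1), of "S *\<^sub>v x"] c k l unit_mat_carrier[OF SR(1)] x by auto
      then show ?thesis using pair_iso_trans[OF iso pair_iso_trans[OF iso']] by blast
    qed
  qed
  show ?case
  proof (cases "\<exists>v \<in> carrier_vec m. v \<noteq> 0\<^sub>v m \<and> transpose_mat (snd P) *\<^sub>v v = 0\<^sub>v n")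
    case True
    then show ?thesis using coker less.prems by blast
  next
    case inj: False
    show ?thesis
    proof (cases "\<exists>v \<in> carrier_vec n. v \<noteq> 0\<^sub>v n \<and> snd P *\<^sub>v v = 0\<^sub>v m")
      case True
      then obtain v where v: "v \<in> carrier_vec n" "v \<noteq> 0\<^sub>v n" "transpose_mat (snd (tr P)) *\<^sub>v v = 0\<^sub>v m"
        unfolding tr_def snd_conv transpose_transpose by blast
      obtain ys where ys: "\<forall>x \<in> set ys. valid_summand x" "pair_iso n m (tr P) (direct_sum ys)"
        using coker[OF add.commute tr_space[OF less.prems] v] by blast
      have "row_count ys = n" "col_count ys = m"
        using pair_iso_space(2)[OF ys(2)] by (auto simp: pair_space_iff)
      then have "pair_iso m n P (direct_sum (map dual ys))"
        using pair_iso_trans[OF tr_iso[OF ys(2)]] tr_direct_sum[of ys] by simp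
      then show ?thesis using ys(1) by (intro exI[of _ "map dual ys"]) auto
    next
      case False
      have c: "snd P \<in> carrier_mat m n" "fst P \<in> carrier_mat m n" using less.prems by (auto simp: pair_space_iff)
      have "transpose_mat (snd P) \<in> carrier_mat n m" using c(1) by simp
      from wide_mat_kernel[OF this] inj have "\<not> n < m" by blast
      moreover from wide_mat_kernel[OF c(1)] False have "\<not> m < n" by blast
      ultimately have mn: "m = n" by simp
      have "unit_mat n (snd P)"
        by (rule unit_matI_kernel) (use c(1) False mn in blast)+
      then obtain T where T: "T \<in> carrier_mat n n" "snd P * T = 1\<^sub>m n" "T * snd P = 1\<^sub>m n"
        unfolding unit_mat_def by blast
      have uT: "unit_mat n T" using T c(1) unfolding mn unit_mat_def by blast
      have "pair_iso n n P (T * fst P, 1\<^sub>m n)"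
        by (rule pair_isoI[of _ _ _ _ T "1\<^sub>m n", OF _ _ uT]) (use T c mn in \<open>simp_all add: pair_hom_def pair_space_iff\<close>)
      moreover obtain ys where "\<forall>x \<in> set ys. valid_summand x" "pair_iso n n (T * fst P, 1\<^sub>m n) (direct_sum ys)"
        using regular_pair_canonical[of "T * fst P" n] mult_carrier_mat[OF T(1)] c mn by blast
      ultimately show ?thesis unfolding mn using pair_iso_trans by blast
    qed
  qed
qed

section \<open>Dimensions of solution spaces\<close>

text \<open>Vectors are plain functions on indices: solutions can be shifted, cut and glued without
  carriers, and only the values below \<open>dim_col M\<close> count.\<close>

definition mapp :: "complex mat \<Rightarrow> (nat \<Rightarrow> complex) \<Rightarrow> nat \<Rightarrow> complex" where
  "mapp M u r = (\<Sum>q<dim_col M. M $$ (r, q) * u q)"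

lemma mapp_mult:
  assumes "A \<in> carrier_mat m n" "B \<in> carrier_mat n p" "r < m"
  shows "mapp (A * B) u r = mapp A (mapp B u) r"
proof -
  have "mapp (A * B) u r = (\<Sum>q<p. (\<Sum>k<n. A $$ (r, k) * B $$ (k, q)) * u q)"
    using assms by (auto simp: mapp_def scalar_prod_def atLeast0LessThan intro!: sum.cong)
  also have "\<dots> = (\<Sum>q<p. \<Sum>k<n. A $$ (r, k) * (B $$ (k, q) * u q))"
    by (simp add: sum_distrib_right mult.assoc)
  also have "\<dots> = (\<Sum>k<n. \<Sum>q<p. A $$ (r, k) * (B $$ (k, q) * u q))" by (rule sum.swap)
  also have "\<dots> = mapp A (mapp B u) r" using assms by (simp add: mapp_def sum_distrib_left)
  finally show ?thesis .
qed

lemma mapp_cong: "(\<And>q. q < dim_col M \<Longrightarrow> u q = v q) \<Longrightarrow> mapp M u r = mapp M v r"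
  by (simp add: mapp_def)

lemma mapp_sum: "mapp M (\<lambda>q. \<Sum>p\<in>C. a p * u p q) r = (\<Sum>p\<in>C. a p * mapp M (u p) r)"
proof -
  have "mapp M (\<lambda>q. \<Sum>p\<in>C. a p * u p q) r = (\<Sum>q<dim_col M. \<Sum>p\<in>C. a p * (M $$ (r, q) * u p q))"
    by (simp add: mapp_def sum_distrib_left mult.left_commute)
  also have "\<dots> = (\<Sum>p\<in>C. \<Sum>q<dim_col M. a p * (M $$ (r, q) * u p q))" by (rule sum.swap)
  finally show ?thesis by (simp add: mapp_def sum_distrib_left)
qed

lemma mapp_zero [simp]: "mapp M (\<lambda>q. 0) r = 0"
  by (simp add: mapp_def)

lemma mapp_one: "r < n \<Longrightarrow> mapp (1\<^sub>m n) u r = u r"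
proof -
  assume r: "r < n"
  then have "mapp (1\<^sub>m n) u r = (\<Sum>q<n. if q = r then u r else 0)"
    unfolding mapp_def by (intro sum.cong) auto
  then show ?thesis using r by simp
qed

lemma mapp_L: "r < n - 1 \<Longrightarrow> mapp (L_mat n) u r = u r"
proof -
  assume r: "r < n - 1"
  then have "mapp (L_mat n) u r = (\<Sum>q<n. if q = r then u r else 0)"
    unfolding mapp_def by (intro sum.cong) auto
  then show ?thesis using r by simp
qed

lemma mapp_R: "r < n - 1 \<Longrightarrow> mapp (R_mat n) u r = u (Suc r)"
proof -
  assume r: "r < n - 1"
  then have "mapp (R_mat n) u r = (\<Sum>q<n. if q = Suc r then u (Suc r) else 0)"
    unfolding mapp_def by (intro sum.cong) auto
  then show ?thesis using r by simp
qed

lemma mapp_LT: "r < n \<Longrightarrow> mapp (transpose_mat (L_mat n)) u r = (if r < n - 1 then u r else 0)"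
proof -
  assume r: "r < n"
  then have "mapp (transpose_mat (L_mat n)) u r = (\<Sum>q<n - 1. if q = r then u r else 0)"
    unfolding mapp_def by (intro sum.cong) auto
  then show ?thesis using r by simp
qed

lemma mapp_RT: "r < n \<Longrightarrow> mapp (transpose_mat (R_mat n)) u r = (if r = 0 then 0 else u (r - 1))"
proof -
  assume r: "r < n"
  then have "mapp (transpose_mat (R_mat n)) u r = (\<Sum>q<n - 1. if q = r - 1 then (if r = 0 then 0 else u (r - 1)) else 0)"
    unfolding mapp_def by (intro sum.cong) auto
  then show ?thesis using r by auto
qed

lemma mapp_jordan: "r < n \<Longrightarrow> mapp (jordan_block n a) u r = a * u r + (if Suc r < n then u (Suc r) else 0)"
proof -
  assume r: "r < n"
  then have "mapp (jordan_block n a) u r =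
      (\<Sum>q<n. (if q = r then a * u r else 0) + (if q = Suc r then u (Suc r) else 0))"
    unfolding mapp_def by (intro sum.cong) auto
  then show ?thesis using r by (simp add: sum.distrib)
qed

lemma mapp_minus:
  "A \<in> carrier_mat m n \<Longrightarrow> B \<in> carrier_mat m n \<Longrightarrow> r < m \<Longrightarrow> mapp (A - c \<cdot>\<^sub>m B) u r = mapp A u r - c * mapp B u r"
  by (auto simp: mapp_def sum_distrib_left sum_subtractf algebra_simps)

lemma mapp_block_diag:
  assumes "A \<in> carrier_mat a b" "B \<in> carrier_mat c d" "r < a + c"
  shows "mapp (four_block_mat A (0\<^sub>m a d) (0\<^sub>m c b) B) u r =
    (if r < a then mapp A u r else mapp B (\<lambda>q. u (q + b)) (r - a))"
proof -
  let ?M = "four_block_mat A (0\<^sub>m a d) (0\<^sub>m c b) B"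
  have "mapp ?M u r = (\<Sum>q<b + d. ?M $$ (r, q) * u q)" using assms by (simp add: mapp_def)
  also have "\<dots> = (\<Sum>q<b. ?M $$ (r, q) * u q) + (\<Sum>q<d. ?M $$ (r, q + b) * u (q + b))"
    using sum.atLeastLessThan_concat[of 0 b "b + d" "\<lambda>q. ?M $$ (r, q) * u q"]
      sum.shift_bounds_nat_ivl[of "\<lambda>q. ?M $$ (r, q) * u q" 0 b d]
    by (simp add: atLeast0LessThan add.commute)
  finally show ?thesis using assms by (auto simp: mapp_def)
qed

text \<open>Solutions of \<open>E u\<^sub>0 = 0\<close>, \<open>E u\<^bsub>c+1\<^esub> = F u\<^sub>c\<close>, and, when the flag is set, \<open>F u\<^bsub>k-1\<^esub> = 0\<close>
  are the homomorphisms into a pair from an indecomposable pair of Jordan type, respectively of type \<open>L\<^sub>k\<close>.\<close>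

definition chain_sol :: "bool \<Rightarrow> nat \<Rightarrow> matrix_pair \<Rightarrow> (nat \<Rightarrow> nat \<Rightarrow> complex) \<Rightarrow> bool" where
  "chain_sol fl k P u \<longleftrightarrow> (\<forall>r < dim_row (fst P).
     (0 < k \<longrightarrow> mapp (fst P) (u 0) r = 0) \<and>
     (\<forall>c. Suc c < k \<longrightarrow> mapp (fst P) (u (Suc c)) r = mapp (snd P) (u c) r) \<and>
     (fl \<longrightarrow> 0 < k \<longrightarrow> mapp (snd P) (u (k - 1)) r = 0))"

definition coord_inj :: "bool \<Rightarrow> nat \<Rightarrow> matrix_pair \<Rightarrow> (nat \<times> nat) set \<Rightarrow> bool" where
  "coord_inj fl k P C \<longleftrightarrow> (\<forall>u. chain_sol fl k P u \<longrightarrow> (\<forall>(c, q) \<in> C. u c q = 0) \<longrightarrow>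
     (\<forall>c < k. \<forall>q < dim_col (fst P). u c q = 0))"

definition coord_dual :: "bool \<Rightarrow> nat \<Rightarrow> matrix_pair \<Rightarrow> (nat \<times> nat) set \<Rightarrow> bool" where
  "coord_dual fl k P C \<longleftrightarrow> (\<forall>p \<in> C. \<exists>u. chain_sol fl k P u \<and>
     (\<forall>(c, q) \<in> C. u c q = (if (c, q) = p then 1 else 0)))"

lemma chain_sol_sum:
  assumes "\<And>p. p \<in> C \<Longrightarrow> chain_sol fl k P (u p)"
  shows "chain_sol fl k P (\<lambda>c q. \<Sum>p\<in>C. a p * u p c q)"
  using assms by (simp add: chain_sol_def mapp_sum)

lemma chain_sol_hom:
  assumes P: "P \<in> pair_space m n" and Q: "Q \<in> pair_space m n"
    and S: "S \<in> carrier_mat m m" and R: "R \<in> carrier_mat n n" and h: "pair_hom P Q S R"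
    and u: "chain_sol fl k P u"
  shows "chain_sol fl k Q (\<lambda>c. mapp R (u c))"
proof -
  have *: "mapp (fst Q) (mapp R v) r = mapp S (mapp (fst P) v) r"
    "mapp (snd Q) (mapp R v) r = mapp S (mapp (snd P) v) r" if "r < m" for v r
    using P Q S R h that by (auto simp: pair_space_iff pair_hom_def mapp_mult[symmetric])
  have dims: "dim_row (fst P) = m" "dim_row (fst Q) = m" "dim_col S = m"
    using P Q S by (auto simp: pair_space_iff)
  have z: "mapp S v r = 0" if "\<And>q. q < m \<Longrightarrow> v q = 0" for v r
    using mapp_cong[of S v "\<lambda>_. 0" r] that dims by simp
  show ?thesis
    using u dims unfolding chain_sol_def by (auto simp: * intro!: z mapp_cong)
qed

text \<open>The solutions dual to \<open>C'\<close> are independent. If there were more than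
  \<open>card C\<close> of them, some nontrivial combination would be carried by the invertible
  \<open>R\<close> to a solution that vanishes on \<open>C\<close>, hence to zero. Here
  \<open>A\<close> evaluates the images of the dual solutions at the coordinates in
  \<open>C\<close>.\<close>

lemma card_coord_le:
  assumes iso: "pair_iso m n P Q" and inj: "coord_inj fl k P C" and dual: "coord_dual fl k Q C'"
    and fin: "finite C" "finite C'" and sub: "C' \<subseteq> {..<k} \<times> {..<n}"
  shows "card C' \<le> card C"
proof (rule ccontr)
  assume less: "\<not> card C' \<le> card C"
  have "pair_iso m n Q P" using iso by (rule pair_iso_sym)
  then obtain S R where P: "P \<in> pair_space m n" and Q: "Q \<in> pair_space m n"
    and S: "unit_mat m S" and R: "unit_mat n R" and h: "pair_hom Q P S R"
    by (auto simp: pair_iso_def)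
  obtain T where T: "T \<in> carrier_mat n n" "T * R = 1\<^sub>m n" using R by (auto simp: unit_mat_def)
  note Rc = unit_mat_carrier[OF R]
  have "\<exists>u. \<forall>p \<in> C'. chain_sol fl k Q (u p) \<and> (\<forall>(c, q) \<in> C'. u p c q = (if (c, q) = p then 1 else 0))"
    using dual unfolding coord_dual_def by (rule bchoice)
  then obtain u where u': "\<forall>p \<in> C'. chain_sol fl k Q (u p) \<and> (\<forall>(c, q) \<in> C'. u p c q = (if (c, q) = p then 1 else 0))"
    by (rule exE)
  have u: "chain_sol fl k Q (u p)" "(c, q) \<in> C' \<Longrightarrow> u p c q = (if (c, q) = p then 1 else 0)" if "p \<in> C'" for p c q
    using bspec[OF u' that] bspec[of C' _ "(c, q)"] by fastforce+
  obtain f where f: "bij_betw f {0..<card C} C" using ex_bij_betw_nat_finite[OF fin(1)] by blast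
  obtain g where g: "bij_betw g {0..<card C'} C'" using ex_bij_betw_nat_finite[OF fin(2)] by blast
  define A where "A = mat (card C) (card C') (\<lambda>(i, j). mapp R (u (g j) (fst (f i))) (snd (f i)))"
  obtain v where v: "v \<in> carrier_vec (card C')" "v \<noteq> 0\<^sub>v (card C')" "A *\<^sub>v v = 0\<^sub>v (card C)"
    using wide_mat_kernel[of A "card C" "card C'"] less unfolding A_def by (meson mat_carrier not_le)
  define h' where "h' = inv_into {0..<card C'} g"
  define a where "a p = v $ h' p" for p
  have ag: "a (g j) = v $ j" if "j < card C'" for j
    using g that by (simp add: a_def h'_def bij_betw_def inv_into_f_f)
  define w where "w c q = (\<Sum>p\<in>C'. a p * u p c q)" for c q
  have w: "chain_sol fl k Q w" using chain_sol_sum[of C' fl k Q u a] u(1) by (simp add: w_def[abs_def])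
  have Rw: "chain_sol fl k P (\<lambda>c. mapp R (w c))"
    by (rule chain_sol_hom[OF Q P unit_mat_carrier[OF S] Rc h w])
  have "mapp R (w c) q = 0" if cq: "(c, q) \<in> C" for c q
  proof -
    obtain i where i: "i < card C" "f i = (c, q)" using bij_betw_imp_surj_on[OF f] cq by force
    have "mapp R (w c) q = (\<Sum>p\<in>C'. a p * mapp R (u p c) q)" by (simp add: w_def[abs_def] mapp_sum)
    also have "\<dots> = (\<Sum>j\<in>{0..<card C'}. a (g j) * mapp R (u (g j) c) q)"
      by (rule sum.reindex_bij_betw[OF g, symmetric])
    also have "\<dots> = (\<Sum>j\<in>{0..<card C'}. A $$ (i, j) * v $ j)"
      using i by (intro sum.cong) (auto simp: ag A_def)
    also have "\<dots> = (A *\<^sub>v v) $ i" using i v(1) by (auto simp: A_def scalar_prod_def)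
    finally show ?thesis using v(3) i by simp
  qed
  then have Rw0: "mapp R (w c) q = 0" if "c < k" "q < n" for c q
    using inj[unfolded coord_inj_def, rule_format, OF Rw, of c q] that P by (auto simp: pair_space_iff)
  have w0: "w c q = 0" if "c < k" "q < n" for c q
  proof -
    have "w c q = mapp T (mapp R (w c)) q"
      using mapp_mult[OF T(1) Rc that(2), of "w c"] mapp_one[OF that(2), of "w c"] T(2) by simp
    also have "\<dots> = 0" using mapp_cong[of T "mapp R (w c)" "\<lambda>_. 0" q] Rw0 that T(1) by auto
    finally show ?thesis .
  qed
  have "v $ j = 0" if j: "j < card C'" for j
  proof -
    obtain c q where cq: "g j = (c, q)" by fastforce
    have in_C: "(c, q) \<in> C'" using bij_betwE[OF g] j cq by force
    have "w c q = (\<Sum>p\<in>C'. if p = (c, q) then a p else 0)"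
      unfolding w_def using u(2) in_C by (intro sum.cong) auto
    also have "\<dots> = a (c, q)" using in_C fin by simp
    finally show ?thesis using w0[of c q] sub in_C ag[OF j] cq by auto
  qed
  then have "v = 0\<^sub>v (card C')" using v(1) by (intro eq_vecI) auto
  then show False using v(2) by simp
qed

text \<open>\<open>ev a\<close> moves the eigenvalue \<open>a\<close> to \<open>\<infinity>\<close>.\<close>

fun ev :: "ext_complex \<Rightarrow> matrix_pair \<Rightarrow> matrix_pair" where
  "ev (Finite a) P = (snd P - a \<cdot>\<^sub>m fst P, fst P)"
| "ev Infinite P = P"

lemma ev_space: "P \<in> pair_space m n \<Longrightarrow> ev a P \<in> pair_space m n"
  by (cases a) (auto simp: pair_space_iff)

lemma ev_iso:
  assumes "pair_iso m n P Q" shows "pair_iso m n (ev a P) (ev a Q)"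
proof (cases a)
  case (Finite c)
  obtain S R where 1: "P \<in> pair_space m n" "Q \<in> pair_space m n" "unit_mat m S" "unit_mat n R" "pair_hom P Q S R"
    using assms by (auto simp: pair_iso_def)
  note u = unit_mat_carrier[OF 1(3)] unit_mat_carrier[OF 1(4)]
  have "S * (snd P - c \<cdot>\<^sub>m fst P) = (snd Q - c \<cdot>\<^sub>m fst Q) * R"
    using 1 u by (simp add: pair_space_iff pair_hom_def mult_minus_distrib_mat[of S m m "snd P" n "c \<cdot>\<^sub>m fst P"] minus_mult_distrib_mat[of _ m n]
        mult_smult_distrib[of S m m _ n] mult_smult_assoc_mat[of _ m n R n])
  then have "pair_hom (ev a P) (ev a Q) S R" using 1(5) Finite by (simp add: pair_hom_def)
  then show ?thesis by (rule pair_isoI[OF ev_space[OF 1(1)] ev_space[OF 1(2)] 1(3,4)])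
qed (use assms in simp)

lemma ev_dsum:
  assumes "P \<in> pair_space a b" "Q \<in> pair_space c d"
  shows "ev e (dsum P Q) = dsum (ev e P) (ev e Q)"
  using assms by (cases e) (auto simp: dsum_def ut_def zero_pair_def pair_space_iff intro!: eq_matI)

text \<open>\<open>N\<close> is the dimension of the space of solutions, witnessed by a set \<open>C\<close> of coordinates on which a
  solution is determined by its values, and on which these values are arbitrary. The first half
  is an open condition on \<open>P\<close>, which is what makes \<open>N\<close> semicontinuous.\<close>

definition coords :: "bool \<Rightarrow> nat \<Rightarrow> matrix_pair \<Rightarrow> nat \<Rightarrow> bool" where
  "coords fl k P N \<longleftrightarrow> (\<exists>C. C \<subseteq> {..<k} \<times> {..<dim_col (fst P)} \<and> coord_inj fl k P C \<and> coord_dual fl k P C \<and> card C = N)"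

text \<open>The equations of a direct sum decouple, so a solution is a pair of solutions; the
  coordinates for \<open>Q\<close> are shifted by the number \<open>b\<close> of columns of
  \<open>P\<close>.\<close>

lemma coords_dsum:
  assumes P: "P \<in> pair_space a b" and Q: "Q \<in> pair_space c d" and "coords fl k P N" "coords fl k Q M"
  shows "coords fl k (dsum P Q) (N + M)"
proof -
  have dims: "dim_row (fst P) = a" "dim_col (fst P) = b" "dim_row (fst Q) = c" "dim_col (fst Q) = d"
    "dim_row (snd P) = a" "dim_col (snd P) = b" "dim_row (snd Q) = c" "dim_col (snd Q) = d"
    using P Q by (auto simp: pair_space_iff)
  obtain C where C: "C \<subseteq> {..<k} \<times> {..<b}" "coord_inj fl k P C" "coord_dual fl k P C" "card C = N"
    using assms(3) dims by (auto simp: coords_def)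
  obtain C' where C': "C' \<subseteq> {..<k} \<times> {..<d}" "coord_inj fl k Q C'" "coord_dual fl k Q C'" "card C' = M"
    using assms(4) dims by (auto simp: coords_def)
  have "fst P \<in> carrier_mat a b" "fst Q \<in> carrier_mat c d" "snd P \<in> carrier_mat a b" "snd Q \<in> carrier_mat c d"
    using P Q by (auto simp: pair_space_iff)
  note mb = mapp_block_diag[OF this(1,2)] mapp_block_diag[OF this(3,4)]
  have rows: "dim_row (fst (dsum P Q)) = a + c" "dim_col (fst (dsum P Q)) = b + d"
    using dims by (auto simp: dsum_def ut_def)
  have sol: "chain_sol fl k (dsum P Q) u \<longleftrightarrow> chain_sol fl k P u \<and> chain_sol fl k Q (\<lambda>c q. u c (q + b))" for u
  proof -
    have m: "mapp (fst (dsum P Q)) v r = (if r < a then mapp (fst P) v r else mapp (fst Q) (\<lambda>q. v (q + b)) (r - a))"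
      "mapp (snd (dsum P Q)) v r = (if r < a then mapp (snd P) v r else mapp (snd Q) (\<lambda>q. v (q + b)) (r - a))"
      if "r < a + c" for v r
      using mb[OF that, of v] mb(2)[OF that, of v] dims by (auto simp: dsum_def ut_def zero_pair_def)
    have all: "(\<forall>r < a + c. X r) \<longleftrightarrow> (\<forall>r < a. X r) \<and> (\<forall>r < c. X (r + a))" for X
    proof safe
      fix r assume "\<forall>r < a. X r" and X: "\<forall>r < c. X (r + a)" and "r < a + c"
      then show "X r" using spec[OF X, of "r - a"] by (cases "r < a") auto
    qed auto
    show ?thesis
      unfolding chain_sol_def rows dims all by (simp add: m)
  qed
  let ?g = "\<lambda>(c, q). (c, q + b)"
  let ?C = "C \<union> ?g ` C'"
  have fin: "finite C" "finite C'" using C(1) C'(1) by (auto intro: finite_subset)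
  have disj: "C \<inter> ?g ` C' = {}" using C(1) by auto
  have "?C \<subseteq> {..<k} \<times> {..<b + d}" using C(1) C'(1) by auto
  moreover have "card ?C = N + M"
  proof -
    have "inj_on ?g C'" by (auto simp: inj_on_def)
    then show ?thesis using card_Un_disjoint[OF fin(1) finite_imageI[OF fin(2)] disj] C(4) C'(4) by (simp add: card_image)
  qed
  moreover have "coord_inj fl k (dsum P Q) ?C"
    unfolding coord_inj_def sol rows
  proof (intro allI impI)
    fix u i q
    assume u: "chain_sol fl k P u \<and> chain_sol fl k Q (\<lambda>c q. u c (q + b))" and z: "\<forall>(c, q) \<in> ?C. u c q = 0"
      and i: "i < k" "q < b + d"
    have z1: "\<forall>(c, q) \<in> C. u c q = 0" and z2: "\<forall>(c, q) \<in> C'. u c (q + b) = 0" using z by auto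
    have "q' < b \<Longrightarrow> u i q' = 0" for q'
      using C(2)[unfolded coord_inj_def dims, THEN spec, THEN mp, OF conjunct1[OF u], THEN mp, OF z1] i(1) by blast
    moreover have "q' < d \<Longrightarrow> u i (q' + b) = 0" for q'
      using C'(2)[unfolded coord_inj_def dims, THEN spec, THEN mp, OF conjunct2[OF u], THEN mp, OF z2] i(1) by blast
    ultimately have "q < b \<Longrightarrow> u i q = 0" "q - b < d \<Longrightarrow> u i (q - b + b) = 0" by blast+
    then show "u i q = 0" using i(2) by (cases "q < b") auto
  qed
  moreover have "coord_dual fl k (dsum P Q) ?C"
    unfolding coord_dual_def
  proof
    fix p assume "p \<in> ?C"
    then consider "p \<in> C" | i q where "(i, q) \<in> C'" "p = (i, q + b)" by auto
    then show "\<exists>u. chain_sol fl k (dsum P Q) u \<and> (\<forall>(c, q) \<in> ?C. u c q = (if (c, q) = p then 1 else 0))"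
    proof cases
      case 1
      then obtain u where u: "chain_sol fl k P u" "\<forall>(c, q) \<in> C. u c q = (if (c, q) = p then 1 else 0)"
        using bspec[OF C(3)[unfolded coord_dual_def] 1] by (elim exE conjE)
      define w where "w c q = (if q < b then u c q else 0)" for c q
      have "chain_sol fl k P w"
      proof -
        have "mapp (fst P) (w c) r = mapp (fst P) (u c) r" "mapp (snd P) (w c) r = mapp (snd P) (u c) r" for c r
          using dims by (auto simp: w_def intro!: mapp_cong)
        then show ?thesis using u(1) by (simp add: chain_sol_def)
      qed
      moreover have "chain_sol fl k Q (\<lambda>c q. w c (q + b))" by (simp add: w_def chain_sol_def)
      moreover have "\<forall>(c, q) \<in> ?C. w c q = (if (c, q) = p then 1 else 0)"
      proof safe
        fix c q assume cq: "(c, q) \<in> C"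
        then show "w c q = (if (c, q) = p then 1 else 0)"
          using bspec[OF u(2) cq] C(1) by (auto simp: w_def)
      next
        fix c q assume "(c, q) \<in> C'"
        then show "w c (q + b) = (if (c, q + b) = p then 1 else 0)"
          using 1 C(1) by (auto simp: w_def)
      qed
      ultimately show ?thesis using sol by blast
    next
      case 2
      then obtain u where u: "chain_sol fl k Q u" "\<forall>(c, q') \<in> C'. u c q' = (if (c, q') = (i, q) then 1 else 0)"
        using bspec[OF C'(3)[unfolded coord_dual_def] 2(1)] by (elim exE conjE)
      define w where "w c q = (if q < b then 0 else u c (q - b))" for c q
      have "chain_sol fl k P w"
      proof -
        have "mapp (fst P) (w c) r = 0" "mapp (snd P) (w c) r = 0" for c r
          using mapp_cong[of "fst P" "w c" "\<lambda>_. 0" r] mapp_cong[of "snd P" "w c" "\<lambda>_. 0" r] dims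
          by (simp_all add: w_def)
        then show ?thesis by (simp add: chain_sol_def)
      qed
      moreover have "chain_sol fl k Q (\<lambda>c q. w c (q + b))" using u(1) by (simp add: w_def)
      moreover have "\<forall>(c, q) \<in> ?C. w c q = (if (c, q) = p then 1 else 0)"
      proof safe
        fix c q' assume "(c, q') \<in> C"
        then show "w c q' = (if (c, q') = p then 1 else 0)"
          using 2 C(1) by (auto simp: w_def)
      next
        fix c q' assume cq: "(c, q') \<in> C'"
        then show "w c (q' + b) = (if (c, q' + b) = p then 1 else 0)"
          using bspec[OF u(2) cq] 2(2) by (simp add: w_def)
      qed
      ultimately show ?thesis using sol by blast
    qed
  qed
  ultimately show ?thesis unfolding coords_def rows by blast
qed

definition mat_inj :: "complex mat \<Rightarrow> bool" where
  "mat_inj M \<longleftrightarrow> (\<forall>v. (\<forall>r < dim_row M. mapp M v r = 0) \<longrightarrow> (\<forall>q < dim_col M. v q = 0))"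

text \<open>The first equation gives \<open>u 0 = 0\<close>, and each chain equation then passes
  zero on to the next vector.\<close>

lemma coord_inj_empty_fst:
  assumes P: "P \<in> pair_space m n" and inj: "mat_inj (fst P)"
  shows "coord_inj fl k P {}"
  unfolding coord_inj_def
proof (intro allI impI)
  fix u c q assume u: "chain_sol fl k P u" and cq: "c < k" "q < dim_col (fst P)"
  have dims: "dim_row (fst P) = m" "dim_col (fst P) = n" "dim_col (snd P) = n" using P by (auto simp: pair_space_iff)
  from cq show "u c q = 0"
  proof (induction c arbitrary: q)
    case 0
    then show ?case using u inj unfolding chain_sol_def mat_inj_def by blast
  next
    case (Suc c)
    have "mapp (snd P) (u c) r = 0" for r
      using mapp_cong[of "snd P" "u c" "\<lambda>_. 0" r] Suc dims by simp
    then have "\<forall>r < dim_row (fst P). mapp (fst P) (u (Suc c)) r = 0"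
      using u Suc.prems(1) unfolding chain_sol_def by simp
    then show ?case using inj Suc.prems(2) unfolding mat_inj_def by blast
  qed
qed

text \<open>The end condition starts a descending induction: \<open>snd P\<close> kills the last
  vector of the chain, which is therefore zero, and the chain equations are read backwards.\<close>

lemma coord_inj_empty_snd:
  assumes P: "P \<in> pair_space m n" and inj: "mat_inj (snd P)"
  shows "coord_inj True k P {}"
  unfolding coord_inj_def
proof (intro allI impI)
  fix u c q assume u: "chain_sol True k P u" and cq: "c < k" "q < dim_col (fst P)"
  have dims: "dim_row (fst P) = m" "dim_col (fst P) = n" "dim_row (snd P) = m" "dim_col (snd P) = n"
    using P by (auto simp: pair_space_iff)
  have "t < k \<Longrightarrow> q < n \<Longrightarrow> u (k - 1 - t) q = 0" for t q
  proof (induction t arbitrary: q)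
    case 0
    then show ?case using u inj dims unfolding chain_sol_def mat_inj_def by simp
  next
    case (Suc t)
    have e: "k - 1 - t = Suc (k - 1 - Suc t)" using Suc.prems by simp
    have "mapp (fst P) (u (k - 1 - t)) r = 0" for r
      using mapp_cong[of "fst P" "u (k - 1 - t)" "\<lambda>_. 0" r] Suc dims by simp
    moreover have "mapp (fst P) (u (Suc c)) r = mapp (snd P) (u c) r" if "r < m" "Suc c < k" for r c
      using u dims that by (simp add: chain_sol_def)
    moreover have "Suc (k - 1 - Suc t) < k" using Suc.prems(1) by simp
    ultimately have "\<forall>r < m. mapp (snd P) (u (k - 1 - Suc t)) r = 0"
      unfolding e by metis
    then show ?case using inj[unfolded mat_inj_def dims] Suc.prems(2) by blast
  qed
  from this[of "k - 1 - c" q] show "u c q = 0" using cq dims by simp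
qed

lemma coords_emptyI: "coord_inj fl k P {} \<Longrightarrow> coords fl k P 0"
  unfolding coords_def coord_dual_def by (intro exI[of _ "{}"]) simp

text \<open>The contribution of one summand to an invariant, that is, the dimension of its solution
  space after passing to the dual. The truncated subtraction is meant: there is no solution unless
  \<open>m\<close> is at most \<open>k\<close>.\<close>

fun LT_num :: "nat \<Rightarrow> summand \<Rightarrow> nat" where
  "LT_num k (LT m) = k + 1 - m"
| "LT_num k _ = 0"

fun L_num :: "nat \<Rightarrow> summand \<Rightarrow> nat" where
  "L_num k (L n) = k + 1 - n"
| "L_num k _ = 0"

text \<open>A summand \<open>L n\<close> contributes \<open>k\<close> for every eigenvalue. This
  ties the Jordan invariants to the number of such summands and is why they cannot be compared
  separately.\<close>

fun D_num :: "ext_complex \<Rightarrow> nat \<Rightarrow> summand \<Rightarrow> nat" where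
  "D_num a k (L n) = k"
| "D_num a k (D b l) = (if b = a then min k l else 0)"
| "D_num a k (LT m) = 0"

lemma LR_mat_carrier: "L_mat n \<in> carrier_mat (n - Suc 0) n" "R_mat n \<in> carrier_mat (n - Suc 0) n"
  by auto

lemma coordsI:
  assumes "C \<subseteq> {..<k} \<times> {..<dim_col (fst P)}" "card C = N"
    and "\<And>u c q. chain_sol fl k P u \<Longrightarrow> \<forall>(c, q) \<in> C. u c q = 0 \<Longrightarrow> c < k \<Longrightarrow> q < dim_col (fst P) \<Longrightarrow> u c q = 0"
    and "\<And>i j. (i, j) \<in> C \<Longrightarrow> \<exists>u. chain_sol fl k P u \<and> (\<forall>(c, q) \<in> C. u c q = (if (c, q) = (i, j) then 1 else 0))"
  shows "coords fl k P N"
proof -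
  have "coord_inj fl k P C" unfolding coord_inj_def using assms(3) by blast
  moreover have "coord_dual fl k P C" unfolding coord_dual_def
  proof
    fix p assume "p \<in> C"
    then show "\<exists>u. chain_sol fl k P u \<and> (\<forall>(c, q) \<in> C. u c q = (if (c, q) = p then 1 else 0))"
      using assms(4)[of "fst p" "snd p"] by (cases p) simp
  qed
  ultimately show ?thesis using assms(1,2) unfolding coords_def by blast
qed

lemma mat_inj_upper_shift:
  assumes dims: "dim_row M = n" "dim_col M = n" and b: "b \<noteq> 0"
    and M: "\<And>v r. r < n \<Longrightarrow> mapp M v r = b * v r + c * (if Suc r < n then v (Suc r) else 0)"
  shows "mat_inj M"
  unfolding mat_inj_def dims
proof (intro allI impI)
  fix v :: "nat \<Rightarrow> complex" and q assume v: "\<forall>r < n. mapp M v r = 0" and q: "q < n"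
  have "t < n \<Longrightarrow> v (n - 1 - t) = 0" for t
  proof (induction t)
    case 0
    then show ?case using v M[of "n - 1" v] b by simp
  next
    case (Suc t)
    then have "Suc (n - 1 - Suc t) = n - 1 - t" by simp
    then show ?case using v M[of "n - 1 - Suc t" v] b Suc by simp
  qed
  from this[of "n - 1 - q"] show "v q = 0" using q by simp
qed

lemma coords_L_summand:
  assumes "valid_summand x"
  shows "coords True k (ev (Finite 0) (summand_pair x)) (L_num k x)"
proof (cases x)
  case (LT m)
  have "mat_inj (transpose_mat (L_mat m))"
    by (auto simp: mat_inj_def mapp_LT)
  then show ?thesis
    using coords_emptyI[OF coord_inj_empty_snd[OF ev_space[OF summand_space[of x]]], of "Finite 0"] LT by simp
next
  case (D a l)
  show ?thesis
  proof (cases a)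
    case (Finite b)
    have "mat_inj (1\<^sub>m l)" by (auto simp: mat_inj_def mapp_one)
    then show ?thesis
      using coords_emptyI[OF coord_inj_empty_snd[OF ev_space[OF summand_space[of x]]], of "Finite 0"] D Finite by simp
  next
    case Infinite
    have "mat_inj (1\<^sub>m l - 0 \<cdot>\<^sub>m jordan_block l 0)"
      by (auto simp: mat_inj_def mapp_minus[of _ l l] mapp_one)
    then show ?thesis
      using coords_emptyI[OF coord_inj_empty_fst[OF ev_space[OF summand_space[of x]]], of "Finite 0"] D Infinite by simp
  qed
next
  case (L n)
  have n: "1 \<le> n" using assms L by simp
  define P where "P = ev (Finite 0) (summand_pair x)"
  have E: "mapp (fst P) v r = v (Suc r)" and F: "mapp (snd P) v r = v r" if "r < n - 1" for v r
    using that L unfolding P_def by (auto simp: mapp_minus[OF LR_mat_carrier(2,1)] mapp_L mapp_R)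
  have dims: "dim_row (fst P) = n - 1" "dim_col (fst P) = n"
    using L unfolding P_def by auto
  have sol: "chain_sol True k P u \<longleftrightarrow> (\<forall>r < n - 1. (0 < k \<longrightarrow> u 0 (Suc r) = 0) \<and>
      (\<forall>c. Suc c < k \<longrightarrow> u (Suc c) (Suc r) = u c r) \<and> (0 < k \<longrightarrow> u (k - 1) r = 0))" for u
    unfolding chain_sol_def dims by (simp add: E F)
  show ?thesis
    unfolding P_def[symmetric]
  \<comment> \<open>Solutions are constant along the diagonals \<open>(c + s, s)\<close>. The end
    condition kills the diagonal from \<open>(c, 0)\<close> unless it reaches the last column
    \<open>n - 1\<close> at chain index \<open>k - 1\<close> or earlier, which means
    \<open>c + n \<le> k\<close>.\<close>
  proof (rule coordsI[where C = "(\<lambda>c. (c, 0 :: nat)) ` {c. c + n \<le> k}"])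
    show "(\<lambda>c. (c, 0 :: nat)) ` {c. c + n \<le> k} \<subseteq> {..<k} \<times> {..<dim_col (fst P)}"
      using n dims by auto
    have "{c. c + n \<le> k} = {..<k + 1 - n}" by auto
    then have "card {c. c + n \<le> k} = k + 1 - n" by simp
    moreover have "inj_on (\<lambda>c. (c, 0 :: nat)) {c. c + n \<le> k}" by (auto simp: inj_on_def)
    ultimately show "card ((\<lambda>c. (c, 0 :: nat)) ` {c. c + n \<le> k}) = L_num k x"
      using L by (simp add: card_image)
  next
    fix u c q
    assume u: "chain_sol True k P u"
      and z: "\<forall>(c, q) \<in> (\<lambda>c. (c, 0 :: nat)) ` {c. c + n \<le> k}. u c q = 0"
      and cq: "c < k" "q < dim_col (fst P)"
    note u = u[unfolded sol]
    have diag: "s < n \<Longrightarrow> c + s < k \<Longrightarrow> u (c + s) s = u c 0" for c s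
    proof (induction s)
      case (Suc s)
      have "u (Suc (c + s)) (Suc s) = u (c + s) s" using u Suc.prems by simp
      then show ?case using Suc by simp
    qed simp
    have col0: "u c 0 = 0" if "c < k" for c
    proof (cases "c + n \<le> k")
      case True
      then show ?thesis using z by auto
    next
      case False
      then have "u (c + (k - 1 - c)) (k - 1 - c) = u c 0" using that by (intro diag) auto
      moreover have "u (k - 1) (k - 1 - c) = 0" using u False that by simp
      ultimately show ?thesis using that by simp
    qed
    show "u c q = 0" using cq
    proof (induction q arbitrary: c)
      case (Suc q)
      then show ?case using u dims by (cases c) auto
    qed (use col0 in auto)
  next
    fix i j assume ij: "(i, j) \<in> (\<lambda>c. (c, 0 :: nat)) ` {c. c + n \<le> k}"
    have "chain_sol True k P (\<lambda>c q. if c = i + q then 1 else 0)"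
      unfolding sol using ij by auto
    moreover have "\<forall>(c, q) \<in> (\<lambda>c. (c, 0 :: nat)) ` {c. c + n \<le> k}.
        (if c = i + q then 1 else 0) = (if (c, q) = (i, j) then 1 else (0 :: complex))"
      using ij by auto
    ultimately show "\<exists>u. chain_sol True k P u \<and>
        (\<forall>(c, q) \<in> (\<lambda>c. (c, 0 :: nat)) ` {c. c + n \<le> k}. u c q = (if (c, q) = (i, j) then 1 else 0))"
      by (intro exI[of _ "\<lambda>c q. if c = i + q then 1 else 0"]) simp
  qed
qed

lemma coords_shift:
  assumes dims: "dim_row (fst P) = l" "dim_col (fst P) = l"
    and E: "\<And>v r. r < l \<Longrightarrow> mapp (fst P) v r = (if Suc r < l then v (Suc r) else 0)"
    and F: "\<And>v r. r < l \<Longrightarrow> mapp (snd P) v r = v r"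
  shows "coords False k P (min k l)"
proof -
  \<comment> \<open>Solutions are again constant along diagonals. A diagonal that reaches the last
    column before chain index \<open>k - 1\<close> is killed there by the next equation; those with
    \<open>k \<le> c + l\<close> survive.\<close>
  let ?C = "(\<lambda>c. (c, 0 :: nat)) ` {c. c < k \<and> k \<le> c + l}"
  have sol: "chain_sol False k P u \<longleftrightarrow> (\<forall>r < l. (0 < k \<longrightarrow> (if Suc r < l then u 0 (Suc r) else 0) = 0) \<and>
      (\<forall>c. Suc c < k \<longrightarrow> (if Suc r < l then u (Suc c) (Suc r) else 0) = u c r))" for u
    unfolding chain_sol_def dims by (simp add: E F)
  show ?thesis
  proof (rule coordsI[where C = ?C])
    show "?C \<subseteq> {..<k} \<times> {..<dim_col (fst P)}" using dims by auto
    have "{c. c < k \<and> k \<le> c + l} = {k - l..<k}" by auto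
    then have "card {c. c < k \<and> k \<le> c + l} = min k l" by simp
    moreover have "inj_on (\<lambda>c. (c, 0 :: nat)) {c. c < k \<and> k \<le> c + l}" by (auto simp: inj_on_def)
    ultimately show "card ?C = min k l" by (simp add: card_image)
  next
    fix u c q
    assume u: "chain_sol False k P u" and z: "\<forall>(c, q) \<in> ?C. u c q = 0" and cq: "c < k" "q < dim_col (fst P)"
    have u1': "(if Suc r < l then u 0 (Suc r) else 0) = 0" if "r < l" "0 < k" for r
      using u[unfolded sol] that by blast
    have u2': "(if Suc r < l then u (Suc c) (Suc r) else 0) = u c r" if "r < l" "Suc c < k" for r c
      using u[unfolded sol] that by blast
    have u1: "u 0 (Suc r) = 0" if "0 < k" "Suc r < l" for r
      using u1'[of r] that by simp
    have u2: "u (Suc c) (Suc r) = u c r" if "Suc c < k" "Suc r < l" for c r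
      using u2'[of r c] that by simp
    have u3: "u c (l - 1) = 0" if "Suc c < k" "0 < l" for c
      using u2'[of "l - 1" c] that by simp
    have diag: "s < l \<Longrightarrow> c + s < k \<Longrightarrow> u (c + s) s = u c 0" for c s
    proof (induction s)
      case (Suc s)
      then show ?case using u2[of "c + s" s] by simp
    qed simp
    have l: "0 < l" using cq dims by simp
    have col0: "u c 0 = 0" if "c < k" for c
    proof (cases "k \<le> c + l")
      case True
      then show ?thesis using z that by auto
    next
      case False
      then have "u (c + (l - 1)) (l - 1) = u c 0" using l by (intro diag) auto
      moreover have "u (c + (l - 1)) (l - 1) = 0" using False l by (intro u3) auto
      ultimately show ?thesis by simp
    qed
    show "u c q = 0" using cq
    proof (induction q arbitrary: c)
      case (Suc q)
      then show ?case using u1 u2 dims by (cases c) auto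
    qed (use col0 in auto)
  next
    fix i j assume ij: "(i, j) \<in> ?C"
    have "chain_sol False k P (\<lambda>c q. if c = i + q then 1 else 0)"
      unfolding sol using ij by auto
    moreover have "\<forall>(c, q) \<in> ?C. (if c = i + q then 1 else 0) = (if (c, q) = (i, j) then 1 else (0 :: complex))"
      using ij by auto
    ultimately show "\<exists>u. chain_sol False k P u \<and> (\<forall>(c, q) \<in> ?C. u c q = (if (c, q) = (i, j) then 1 else 0))"
      by (intro exI[of _ "\<lambda>c q. if c = i + q then 1 else 0"]) simp
  qed
qed

lemma coords_D_L:
  assumes n: "1 \<le> n"
  shows "coords False k (ev a (summand_pair (L n))) k"
proof (cases a)
  case (Finite b)
  define P where "P = ev a (summand_pair (L n))"
  \<comment> \<open>Column 0 is free, and the equations compute each further column from the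
    previous one.\<close>
  let ?C = "(\<lambda>c. (c, 0 :: nat)) ` {..<k}"
  have E: "mapp (fst P) v r = v (Suc r) - b * v r" and F: "mapp (snd P) v r = v r" if "r < n - 1" for v r
    using that Finite unfolding P_def by (auto simp: mapp_minus[OF LR_mat_carrier(2,1)] mapp_L mapp_R)
  have dims: "dim_row (fst P) = n - 1" "dim_col (fst P) = n" using Finite unfolding P_def by auto
  have sol: "chain_sol False k P u \<longleftrightarrow> (\<forall>r < n - 1. (0 < k \<longrightarrow> u 0 (Suc r) - b * u 0 r = 0) \<and>
      (\<forall>c. Suc c < k \<longrightarrow> u (Suc c) (Suc r) - b * u (Suc c) r = u c r))" for u
    unfolding chain_sol_def dims by (simp add: E F)
  show ?thesis
    unfolding P_def[symmetric]
  proof (rule coordsI[where C = ?C])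
    show "?C \<subseteq> {..<k} \<times> {..<dim_col (fst P)}" using dims n by auto
    show "card ?C = k" by (simp add: card_image inj_on_def)
  next
    fix u c q
    assume u: "chain_sol False k P u" and z: "\<forall>(c, q) \<in> ?C. u c q = 0" and cq: "c < k" "q < dim_col (fst P)"
    show "u c q = 0" using cq
    proof (induction q arbitrary: c)
      case (Suc q)
      then have "q < n - 1" using dims by simp
      then have e: "0 < k \<longrightarrow> u 0 (Suc q) - b * u 0 q = 0" "\<forall>c. Suc c < k \<longrightarrow> u (Suc c) (Suc q) - b * u (Suc c) q = u c q"
        using u[unfolded sol] by blast+
      show ?case
      proof (cases c)
        case 0
        then show ?thesis using e(1) Suc dims by simp
      next
        case (Suc c')
        then show ?thesis using spec[OF e(2), of c'] Suc.IH[of c] Suc.IH[of c'] Suc.prems dims by simp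
      qed
    qed (use z in auto)
  next
    fix i j assume ij: "(i, j) \<in> ?C"
    \<comment> \<open>The recursion from column to column, started with a single 1 at chain index
      \<open>i\<close> in column 0.\<close>
    define w where "w = rec_nat (\<lambda>c. if c = i then 1 else 0)
      (\<lambda>_ (f :: nat \<Rightarrow> complex) c. b * f c + (if c = 0 then 0 else f (c - 1)))"
    have w: "w 0 = (\<lambda>c. if c = i then 1 else 0)" "w (Suc r) = (\<lambda>c. b * w r c + (if c = 0 then 0 else w r (c - 1)))" for r
      unfolding w_def by simp_all
    have "chain_sol False k P (\<lambda>c q. w q c)" unfolding sol by (simp add: w)
    moreover have "\<forall>(c, q) \<in> ?C. w q c = (if (c, q) = (i, j) then 1 else 0)"
      using ij by (auto simp: w)
    ultimately show "\<exists>u. chain_sol False k P u \<and> (\<forall>(c, q) \<in> ?C. u c q = (if (c, q) = (i, j) then 1 else 0))"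
      by blast
  qed
next
  case Infinite
  define P where "P = ev a (summand_pair (L n))"
  \<comment> \<open>At infinity the roles of the two matrices are exchanged, so the recursion runs
    downwards from the last column.\<close>
  let ?C = "(\<lambda>c. (c, n - 1)) ` {..<k}"
  have E: "mapp (fst P) v r = v r" and F: "mapp (snd P) v r = v (Suc r)" if "r < n - 1" for v r
    using that Infinite unfolding P_def by (auto simp: mapp_L mapp_R)
  have dims: "dim_row (fst P) = n - 1" "dim_col (fst P) = n" using Infinite unfolding P_def by auto
  have sol: "chain_sol False k P u \<longleftrightarrow> (\<forall>r < n - 1. (0 < k \<longrightarrow> u 0 r = 0) \<and>
      (\<forall>c. Suc c < k \<longrightarrow> u (Suc c) r = u c (Suc r)))" for u
    unfolding chain_sol_def dims by (simp add: E F)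
  show ?thesis
    unfolding P_def[symmetric]
  proof (rule coordsI[where C = ?C])
    show "?C \<subseteq> {..<k} \<times> {..<dim_col (fst P)}" using dims n by auto
    show "card ?C = k" by (simp add: card_image inj_on_def)
  next
    fix u c q
    assume u: "chain_sol False k P u" and z: "\<forall>(c, q) \<in> ?C. u c q = 0" and cq: "c < k" "q < dim_col (fst P)"
    have "t < n \<Longrightarrow> c < k \<Longrightarrow> u c (n - 1 - t) = 0" for t c
    proof (induction t arbitrary: c)
      case (Suc t)
      then have "n - 1 - Suc t < n - 1" "Suc (n - 1 - Suc t) = n - 1 - t" by simp_all
      then have e: "0 < k \<longrightarrow> u 0 (n - 1 - Suc t) = 0"
        "\<forall>c. Suc c < k \<longrightarrow> u (Suc c) (n - 1 - Suc t) = u c (n - 1 - t)"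
        using u[unfolded sol, rule_format, of "n - 1 - Suc t"] by simp_all
      show ?case
      proof (cases c)
        case 0
        then show ?thesis using e(1) Suc.prems by simp
      next
        case (Suc c')
        then show ?thesis using spec[OF e(2), of c'] Suc.IH[of c'] Suc.prems by simp
      qed
    qed (use z in auto)
    from this[of "n - 1 - q" c] show "u c q = 0" using cq dims by simp
  next
    fix i j assume ij: "(i, j) \<in> ?C"
    let ?u = "\<lambda>c q. if c + q = i + (n - 1) then 1 else 0 :: complex"
    have "chain_sol False k P ?u" unfolding sol using ij by auto
    moreover have "\<forall>(c, q) \<in> ?C. ?u c q = (if (c, q) = (i, j) then 1 else 0)" using ij by auto
    ultimately show "\<exists>u. chain_sol False k P u \<and> (\<forall>(c, q) \<in> ?C. u c q = (if (c, q) = (i, j) then 1 else 0))"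
      by blast
  qed
qed

text \<open>After \<open>ev a\<close> the first matrix of \<open>LT m\<close> and of a block with
  another eigenvalue is injective, which leaves no solution. Only a block at \<open>a\<close>
  itself, a nilpotent shift after \<open>ev a\<close>, and \<open>L n\<close> contribute.\<close>

lemma coords_D_summand:
  assumes "valid_summand x"
  shows "coords False k (ev a (summand_pair x)) (D_num a k x)"
proof (cases x)
  case (L n)
  then show ?thesis using coords_D_L[of n] assms by simp
next
  case (LT m)
  have "mat_inj (fst (ev a (summand_pair x)))"
  proof (cases a)
    case (Finite b)
    have M: "mapp (fst (ev a (summand_pair x))) v r = (if r = 0 then 0 else v (r - 1)) - b * (if r < m - 1 then v r else 0)"
      if "r < m" for v r
      using that LT Finite by (auto simp: mapp_minus[OF LR_mat_transpose_carrier(2,1)] mapp_LT mapp_RT)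
    show ?thesis unfolding mat_inj_def
    proof (intro allI impI)
      fix v q
      assume "\<forall>r < dim_row (fst (ev a (summand_pair x))). mapp (fst (ev a (summand_pair x))) v r = 0"
        and "q < dim_col (fst (ev a (summand_pair x)))"
      then have v: "\<forall>r < m. mapp (fst (ev a (summand_pair x))) v r = 0" and q: "q < m - 1"
        using LT Finite by auto
      have "t < m - 1 \<Longrightarrow> v (m - 2 - t) = 0" for t
      proof (induction t)
        case 0
        then show ?case using v M[of "m - 1" v] by (auto simp: numeral_2_eq_2)
      next
        case (Suc t)
        then have "m - 2 - t = Suc (m - 2 - Suc t)" "m - 2 - t < m - 1" by simp_all
        then show ?case using v M[of "m - 2 - t" v] Suc by auto
      qed
      moreover have "m - 2 - (m - 2 - q) = q" "m - 2 - q < m - 1" using q by simp_all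
      ultimately show "v q = 0" by metis
    qed
  next
    case Infinite
    then show ?thesis using LT by (auto simp: mat_inj_def mapp_LT)
  qed
  then show ?thesis
    using coords_emptyI[OF coord_inj_empty_fst[OF ev_space[OF summand_space[of x]]], of a] LT by simp
next
  case (D b l)
  show ?thesis
  proof (cases "a = b")
    case True
    have "coords False k (ev a (summand_pair x)) (min k l)"
      by (rule coords_shift) (use True D in \<open>cases a; auto simp: mapp_minus[of _ l l] mapp_one mapp_jordan\<close>)+
    then show ?thesis using True D by simp
  next
    case False
    have "mat_inj (fst (ev a (summand_pair x)))"
    proof (cases a; cases b)
      fix c d assume cd: "a = Finite c" "b = Finite d"
      then show ?thesis using D False
        by (intro mat_inj_upper_shift[of _ l "d - c" 1]) (auto simp: mapp_minus[of _ l l] mapp_one mapp_jordan algebra_simps)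
    next
      fix c assume cd: "a = Finite c" "b = Infinite"
      then show ?thesis using D
        by (intro mat_inj_upper_shift[of _ l 1 "- c"]) (auto simp: mapp_minus[of _ l l] mapp_one mapp_jordan)
    next
      fix d assume cd: "a = Infinite" "b = Finite d"
      then show ?thesis using D by (auto simp: mat_inj_def mapp_one)
    qed (use False in auto)
    then show ?thesis
      using coords_emptyI[OF coord_inj_empty_fst[OF ev_space[OF summand_space[of x]]], of a] D False by simp
  qed
qed

section \<open>The numerical invariants of a canonical sum\<close>

definition inv_LT :: "nat \<Rightarrow> summand list \<Rightarrow> nat" where
  "inv_LT k xs = sum_list (map (LT_num k) xs)"

definition inv_L :: "nat \<Rightarrow> summand list \<Rightarrow> nat" where
  "inv_L k xs = sum_list (map (L_num k) xs)"

definition inv_D :: "ext_complex \<Rightarrow> nat \<Rightarrow> summand list \<Rightarrow> nat" where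
  "inv_D a k xs = sum_list (map (D_num a k) xs)"

lemma inv_simps [simp]:
  "inv_LT k [] = 0" "inv_LT k (x # xs) = LT_num k x + inv_LT k xs" "inv_LT k (xs @ ys) = inv_LT k xs + inv_LT k ys"
  "inv_L k [] = 0" "inv_L k (x # xs) = L_num k x + inv_L k xs" "inv_L k (xs @ ys) = inv_L k xs + inv_L k ys"
  "inv_D a k [] = 0" "inv_D a k (x # xs) = D_num a k x + inv_D a k xs" "inv_D a k (xs @ ys) = inv_D a k xs + inv_D a k ys"
  by (simp_all add: inv_LT_def inv_L_def inv_D_def)

lemma coords_zero_pair: "coords fl k (ev a (zero_pair 0 0)) 0"
proof -
  have "dim_col (fst (ev a (zero_pair 0 0))) = 0" by (cases a) (auto simp: zero_pair_def)
  then show ?thesis by (intro coords_emptyI) (simp add: coord_inj_def)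
qed

lemma coords_direct_sum:
  assumes "\<forall>x \<in> set xs. valid_summand x"
  shows "coords True k (ev (Finite 0) (direct_sum xs)) (inv_L k xs)"
    and "coords False k (ev a (direct_sum xs)) (inv_D a k xs)"
  using assms
proof (induction xs)
  case (Cons x xs)
  {
    case 1
    then show ?case
      using coords_dsum[OF ev_space[OF summand_space] ev_space[OF direct_sum_in_pair_space] coords_L_summand Cons.IH(1)]
      by (simp add: direct_sum_Cons ev_dsum[OF summand_space direct_sum_in_pair_space] del: ev.simps)
  next
    case 2
    then show ?case
      using coords_dsum[OF ev_space[OF summand_space] ev_space[OF direct_sum_in_pair_space] coords_D_summand Cons.IH(2)]
      by (simp add: direct_sum_Cons ev_dsum[OF summand_space direct_sum_in_pair_space] del: ev.simps)
  }
qed (simp_all add: direct_sum_Nil coords_zero_pair del: ev.simps)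

lemma coord_inj_bound:
  assumes iso: "pair_iso m n P Q" and inj: "coord_inj fl k P C" "finite C" and c: "coords fl k Q N"
  shows "N \<le> card C"
proof -
  have Q: "dim_col (fst Q) = n" using pair_iso_space(2)[OF iso] by (auto simp: pair_space_iff)
  obtain C' where C': "C' \<subseteq> {..<k} \<times> {..<n}" "coord_dual fl k Q C'" "card C' = N"
    using c Q by (auto simp: coords_def)
  then have "finite C'" by (auto intro: finite_subset)
  then show ?thesis using card_coord_le[OF iso inj(1) C'(2) inj(2) _ C'(1)] C'(3) by simp
qed

lemma inv_L_dual: "inv_L k (map dual xs) = inv_LT k xs"
proof (induction xs)
  case (Cons x xs)
  then show ?case by (cases x) auto
qed simp

text \<open>Bounds for the invariants of an unknown canonical form, read off the pair itself from
  any coordinate set that determines the solutions. This serves both to recognise canonical forms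
  and to prove semicontinuity.\<close>

lemma inv_bounds:
  assumes iso: "pair_iso m n P (direct_sum xs)" and val: "\<forall>x \<in> set xs. valid_summand x" and fin: "finite C"
  shows "coord_inj True k (ev (Finite 0) P) C \<Longrightarrow> inv_L k xs \<le> card C"
    and "coord_inj False k (ev a P) C \<Longrightarrow> inv_D a k xs \<le> card C"
    and "coord_inj True k (ev (Finite 0) (tr P)) C \<Longrightarrow> inv_LT k xs \<le> card C"
proof -
  show "inv_L k xs \<le> card C" if "coord_inj True k (ev (Finite 0) P) C"
    by (rule coord_inj_bound[OF ev_iso[OF iso] that fin coords_direct_sum(1)[OF val]])
  show "inv_D a k xs \<le> card C" if "coord_inj False k (ev a P) C"
    by (rule coord_inj_bound[OF ev_iso[OF iso] that fin coords_direct_sum(2)[OF val]])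
  have mn: "col_count xs = n" "row_count xs = m" using pair_iso_space(2)[OF iso] by (auto simp: pair_space_iff)
  have iso': "pair_iso n m (tr P) (direct_sum (map dual xs))"
    using pair_iso_trans[OF tr_iso[OF iso]] tr_direct_sum[of xs] mn by simp
  have "inv_L k (map dual xs) = inv_LT k xs" by (rule inv_L_dual)
  moreover have "\<forall>x \<in> set (map dual xs). valid_summand x" using val by simp
  ultimately show "inv_LT k xs \<le> card C" if "coord_inj True k (ev (Finite 0) (tr P)) C"
    using coord_inj_bound[OF ev_iso[OF iso'] that fin coords_direct_sum(1)] by metis
qed

fun is_LT :: "summand \<Rightarrow> bool" where "is_LT (LT m) = True" | "is_LT _ = False"
fun is_L :: "summand \<Rightarrow> bool" where "is_L (L m) = True" | "is_L _ = False"

lemma row_col_defect: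
  "\<forall>x \<in> set xs. valid_summand x \<Longrightarrow>
    row_count xs + length (filter is_L xs) = col_count xs + length (filter is_LT xs)"
proof (induction xs)
  case (Cons x xs)
  then show ?case by (cases x) auto
qed simp

lemma inv_D_zero_imp_LT:
  assumes "\<forall>x \<in> set xs. valid_summand x" "\<And>a. inv_D a 1 xs = 0" "x \<in> set xs"
  shows "is_LT x"
proof -
  have z: "D_num a 1 x = 0" for a
    using assms(2)[of a] assms(3) by (simp add: inv_D_def sum_list_eq_0_iff)
  show ?thesis
  proof (cases x)
    case (D a k)
    then show ?thesis using z[of a] assms(1,3) by auto
  next
    case (L n)
    then show ?thesis using z[of Infinite] by auto
  qed simp
qed

text \<open>A Jordan block or an \<open>L\<close> in the canonical form would contribute to some
  \<open>inv_D a 1\<close>. So all summands are of type \<open>LT\<close>, and each of them has one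
  row more than columns, which leaves exactly one.\<close>

lemma LT_pair_characterization:
  assumes P: "P \<in> pair_space m (m - 1)" and m: "1 \<le> m" and inj: "\<And>a. mat_inj (fst (ev a P))"
  shows "pair_iso m (m - 1) P (summand_pair (LT m))"
proof -
  obtain ys where ys: "\<forall>x \<in> set ys. valid_summand x" "pair_iso m (m - 1) P (direct_sum ys)"
    using kronecker_canonical_form[OF P] by blast
  have "inv_D a 1 ys = 0" for a
    using inv_bounds(2)[OF ys(2,1), of "{}" 1 a] coord_inj_empty_fst[OF ev_space[OF P] inj] by simp
  then have LT: "\<forall>x \<in> set ys. is_LT x" using inv_D_zero_imp_LT[OF ys(1)] by blast
  have c: "row_count ys = m" "col_count ys = m - 1"
    using pair_iso_space(2)[OF ys(2)] by (auto simp: pair_space_iff)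
  have "\<forall>x \<in> set ys. \<not> is_L x" using LT by (metis is_L.elims(2) is_LT.simps(3))
  then have "filter is_L ys = []" "filter is_LT ys = ys" using LT by (simp_all add: filter_empty_conv)
  then have "length ys = 1" using row_col_defect[OF ys(1)] c m by simp
  then obtain x where x: "ys = [x]" by (metis One_nat_def Suc_length_conv length_0_conv)
  then obtain m' where "x = LT m'" using LT by (cases x) auto
  then have "ys = [LT m]" using x c by simp
  then show ?thesis using ys(2) by simp
qed

text \<open>Forward substitution if the diagonal has no zero, backward substitution if the
  subdiagonal has none.\<close>

lemma mat_inj_bidiagonal:
  assumes dims: "dim_row M = n" "dim_col M = n - 1"
    and M: "\<And>v r. r < n \<Longrightarrow> mapp M v r =
      (if r < n - 1 then x r * v r else 0) + (if 0 < r then y r * v (r - 1) else 0)"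
    and nz: "(\<forall>r < n - 1. x r \<noteq> 0) \<or> (\<forall>r < n. 0 < r \<longrightarrow> y r \<noteq> 0)"
  shows "mat_inj M"
  unfolding mat_inj_def dims
proof (intro allI impI)
  fix v :: "nat \<Rightarrow> complex" and q assume v: "\<forall>r < n. mapp M v r = 0" and q: "q < n - 1"
  from nz show "v q = 0"
  proof
    assume x: "\<forall>r < n - 1. x r \<noteq> 0"
    show "v q = 0" using q
    proof (induction q)
      case 0
      then show ?case using v[rule_format, of 0] M[of 0 v] x by auto
    next
      case (Suc q)
      then show ?case using v[rule_format, of "Suc q"] M[of "Suc q" v] x by auto
    qed
  next
    assume y: "\<forall>r < n. 0 < r \<longrightarrow> y r \<noteq> 0"
    have "t < n - 1 \<Longrightarrow> v (n - 2 - t) = 0" for t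
    proof (induction t)
      case 0
      then have "n - 1 < n" "0 < n - 1" "n - 1 - 1 = n - 2" by auto
      then show ?case using v[rule_format, of "n - 1"] M[of "n - 1" v] y[rule_format, of "n - 1"] by auto
    next
      case (Suc t)
      then have "n - 2 - t < n - 1" "0 < n - 2 - t" "n - 2 - t < n" "n - 2 - t - 1 = n - 2 - Suc t" by auto
      then show ?case using v[rule_format, of "n - 2 - t"] M[of "n - 2 - t" v] y[rule_format, of "n - 2 - t"] Suc by auto
    qed
    moreover have "n - 2 - (n - 2 - q) = q" "n - 2 - q < n - 1" using q by simp_all
    ultimately show "v q = 0" by metis
  qed
qed

section \<open>Extensions of L by its transpose\<close>

definition bid :: "nat \<Rightarrow> nat \<Rightarrow> (nat \<Rightarrow> complex) \<Rightarrow> (nat \<Rightarrow> complex) \<Rightarrow> complex mat" where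
  "bid m n x y = mat m n (\<lambda>(i, j). if i = j then x i else if i = Suc j then y j else 0)"

lemma bid_carrier [simp]: "bid m n x y \<in> carrier_mat m n"
  and bid_dims [simp]: "dim_row (bid m n x y) = m" "dim_col (bid m n x y) = n"
  by (simp_all add: bid_def)

lemma mapp_bid:
  "r < m \<Longrightarrow> mapp (bid m n x y) v r =
    (if r < n then x r * v r else 0) + (if 0 < r \<and> r - 1 < n then y (r - 1) * v (r - 1) else 0)"
proof -
  assume r: "r < m"
  have "mapp (bid m n x y) v r =
      (\<Sum>q<n. (if q = r then x r * v r else 0) + (if q = r - 1 then (if 0 < r then y (r - 1) * v (r - 1) else 0) else 0))"
    unfolding mapp_def bid_dims using r by (intro sum.cong) (auto simp: bid_def)
  then show ?thesis by (simp add: sum.distrib)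
qed

fun ev_val :: "ext_complex \<Rightarrow> complex \<Rightarrow> complex \<Rightarrow> complex" where
  "ev_val (Finite c) x x' = x' - c * x"
| "ev_val Infinite x x' = x"

fun ev_rest :: "ext_complex \<Rightarrow> complex \<Rightarrow> complex \<Rightarrow> complex" where
  "ev_rest (Finite c) x x' = x"
| "ev_rest Infinite x x' = x'"

lemma ev_bid:
  "ev b (bid m n x y, bid m n x' y') =
    (bid m n (\<lambda>i. ev_val b (x i) (x' i)) (\<lambda>i. ev_val b (y i) (y' i)),
     bid m n (\<lambda>i. ev_rest b (x i) (x' i)) (\<lambda>i. ev_rest b (y i) (y' i)))"
  by (cases b) (auto simp: bid_def intro!: eq_matI)

lemma bid_pair_LT:
  assumes m: "1 \<le> m"
    and nz: "\<And>b. (\<forall>r. r < m - 1 \<longrightarrow> ev_val b (x r) (x' r) \<noteq> 0) \<or> (\<forall>r. r < m - 1 \<longrightarrow> ev_val b (y r) (y' r) \<noteq> 0)"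
  shows "pair_iso m (m - 1) (bid m (m - 1) x y, bid m (m - 1) x' y') (summand_pair (LT m))"
proof (rule LT_pair_characterization[OF _ m])
  show "(bid m (m - 1) x y, bid m (m - 1) x' y') \<in> pair_space m (m - 1)" by (simp add: pair_space_iff)
  fix b
  show "mat_inj (fst (ev b (bid m (m - 1) x y, bid m (m - 1) x' y')))"
    unfolding ev_bid fst_conv
  proof (rule mat_inj_bidiagonal)
    show "mapp (bid m (m - 1) (\<lambda>i. ev_val b (x i) (x' i)) (\<lambda>i. ev_val b (y i) (y' i))) v r =
      (if r < m - 1 then ev_val b (x r) (x' r) * v r else 0) +
      (if 0 < r then ev_val b (y (r - 1)) (y' (r - 1)) * v (r - 1) else 0)" if "r < m" for v r
      using mapp_bid[OF that, of "m - 1"] that by auto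
    show "(\<forall>r < m - 1. ev_val b (x r) (x' r) \<noteq> 0) \<or>
        (\<forall>r < m. 0 < r \<longrightarrow> ev_val b (y (r - 1)) (y' (r - 1)) \<noteq> 0)"
      using nz[of b] by auto
  qed simp_all
qed

text \<open>Cutting the square pencil after row \<open>m\<close> and column \<open>m - 1\<close>
  leaves zero in the lower left and a single diagonal entry of the pencil in the upper right. The
  two blocks on the diagonal have the shapes of \<open>LT m\<close> and \<open>L n\<close>; they are
  equivalent to these because at each eigenvalue the diagonal or the subdiagonal is free of
  zeros.\<close>

lemma bid_pair_extension:
  assumes m: "1 \<le> m" and n: "1 \<le> n"
    and nz: "\<And>b. (\<forall>r < m + n - 1. ev_val b (x r) (x' r) \<noteq> 0) \<or> ev_val b y y' \<noteq> 0"
    and iso: "pair_iso (m + n - 1) (m + n - 1)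
       (bid (m + n - 1) (m + n - 1) x (\<lambda>_. y), bid (m + n - 1) (m + n - 1) x' (\<lambda>_. y')) T"
  shows "extension_of m (m - 1) (n - 1) n (summand_pair (LT m)) (summand_pair (L n)) T"
proof -
  define P where "P = (bid m (m - 1) x (\<lambda>_. y), bid m (m - 1) x' (\<lambda>_. y'))"
  define Q where "Q = tr (bid n (n - 1) (\<lambda>_. y) (\<lambda>i. x (i + m)), bid n (n - 1) (\<lambda>_. y') (\<lambda>i. x' (i + m)))"
  define X where "X = (mat m n (\<lambda>(i, j). if i = m - 1 \<and> j = 0 then x i else 0),
      mat m n (\<lambda>(i, j). if i = m - 1 \<and> j = 0 then x' i else 0))"
  have P: "pair_iso m (m - 1) P (summand_pair (LT m))"
    unfolding P_def
  proof (rule bid_pair_LT[OF m])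
    show "(\<forall>r. r < m - 1 \<longrightarrow> ev_val b (x r) (x' r) \<noteq> 0) \<or> (\<forall>r. r < m - 1 \<longrightarrow> ev_val b y y' \<noteq> 0)" for b
      using nz[of b] by auto
  qed
  have "pair_iso n (n - 1) (tr Q) (summand_pair (LT n))"
    unfolding Q_def tr_tr
  proof (rule bid_pair_LT[OF n])
    show "(\<forall>r. r < n - 1 \<longrightarrow> ev_val b y y' \<noteq> 0) \<or> (\<forall>r. r < n - 1 \<longrightarrow> ev_val b (x (r + m)) (x' (r + m)) \<noteq> 0)" for b
      using nz[of b] by auto
  qed
  from tr_iso[OF this] have Q: "pair_iso (n - 1) n Q (summand_pair (L n))" by (simp add: tr_def)
  have X: "X \<in> pair_space m n" by (simp add: X_def pair_space_iff)
  have block: "four_block_mat (bid m (m - 1) x (\<lambda>_. y)) (mat m n (\<lambda>(i, j). if i = m - 1 \<and> j = 0 then x i else 0))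
      (0\<^sub>m (n - 1) (m - 1)) (transpose_mat (bid n (n - 1) (\<lambda>_. y) (\<lambda>i. x (i + m)))) =
      bid (m + n - 1) (m + n - 1) x (\<lambda>_. y)" for x y
  proof (rule eq_matI, goal_cases)
    case (1 i j)
    then have ij: "i < m + n - 1" "j < m + n - 1" by simp_all
    then have "i < m \<or> i - m < n - 1" "j < m - 1 \<or> j - (m - 1) < n" using m by auto
    moreover have "Suc j - m = Suc (i - m) \<longleftrightarrow> i = j" if "\<not> i < m" using that by arith
    ultimately show ?case
      using ij m n by (cases "i < m"; cases "j < m - 1") (auto simp: bid_def)
  qed (use m n in \<open>auto simp: bid_def\<close>)
  have "ut P X Q = (bid (m + n - 1) (m + n - 1) x (\<lambda>_. y), bid (m + n - 1) (m + n - 1) x' (\<lambda>_. y'))"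
    using block by (simp add: ut_def P_def X_def Q_def tr_def)
  then have "pair_iso (m + (n - 1)) (m - 1 + n) (ut P X Q) T" using iso m n by simp
  then have "extension_of m (m - 1) (n - 1) n P Q T"
    using X pair_iso_space(1)[OF P] pair_iso_space(1)[OF Q] by (auto simp: extension_of_def)
  moreover have "T \<in> pair_space (m + (n - 1)) (m - 1 + n)" using pair_iso_space(2)[OF iso] m n by simp
  ultimately show ?thesis using extension_cong[OF _ P Q pair_iso_refl] by blast
qed

text \<open>Homogeneous coordinates of an eigenvalue: the entries of the one by one pair
  \<open>D p 1\<close>.\<close>

fun pt_fst :: "ext_complex \<Rightarrow> complex" where
  "pt_fst (Finite c) = 1" | "pt_fst Infinite = 0"

fun pt_snd :: "ext_complex \<Rightarrow> complex" where
  "pt_snd (Finite c) = c" | "pt_snd Infinite = 1"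

lemma ev_val_pt: "ev_val b (pt_fst p) (pt_snd p) = 0 \<longleftrightarrow> p = b"
  by (cases b; cases p) auto

lemma ev_rest_pt: "ev_rest p (pt_fst p) (pt_snd p) = 1"
  by (cases p) auto

text \<open>The lower bidiagonal pencil with the points \<open>ps\<close> on the diagonal. If \<open>a\<close> is not one of them, every
  eigenvalue has geometric multiplicity one; and a suitable cut of the rows and columns displays
  the pencil as an extension of \<open>L\<^sub>n\<close> by the transpose of \<open>L\<^sub>m\<close>.\<close>

definition bid_pair :: "complex \<Rightarrow> ext_complex list \<Rightarrow> matrix_pair" where
  "bid_pair a ps =
    (bid (length ps) (length ps) (\<lambda>i. pt_fst (ps ! i)) (\<lambda>_. 1),
     bid (length ps) (length ps) (\<lambda>i. pt_snd (ps ! i)) (\<lambda>_. a))"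

lemma bid_pair_space: "bid_pair a ps \<in> pair_space (length ps) (length ps)"
  by (simp add: bid_pair_def pair_space_iff)

lemma mapp_ev_bid_pair:
  assumes "r < length ps"
  shows "mapp (fst (ev b (bid_pair a ps))) v r =
      ev_val b (pt_fst (ps ! r)) (pt_snd (ps ! r)) * v r + (if 0 < r then ev_val b 1 a * v (r - 1) else 0)"
    and "mapp (snd (ev b (bid_pair a ps))) v r =
      ev_rest b (pt_fst (ps ! r)) (pt_snd (ps ! r)) * v r + (if 0 < r then ev_rest b 1 a * v (r - 1) else 0)"
  unfolding bid_pair_def ev_bid fst_conv snd_conv mapp_bid[OF assms] using assms by auto

lemma bid_pair_sol:
  "chain_sol False k (ev b (bid_pair a ps)) u \<longleftrightarrow> (\<forall>r < length ps.
    (0 < k \<longrightarrow> ev_val b (pt_fst (ps ! r)) (pt_snd (ps ! r)) * u 0 r + (if 0 < r then ev_val b 1 a * u 0 (r - 1) else 0) = 0) \<and>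
    (\<forall>c. Suc c < k \<longrightarrow>
      ev_val b (pt_fst (ps ! r)) (pt_snd (ps ! r)) * u (Suc c) r + (if 0 < r then ev_val b 1 a * u (Suc c) (r - 1) else 0) =
      ev_rest b (pt_fst (ps ! r)) (pt_snd (ps ! r)) * u c r + (if 0 < r then ev_rest b 1 a * u c (r - 1) else 0)))"
proof -
  have "dim_row (fst (ev b (bid_pair a ps))) = length ps" by (simp add: bid_pair_def ev_bid)
  then show ?thesis unfolding chain_sol_def by (simp add: mapp_ev_bid_pair)
qed

text \<open>This bounds the invariants at \<open>b\<close> by its algebraic multiplicity, for every
  \<open>k\<close>. Row by row, a diagonal entry different from \<open>b\<close> determines the
  whole chain; at an entry \<open>b\<close> the chain equation kills all but the last vector of the
  chain.\<close>

lemma bid_pair_inj_multiplicity: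
  assumes k: "0 < k"
  shows "coord_inj False k (ev b (bid_pair a ps)) ({k - 1} \<times> {r. r < length ps \<and> ps ! r = b})"
  unfolding coord_inj_def
proof (intro allI impI)
  fix u c q
  assume u: "chain_sol False k (ev b (bid_pair a ps)) u"
    and z: "\<forall>(c, q) \<in> {k - 1} \<times> {r. r < length ps \<and> ps ! r = b}. u c q = 0"
    and cq: "c < k" "q < dim_col (fst (ev b (bid_pair a ps)))"
  have "q < length ps" using cq(2) by (simp add: bid_pair_def ev_bid)
  then have "\<forall>c < k. u c q = 0"
  proof (induction q rule: nat_less_induct)
    case (1 r)
    have prev: "u c (r - 1) = 0" if "c < k" "0 < r" for c
      using 1(1)[rule_format, of "r - 1" c] 1(2) that by simp
    have e0: "ev_val b (pt_fst (ps ! r)) (pt_snd (ps ! r)) * u 0 r = 0"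
      using u[unfolded bid_pair_sol] 1(2) k prev[of 0] by (auto split: if_splits)
    have e: "ev_val b (pt_fst (ps ! r)) (pt_snd (ps ! r)) * u (Suc c) r =
        ev_rest b (pt_fst (ps ! r)) (pt_snd (ps ! r)) * u c r" if c: "Suc c < k" for c
    proof -
      have "ev_val b (pt_fst (ps ! r)) (pt_snd (ps ! r)) * u (Suc c) r + (if 0 < r then ev_val b 1 a * u (Suc c) (r - 1) else 0) =
        ev_rest b (pt_fst (ps ! r)) (pt_snd (ps ! r)) * u c r + (if 0 < r then ev_rest b 1 a * u c (r - 1) else 0)"
        using u[unfolded bid_pair_sol] 1(2) c by blast
      then show ?thesis using prev[of c] prev[of "Suc c"] c by (auto split: if_splits)
    qed
    show ?case
    proof (cases "ps ! r = b")
      case True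
      then have "ev_val b (pt_fst (ps ! r)) (pt_snd (ps ! r)) = 0" "ev_rest b (pt_fst (ps ! r)) (pt_snd (ps ! r)) = 1"
        using ev_val_pt ev_rest_pt by simp_all
      then have "u c r = 0" if "Suc c < k" for c using e[OF that] by simp
      moreover have "u (k - 1) r = 0" using z True 1(2) by auto
      ultimately show ?thesis by (metis Suc_lessI Suc_diff_1 diff_Suc_1)
    next
      case False
      then have nz: "ev_val b (pt_fst (ps ! r)) (pt_snd (ps ! r)) \<noteq> 0" using ev_val_pt by simp
      have "c < k \<Longrightarrow> u c r = 0" for c
      proof (induction c)
        case 0
        then show ?case using e0 nz by simp
      next
        case (Suc c)
        then show ?case using e[of c] nz by simp
      qed
      then show ?thesis by blast
    qed
  qed
  then show "u c q = 0" using cq(1) by simp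
qed

text \<open>Geometric multiplicity at most one: with a nonzero subdiagonal, the last entry
  determines all others upwards.\<close>

lemma bid_pair_inj_one:
  assumes a: "ev_val b 1 a \<noteq> 0"
  shows "coord_inj False 1 (ev b (bid_pair a ps)) {(0, length ps - 1)}"
  unfolding coord_inj_def
proof (intro allI impI)
  fix u c q
  assume u: "chain_sol False 1 (ev b (bid_pair a ps)) u" and z: "\<forall>(c, q) \<in> {(0, length ps - 1)}. u c q = 0"
    and cq: "c < (1 :: nat)" "q < dim_col (fst (ev b (bid_pair a ps)))"
  have q: "q < length ps" using cq(2) by (simp add: bid_pair_def ev_bid)
  have "t < length ps \<Longrightarrow> u 0 (length ps - 1 - t) = 0" for t
  proof (induction t)
    case 0
    then show ?case using z by simp
  next
    case (Suc t)
    let ?r = "length ps - 1 - t"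
    have r: "?r < length ps" "0 < ?r" "?r - 1 = length ps - 1 - Suc t" using Suc.prems by auto
    then have "ev_val b 1 a * u 0 (?r - 1) = 0" using u[unfolded bid_pair_sol, rule_format, of ?r] Suc by auto
    then show ?case using a r(3) by simp
  qed
  moreover have "length ps - 1 - (length ps - 1 - q) = q" "length ps - 1 - q < length ps" using q by simp_all
  ultimately have "u 0 q = 0" by metis
  then show "u c q = 0" using cq(1) by simp
qed

fun is_D :: "ext_complex \<Rightarrow> summand \<Rightarrow> bool" where
  "is_D b (D p k) = (p = b)" | "is_D b _ = False"

abbreviation D_list :: "(ext_complex \<times> nat) list \<Rightarrow> summand list" where
  "D_list es \<equiv> map (\<lambda>(p, k). D p k) es"

abbreviation points :: "(ext_complex \<times> nat) list \<Rightarrow> ext_complex list" where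
  "points es \<equiv> concat (map (\<lambda>(p, k). replicate k p) es)"

lemma filter_is_D_list:
  "distinct (map fst es) \<Longrightarrow>
    filter (is_D b) (D_list es) = (case map_of es b of None \<Rightarrow> [] | Some k \<Rightarrow> [D b k])"
proof (induction es)
  case (Cons e es)
  obtain p k where e: "e = (p, k)" by fastforce
  show ?case
  proof (cases "p = b")
    case True
    then have "map_of es b = None" using Cons.prems e by (simp add: map_of_eq_None_iff)
    then show ?thesis using Cons True e by simp
  next
    case False
    then show ?thesis using Cons e by simp
  qed
qed simp

lemma count_points:
  "distinct (map fst es) \<Longrightarrow>
    length (filter (\<lambda>p. p = b) (points es)) = (case map_of es b of None \<Rightarrow> 0 | Some k \<Rightarrow> k)"
proof (induction es)
  case (Cons e es)
  obtain p k where e: "e = (p, k)" by fastforce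
  show ?case
  proof (cases "p = b")
    case True
    then have "map_of es b = None" using Cons.prems e by (simp add: map_of_eq_None_iff)
    then show ?thesis using Cons True e by (simp add: filter_replicate)
  next
    case False
    then show ?thesis using Cons e by (simp add: filter_replicate)
  qed
qed simp

lemma length_points: "length (points es) = row_count (D_list es)"
  by (induction es) auto

lemma row_count_by_points:
  assumes "finite S" "\<And>x. x \<in> set ys \<Longrightarrow> \<exists>b \<in> S. is_D b x"
  shows "row_count ys = (\<Sum>b\<in>S. row_count (filter (is_D b) ys))"
  using assms(2)
proof (induction ys)
  case (Cons x ys)
  then obtain b where b: "b \<in> S" "is_D b x" by auto
  then have "is_D c x \<longleftrightarrow> c = b" for c by (cases x) auto
  then have "(\<Sum>c\<in>S. row_count (filter (is_D c) (x # ys))) =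
      (\<Sum>c\<in>S. (if c = b then summand_rows x else 0) + row_count (filter (is_D c) ys))"
    by (intro sum.cong) auto
  then show ?case using Cons b assms(1) by (simp add: sum.distrib)
qed simp

lemma inv_D_no_L:
  assumes "\<forall>x \<in> set ys. \<not> is_L x \<and> valid_summand x"
  shows "inv_D b 1 ys = length (filter (is_D b) ys)"
    and "row_count ys \<le> k \<Longrightarrow> inv_D b k ys = row_count (filter (is_D b) ys)"
  using assms
proof (induction ys)
  case (Cons x ys)
  { case 1 then show ?case using Cons by (cases x) auto
  next
    case 2 then show ?case using Cons by (cases x) auto }
qed simp_all

lemma L_count_le_inv_D: "k * length (filter is_L ys) \<le> inv_D b k ys"
proof (induction ys)
  case (Cons x ys)
  then show ?case by (cases x) auto
qed simp

lemma mset_eq_by_points: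
  assumes "\<And>x. x \<in> set ys \<Longrightarrow> \<exists>b. is_D b x" "\<And>x. x \<in> set zs \<Longrightarrow> \<exists>b. is_D b x"
    and "\<And>b. filter (is_D b) ys = filter (is_D b) zs"
  shows "mset ys = mset zs"
proof (rule multiset_eqI)
  fix x
  show "count (mset ys) x = count (mset zs) x"
  proof (cases "\<exists>b. is_D b x")
    case True
    then obtain b where b: "is_D b x" by blast
    have "count (mset ys) x = count (mset (filter (is_D b) ys)) x" using b by (simp add: mset_filter)
    also have "\<dots> = count (mset zs) x" using b assms(3) by (simp add: mset_filter)
    finally show ?thesis .
  next
    case False
    then have "x \<notin> set ys" "x \<notin> set zs" using assms(1,2) by blast+
    then have "count (mset ys) x = 0" "count (mset zs) x = 0" by (simp_all add: count_eq_zero_iff)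
    then show ?thesis by (simp only:)
  qed
qed

text \<open>The unknown canonical form \<open>ys\<close> is pinned down by counting. An
  \<open>L\<close> would make \<open>inv_D\<close> grow with \<open>k\<close> beyond the algebraic
  multiplicity, and without \<open>L\<close> a square pair has no \<open>LT\<close>. Each eigenvalue
  then has at most one block, of size at most its multiplicity, and the total size forces equality
  everywhere.\<close>

lemma bid_pair_canonical:
  assumes dist: "distinct (map fst es)" and pos: "\<forall>(p, k) \<in> set es. 1 \<le> k" and a: "Finite a \<notin> fst ` set es"
  shows "pair_iso (length (points es)) (length (points es)) (bid_pair a (points es)) (direct_sum (D_list es))"
proof -
  let ?ps = "points es" and ?N = "length (points es)"
  define m where "m b = (case map_of es b of None \<Rightarrow> 0 | Some k \<Rightarrow> k)" for b
  obtain ys where ys: "\<forall>x \<in> set ys. valid_summand x" and iso: "pair_iso ?N ?N (bid_pair a ?ps) (direct_sum ys)"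
    using kronecker_canonical_form[OF bid_pair_space] by blast
  have cnt: "row_count ys = ?N" "col_count ys = ?N"
    using pair_iso_space(2)[OF iso] by (auto simp: pair_space_iff)
  have mult: "card {r. r < ?N \<and> ?ps ! r = b} = m b" for b
    using count_points[OF dist, of b] unfolding length_filter_conv_card m_def .
  have le: "inv_D b k ys \<le> m b" if "0 < k" for b k
  proof -
    have "inv_D b k ys \<le> card ({k - 1} \<times> {r. r < ?N \<and> ?ps ! r = b})"
      using inv_bounds(2)[OF iso ys _ bid_pair_inj_multiplicity[OF that]] by simp
    then show ?thesis using mult[of b] by (simp add: card_cartesian_product)
  qed
  have m_le: "m b \<le> ?N" for b
    unfolding mult[of b, symmetric] using card_mono[of "{..<?N}" "{r. r < ?N \<and> ?ps ! r = b}"] by auto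
  have "Suc ?N * length (filter is_L ys) \<le> ?N"
    using L_count_le_inv_D[of "Suc ?N" ys Infinite] le[of "Suc ?N" Infinite] m_le[of Infinite] by linarith
  then have "filter is_L ys = []" by (cases "length (filter is_L ys)") auto
  moreover from this have "filter is_LT ys = []" using row_col_defect[OF ys] cnt by simp
  ultimately have nL: "\<not> is_L x" and nLT: "\<not> is_LT x" if "x \<in> set ys" for x
    using that by (auto simp: filter_empty_conv)
  have isD: "\<exists>b. is_D b x" if "x \<in> set ys" for x using nL[OF that] nLT[OF that] by (cases x) auto
  have ys': "\<forall>x \<in> set ys. \<not> is_L x \<and> valid_summand x" using ys nL by blast
  have F1: "row_count (filter (is_D b) ys) \<le> m b" for b
    using inv_D_no_L(2)[OF ys', of "Suc ?N" b] le[of "Suc ?N" b] cnt by simp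
  have F2: "length (filter (is_D b) ys) \<le> 1" for b
  proof (cases "ev_val b 1 a = 0")
    \<comment> \<open>The subdiagonal vanishes only at \<open>b = Finite a\<close>, which is not a
      point of \<open>es\<close>, so there the multiplicity is already zero.\<close>
    case True
    then have "b = Finite a" by (cases b) auto
    then have "map_of es b = None" using a by (simp add: map_of_eq_None_iff)
    then have "m b = 0" by (simp add: m_def)
    then show ?thesis using inv_D_no_L(1)[OF ys', of b] le[of 1 b] by simp
  next
    case False
    have "inv_D b 1 ys \<le> card {(0 :: nat, ?N - 1)}"
      by (rule inv_bounds(2)[OF iso ys _ bid_pair_inj_one[OF False]]) simp
    then show ?thesis using inv_D_no_L(1)[OF ys', of b] by simp
  qed
  let ?S = "fst ` set es"
  have F3: "b \<in> ?S" if "x \<in> set ys" "is_D b x" for x b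
  proof (rule ccontr)
    assume "b \<notin> ?S"
    then have "m b = 0" by (simp add: m_def map_of_eq_None_iff[THEN iffD2])
    then have "length (filter (is_D b) ys) = 0" using inv_D_no_L(1)[OF ys', of b] le[of 1 b] by simp
    then show False using that by (auto simp: filter_empty_conv)
  qed
  have filt: "filter (is_D b) (D_list es) = (case map_of es b of None \<Rightarrow> [] | Some k \<Rightarrow> [D b k])" for b
    by (rule filter_is_D_list[OF dist])
  have "row_count (filter (is_D b) (D_list es)) = m b" for b
    unfolding filt m_def by (cases "map_of es b") auto
  moreover have "row_count (D_list es) = (\<Sum>b\<in>?S. row_count (filter (is_D b) (D_list es)))"
    by (rule row_count_by_points) force+
  ultimately have "(\<Sum>b\<in>?S. m b) = ?N" using length_points[of es] by simp
  moreover have "(\<Sum>b\<in>?S. row_count (filter (is_D b) ys)) = ?N"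
    using row_count_by_points[of ?S ys] F3 isD cnt by fastforce
  ultimately have sum: "(\<Sum>b\<in>?S. row_count (filter (is_D b) ys)) = (\<Sum>b\<in>?S. m b)" by simp
  have eq: "row_count (filter (is_D b) ys) = m b" if "b \<in> ?S" for b
  proof (rule ccontr)
    assume "row_count (filter (is_D b) ys) \<noteq> m b"
    then have "row_count (filter (is_D b) ys) < m b" using F1[of b] by simp
    then have "(\<Sum>b\<in>?S. row_count (filter (is_D b) ys)) < (\<Sum>b\<in>?S. m b)"
      using that F1 by (intro sum_strict_mono_ex1) auto
    then show False using sum by simp
  qed
  have "filter (is_D b) ys = filter (is_D b) (D_list es)" for b
  proof (cases "map_of es b")
    case None
    then have "b \<notin> ?S" by (simp add: map_of_eq_None_iff)
    then have "filter (is_D b) ys = []" using F3 by (auto simp: filter_empty_conv)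
    then show ?thesis using None filt by simp
  next
    case (Some k)
    then have bk: "(b, k) \<in> set es" by (rule map_of_SomeD)
    then have "1 \<le> k" using pos by auto
    moreover have rk: "row_count (filter (is_D b) ys) = k" using eq[of b] bk Some by (force simp: m_def)
    ultimately have "filter (is_D b) ys \<noteq> []" by auto
    then obtain x where x: "filter (is_D b) ys = [x]"
      using F2[of b] by (cases "filter (is_D b) ys") auto
    then have "x \<in> set (filter (is_D b) ys)" by simp
    then have "is_D b x" by simp
    then have "x = D b k" using rk x by (cases x) auto
    then show ?thesis using x Some filt by simp
  qed
  note filter_eq = this
  have isD': "\<exists>b. is_D b x" if "x \<in> set (D_list es)" for x using that by auto
  have "mset ys = mset (D_list es)" by (rule mset_eq_by_points[OF isD isD' filter_eq])
  then show ?thesis using pair_iso_trans[OF iso] direct_sum_perm[of ys "D_list es"] cnt by simp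
qed

section \<open>Extensions between canonical summands\<close>

definition sum_extension :: "summand \<Rightarrow> summand \<Rightarrow> summand list \<Rightarrow> bool" where
  "sum_extension x y zs \<longleftrightarrow> extension_of (summand_rows x) (summand_cols x) (summand_rows y) (summand_cols y)
     (summand_pair x) (summand_pair y) (direct_sum zs)"

text \<open>The eigenvalues of \<open>es\<close>, repeated by size, fill the diagonal of the pencil;
  the subdiagonal is a finite point \<open>a\<close> off \<open>es\<close>, which exists because the
  complex numbers are infinite.\<close>

lemma LT_L_extension:
  assumes mn: "1 \<le> m" "1 \<le> n" and dist: "distinct (map fst es)" and pos: "\<forall>(p, k) \<in> set es. 1 \<le> k"
    and size: "sum_list (map snd es) = m + n - 1"
  shows "sum_extension (LT m) (L n) (D_list es)"
proof -
  have len: "length (points es) = m + n - 1" unfolding size[symmetric] by (induction es) auto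
  have "finite (Finite -` fst ` set es)" by (intro finite_vimageI) (auto simp: inj_def)
  then obtain a where a: "Finite a \<notin> fst ` set es"
    using ex_new_if_finite[of "Finite -` fst ` set es"] infinite_UNIV_char_0 by blast
  have "extension_of m (m - 1) (n - 1) n (summand_pair (LT m)) (summand_pair (L n)) (direct_sum (D_list es))"
  proof (rule bid_pair_extension[OF mn])
    show "pair_iso (m + n - 1) (m + n - 1) (bid (m + n - 1) (m + n - 1) (\<lambda>i. pt_fst (points es ! i)) (\<lambda>_. 1),
        bid (m + n - 1) (m + n - 1) (\<lambda>i. pt_snd (points es ! i)) (\<lambda>_. a)) (direct_sum (D_list es))"
      using bid_pair_canonical[OF dist pos a] unfolding bid_pair_def len .
    fix b
    show "(\<forall>r < m + n - 1. ev_val b (pt_fst (points es ! r)) (pt_snd (points es ! r)) \<noteq> 0) \<or> ev_val b 1 a \<noteq> 0"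
    proof (cases "ev_val b 1 a = 0")
      case True
      then have b: "b = Finite a" by (cases b) auto
      have "points es ! r \<noteq> b" if "r < m + n - 1" for r
      proof -
        have mem: "points es ! r \<in> set (points es)" using that len by (intro nth_mem) simp
        have "set (points es) \<subseteq> fst ` set es" by (auto simp: set_replicate_conv_if image_iff) force
        from subsetD[OF this mem] show ?thesis using a unfolding b by metis
      qed
      then show ?thesis using ev_val_pt by blast
    qed simp
  qed
  then show ?thesis by (simp add: sum_extension_def)
qed

lemma sum_extension_dual:
  assumes "sum_extension x y zs"
  shows "sum_extension (dual y) (dual x) (map dual zs)"
proof -
  have c: "summand_rows x + summand_rows y = row_count zs" "summand_cols x + summand_cols y = col_count zs"
    using assms direct_sum_in_pair_space[of zs] unfolding sum_extension_def extension_of_def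
    by (auto simp: pair_iso_def pair_space_iff)
  have "extension_of (summand_cols y) (summand_rows y) (summand_cols x) (summand_rows x)
      (tr (summand_pair y)) (tr (summand_pair x)) (tr (direct_sum zs))"
    using extension_tr assms unfolding sum_extension_def by blast
  then have "extension_of (summand_cols y) (summand_rows y) (summand_cols x) (summand_rows x)
      (summand_pair (dual y)) (summand_pair (dual x)) (direct_sum (map dual zs))"
    using extension_cong[OF _ tr_summand[of y] tr_summand[of x]] tr_direct_sum[of zs] c
    by (simp add: add.commute)
  then show ?thesis by (simp add: sum_extension_def)
qed

text \<open>A change of parameter of the pencil that moves the eigenvalue 0 to \<open>p\<close> and
  preserves the type \<open>LT\<close>. It carries the extensions found at eigenvalue 0 over to
  every eigenvalue.\<close>

fun mob :: "ext_complex \<Rightarrow> matrix_pair \<Rightarrow> matrix_pair" where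
  "mob (Finite a) P = (fst P, snd P + a \<cdot>\<^sub>m fst P)"
| "mob Infinite P = (snd P, fst P)"

lemma mob_space: "P \<in> pair_space m n \<Longrightarrow> mob p P \<in> pair_space m n"
  by (cases p) (auto simp: pair_space_iff)

lemma mob_iso:
  assumes "pair_iso m n P Q" shows "pair_iso m n (mob p P) (mob p Q)"
proof -
  obtain S R where 1: "P \<in> pair_space m n" "Q \<in> pair_space m n" "unit_mat m S" "unit_mat n R" "pair_hom P Q S R"
    using assms by (auto simp: pair_iso_def)
  note u = unit_mat_carrier[OF 1(3)] unit_mat_carrier[OF 1(4)]
  have "S * (snd P + c \<cdot>\<^sub>m fst P) = (snd Q + c \<cdot>\<^sub>m fst Q) * R" for c
    using 1 u by (simp add: pair_space_iff pair_hom_def mult_add_distrib_mat[of S m m _ n] add_mult_distrib_mat[of _ m n]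
        mult_smult_distrib[of S m m _ n] mult_smult_assoc_mat[of _ m n R n])
  then have "pair_hom (mob p P) (mob p Q) S R" using 1(5) by (cases p) (simp_all add: pair_hom_def)
  then show ?thesis by (rule pair_isoI[OF mob_space[OF 1(1)] mob_space[OF 1(2)] 1(3,4)])
qed

lemma mob_ut:
  assumes "P \<in> pair_space a b" "Q \<in> pair_space c d" "X \<in> pair_space a d"
  shows "mob p (ut P X Q) = ut (mob p P) (mob p X) (mob p Q)"
  using assms by (cases p) (auto simp: ut_def pair_space_iff intro!: eq_matI)

lemma extension_mob:
  assumes "extension_of a b c d P Q T"
  shows "extension_of a b c d (mob p P) (mob p Q) (mob p T)"
proof -
  obtain X where 1: "P \<in> pair_space a b" "Q \<in> pair_space c d" "X \<in> pair_space a d"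
    "pair_iso (a + c) (b + d) (ut P X Q) T"
    using assms by (auto simp: extension_of_def)
  have "pair_iso (a + c) (b + d) (ut (mob p P) (mob p X) (mob p Q)) (mob p T)"
    using mob_iso[OF 1(4)] mob_ut[OF 1(1-3)] by simp
  then show ?thesis using mob_space[OF 1(1)] mob_space[OF 1(2)] mob_space[OF 1(3)]
    unfolding extension_of_def by blast
qed

lemma mob_dsum:
  assumes "P \<in> pair_space a b" "Q \<in> pair_space c d"
  shows "mob p (dsum P Q) = dsum (mob p P) (mob p Q)"
  using assms by (cases p) (auto simp: dsum_def ut_def zero_pair_def pair_space_iff intro!: eq_matI)

lemma mob_D: "mob p (summand_pair (D (Finite 0) k)) = summand_pair (D p k)"
  by (cases p) (auto simp: jordan_block_def intro!: eq_matI)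

text \<open>\<open>LT m\<close> has no eigenvalue, and a change of parameter creates none. The
  transformed pencil is still bidiagonal, so \<open>bid_pair_LT\<close> recognises it.\<close>

lemma mob_LT:
  assumes "1 \<le> m" shows "pair_iso m (m - 1) (mob p (summand_pair (LT m))) (summand_pair (LT m))"
proof -
  have LT: "summand_pair (LT m) = (bid m (m - 1) (\<lambda>_. 1) (\<lambda>_. 0), bid m (m - 1) (\<lambda>_. 0) (\<lambda>_. 1))"
    by (auto simp: bid_def L_mat_def R_mat_def intro!: eq_matI)
  show ?thesis
  proof (cases p)
    case (Finite a)
    have "mob p (summand_pair (LT m)) = (bid m (m - 1) (\<lambda>_. 1) (\<lambda>_. 0), bid m (m - 1) (\<lambda>_. a) (\<lambda>_. 1))"
      unfolding LT Finite by (auto simp: bid_def intro!: eq_matI)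
    moreover have "pair_iso m (m - 1) (bid m (m - 1) (\<lambda>_. 1) (\<lambda>_. 0), bid m (m - 1) (\<lambda>_. a) (\<lambda>_. 1)) (summand_pair (LT m))"
    proof (rule bid_pair_LT[OF assms])
      show "(\<forall>r < m - 1. ev_val b 1 a \<noteq> 0) \<or> (\<forall>r < m - 1. ev_val b 0 1 \<noteq> 0)" for b by (cases b) auto
    qed
    ultimately show ?thesis by simp
  next
    case Infinite
    have "pair_iso m (m - 1) (bid m (m - 1) (\<lambda>_. 0) (\<lambda>_. 1), bid m (m - 1) (\<lambda>_. 1) (\<lambda>_. 0)) (summand_pair (LT m))"
    proof (rule bid_pair_LT[OF assms])
      show "(\<forall>r < m - 1. ev_val b 0 1 \<noteq> 0) \<or> (\<forall>r < m - 1. ev_val b 1 0 \<noteq> 0)" for b by (cases b) auto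
    qed
    then show ?thesis unfolding LT Infinite by simp
  qed
qed

lemma LT_LT_extension:
  assumes "1 \<le> a" "a \<le> b"
  shows "sum_extension (LT a) (LT (Suc b)) [LT (Suc a), LT b]"
  using growth_extension[of "LT a" "LT b"] assms by (simp add: sum_extension_def)

lemma LT_D_extension:
  assumes "1 \<le> m"
  shows "sum_extension (LT m) (D p (Suc k)) [LT (Suc m), D p k]"
proof -
  have 1: "extension_of m (m - 1) (Suc k) (Suc k) (summand_pair (LT m)) (summand_pair (D (Finite 0) (Suc k)))
      (direct_sum [LT (Suc m), D (Finite 0) k])"
    using growth_extension[of "LT m" "D (Finite 0) k"] assms by simp
  have "pair_iso (Suc m + k) (m + k) (mob p (direct_sum [LT (Suc m), D (Finite 0) k])) (direct_sum [LT (Suc m), D p k])"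
    using dsum_cong[OF mob_LT[of "Suc m" p] pair_iso_refl[OF summand_space[of "D p k"]]]
    unfolding direct_sum_Cons[of "LT (Suc m)"] direct_sum_single
    by (simp add: mob_dsum[OF summand_space summand_space] mob_D del: summand_pair.simps mob.simps)
  then have "extension_of m (m - 1) (Suc k) (Suc k) (summand_pair (LT m)) (summand_pair (D p (Suc k)))
      (direct_sum [LT (Suc m), D p k])"
    using extension_cong[OF extension_mob[OF 1, of p] mob_LT[OF assms] pair_iso_refl] assms summand_space[of "D p (Suc k)"]
    unfolding mob_D by (simp del: summand_pair.simps)
  then show ?thesis by (simp add: sum_extension_def del: summand_pair.simps)
qed

lemma D_D_extension:
  assumes "l \<le> k"
  shows "sum_extension (D p (Suc l)) (D p k) [D p (Suc k), D p l]"
proof -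
  have 1: "extension_of k k (Suc l) (Suc l) (summand_pair (D (Finite 0) k)) (summand_pair (D (Finite 0) (Suc l)))
      (direct_sum [D (Finite 0) (Suc k), D (Finite 0) l])"
    using growth_extension[of "D (Finite 0) k" "D (Finite 0) l"] assms by simp
  have "mob p (direct_sum [D (Finite 0) (Suc k), D (Finite 0) l]) = direct_sum [D p (Suc k), D p l]"
    unfolding direct_sum_Cons[of "D _ _"] direct_sum_Nil[symmetric]
    by (simp add: mob_dsum[OF summand_space direct_sum_in_pair_space] mob_D direct_sum_Nil
        dsum_zero_right[OF summand_space] del: summand_pair.simps mob.simps)
      (simp add: mob_dsum[OF summand_space summand_space] mob_D del: summand_pair.simps mob.simps)
  then have "sum_extension (D p k) (D p (Suc l)) [D p (Suc k), D p l]"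
    using extension_mob[OF 1, of p] by (simp add: sum_extension_def mob_D del: summand_pair.simps mob.simps)
  \<comment> \<open>Duality exchanges subobject and quotient. This puts the block
    \<open>D p (Suc l)\<close> first, which is the smaller one in the moves and precedes the other
    in the canonical order.\<close>
  from sum_extension_dual[OF this] show ?thesis by simp
qed

section \<open>Degenerations\<close>

text \<open>Convergence is stated entrywise, where limits of products are at hand; it agrees with
  convergence in \<open>pair_dist\<close> by \<open>pair_dist_tendsto\<close> and
  \<open>pair_tendsto_dist\<close>.\<close>

definition pair_tendsto :: "nat \<Rightarrow> nat \<Rightarrow> (nat \<Rightarrow> matrix_pair) \<Rightarrow> matrix_pair \<Rightarrow> bool" where
  "pair_tendsto m n B P \<longleftrightarrow> (\<forall>r < m. \<forall>c < n.
     (\<lambda>s. fst (B s) $$ (r, c)) \<longlonglongrightarrow> fst P $$ (r, c) \<and> (\<lambda>s. snd (B s) $$ (r, c)) \<longlonglongrightarrow> snd P $$ (r, c))"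

lemma mat_dist_tendsto:
  assumes "\<And>r c. r < m \<Longrightarrow> c < n \<Longrightarrow> (\<lambda>s. M s $$ (r, c)) \<longlonglongrightarrow> A $$ (r, c)"
  shows "(\<lambda>s. mat_dist m n A (M s)) \<longlonglongrightarrow> 0"
proof -
  have "(\<lambda>s. (cmod (A $$ p - M s $$ p))\<^sup>2) \<longlonglongrightarrow> 0" if p: "p \<in> {..<m} \<times> {..<n}" for p
  proof -
    have "(\<lambda>s. M s $$ p) \<longlonglongrightarrow> A $$ p" using assms p by (cases p) auto
    then have "(\<lambda>s. (cmod (A $$ p - M s $$ p))\<^sup>2) \<longlonglongrightarrow> (cmod (A $$ p - A $$ p))\<^sup>2"
      by (intro tendsto_power tendsto_norm tendsto_diff tendsto_const)
    then show ?thesis by simp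
  qed
  then have "(\<lambda>s. \<Sum>p\<in>{..<m} \<times> {..<n}. (cmod (A $$ p - M s $$ p))\<^sup>2) \<longlonglongrightarrow> (\<Sum>p\<in>{..<m} \<times> {..<n}. 0)"
    by (rule tendsto_sum)
  then have "(\<lambda>s. sqrt (\<Sum>p\<in>{..<m} \<times> {..<n}. (cmod (A $$ p - M s $$ p))\<^sup>2)) \<longlonglongrightarrow> sqrt (\<Sum>p\<in>{..<m} \<times> {..<n}. 0)"
    by (rule tendsto_real_sqrt)
  moreover have "mat_dist m n A (M s) = sqrt (\<Sum>p\<in>{..<m} \<times> {..<n}. (cmod (A $$ p - M s $$ p))\<^sup>2)" for s
    unfolding mat_dist_def L2_set_def split_beta prod.collapse ..
  ultimately show ?thesis by simp
qed

lemma pair_dist_eq: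
  "pair_dist m n P Q = sqrt ((mat_dist m n (fst P) (fst Q))\<^sup>2 + (mat_dist m n (snd P) (snd Q))\<^sup>2)"
  unfolding pair_dist_def prod_dist_def split_beta ..

lemma pair_dist_tendsto:
  assumes "pair_tendsto m n B P"
  shows "(\<lambda>s. pair_dist m n P (B s)) \<longlonglongrightarrow> 0"
proof -
  have "(\<lambda>s. mat_dist m n (fst P) (fst (B s))) \<longlonglongrightarrow> 0" "(\<lambda>s. mat_dist m n (snd P) (snd (B s))) \<longlonglongrightarrow> 0"
    using assms unfolding pair_tendsto_def by (intro mat_dist_tendsto; blast)+
  then have "(\<lambda>s. sqrt ((mat_dist m n (fst P) (fst (B s)))\<^sup>2 + (mat_dist m n (snd P) (snd (B s)))\<^sup>2)) \<longlonglongrightarrow> sqrt (0\<^sup>2 + 0\<^sup>2)"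
    by (intro tendsto_real_sqrt tendsto_add tendsto_power)
  then show ?thesis by (simp add: pair_dist_eq)
qed

lemma entry_tendsto_mat_dist:
  assumes "(\<lambda>s. mat_dist m n A (M s)) \<longlonglongrightarrow> 0" "r < m" "c < n"
  shows "(\<lambda>s. M s $$ (r, c)) \<longlonglongrightarrow> A $$ (r, c)"
proof (rule metric_tendsto_imp_tendsto[OF assms(1)], rule always_eventually, rule allI)
  fix s
  have "cmod (A $$ (r, c) - M s $$ (r, c)) \<le> mat_dist m n A (M s)"
    using member_le_L2_set[of "{..<m} \<times> {..<n}" "(r, c)" "\<lambda>(r, c). cmod (A $$ (r, c) - M s $$ (r, c))"] assms(2,3)
    by (simp add: mat_dist_def)
  then show "dist (M s $$ (r, c)) (A $$ (r, c)) \<le> dist (mat_dist m n A (M s)) 0"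
    by (simp add: dist_norm norm_minus_commute)
qed

lemma pair_tendsto_dist:
  assumes "(\<lambda>s. pair_dist m n P (B s)) \<longlonglongrightarrow> 0"
  shows "pair_tendsto m n B P"
proof -
  have nn: "0 \<le> mat_dist m n A M" for A M by (simp add: mat_dist_def L2_set_nonneg)
  have le: "mat_dist m n (fst P) (fst Q) \<le> pair_dist m n P Q" "mat_dist m n (snd P) (snd Q) \<le> pair_dist m n P Q" for Q
    unfolding pair_dist_eq by (rule real_le_rsqrt; simp)+
  have "(\<lambda>s. mat_dist m n (fst P) (fst (B s))) \<longlonglongrightarrow> 0" "(\<lambda>s. mat_dist m n (snd P) (snd (B s))) \<longlonglongrightarrow> 0"
    by (rule tendsto_sandwich[OF _ _ tendsto_const assms]; rule always_eventually; rule allI; rule nn le)+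
  from this[THEN entry_tendsto_mat_dist] show ?thesis unfolding pair_tendsto_def by simp
qed

definition degen :: "nat \<Rightarrow> nat \<Rightarrow> matrix_pair \<Rightarrow> matrix_pair \<Rightarrow> bool" where
  "degen m n P Q \<longleftrightarrow> P \<in> pair_space m n \<and> (\<exists>B. (\<forall>s. pair_iso m n Q (B s)) \<and> pair_tendsto m n B P)"

lemma mem_closure_orbit_iff:
  assumes Q: "Q \<in> pair_space m n"
  shows "P \<in> pair_topology m n closure_of pair_orbit Q \<longleftrightarrow> degen m n P Q"
proof -
  interpret Metric_space "pair_space m n" "pair_dist m n" by (rule Metric_space_pair)
  have iso: "B \<in> pair_orbit Q \<longleftrightarrow> pair_iso m n Q B" for B by (rule mem_pair_orbit_iff[OF Q])
  have "P \<in> pair_topology m n closure_of pair_orbit Q \<longleftrightarrow>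
      P \<in> pair_space m n \<and> (\<forall>r>0. \<exists>B. pair_iso m n Q B \<and> pair_dist m n P B < r)"
    unfolding pair_topology_def metric_closure_of mem_Collect_eq in_mball Bex_def iso
    using pair_iso_space(2)[of m n Q] by (metis gt_ex)
  also have "\<dots> \<longleftrightarrow> degen m n P Q"
  proof
    assume *: "P \<in> pair_space m n \<and> (\<forall>r>0. \<exists>B. pair_iso m n Q B \<and> pair_dist m n P B < r)"
    then have "\<forall>s. \<exists>B. pair_iso m n Q B \<and> pair_dist m n P B < inverse (real (Suc s))" by simp
    then obtain B where B: "\<And>s. pair_iso m n Q (B s)" "\<And>s. pair_dist m n P (B s) < inverse (real (Suc s))" by metis
    have "(\<lambda>s. pair_dist m n P (B s)) \<longlonglongrightarrow> 0"
      by (rule tendsto_sandwich[OF _ _ tendsto_const LIMSEQ_inverse_real_of_nat])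
        (use B(2) in \<open>auto intro!: always_eventually less_imp_le\<close>)
    from pair_tendsto_dist[OF this] show "degen m n P Q" using B(1) * unfolding degen_def by blast
  next
    assume "degen m n P Q"
    then obtain B where P: "P \<in> pair_space m n" and B: "\<And>s. pair_iso m n Q (B s)" "pair_tendsto m n B P"
      by (auto simp: degen_def)
    have "\<exists>B. pair_iso m n Q B \<and> pair_dist m n P B < r" if "r > 0" for r
    proof -
      have "\<forall>\<^sub>F s in sequentially. pair_dist m n P (B s) < r"
        using order_tendstoD(2)[OF pair_dist_tendsto[OF B(2)] that] .
      then obtain s where "pair_dist m n P (B s) < r" by (meson eventually_happens trivial_limit_sequentially)
      then show ?thesis using B(1) by blast
    qed
    then show "P \<in> pair_space m n \<and> (\<forall>r>0. \<exists>B. pair_iso m n Q B \<and> pair_dist m n P B < r)" using P by blast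
  qed
  finally show ?thesis .
qed

lemma tendsto_mat_mult:
  assumes A: "A \<in> carrier_mat k m" and M: "\<And>s. M s \<in> carrier_mat m n" "M0 \<in> carrier_mat m n"
    and B: "B \<in> carrier_mat n l"
    and lim: "\<And>r c. r < m \<Longrightarrow> c < n \<Longrightarrow> (\<lambda>s. M s $$ (r, c)) \<longlonglongrightarrow> (M0 $$ (r, c) :: complex)"
    and rc: "r < k" "c < l"
  shows "(\<lambda>s. (A * M s * B) $$ (r, c)) \<longlonglongrightarrow> (A * M0 * B) $$ (r, c)"
proof -
  have "(A * N * B) $$ (r, c) = (\<Sum>j\<in>{0..<n}. (\<Sum>i\<in>{0..<m}. A $$ (r, i) * N $$ (i, j)) * B $$ (j, c))"
    if "N \<in> carrier_mat m n" for N
    using that A B rc by (simp add: scalar_prod_def del: assoc_mult_mat)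
  then show ?thesis using M lim by (auto intro!: tendsto_intros)
qed

lemma degen_iso_left:
  assumes iso: "pair_iso m n P P'" and d: "degen m n P Q"
  shows "degen m n P' Q"
proof -
  obtain B where B: "\<And>s. pair_iso m n Q (B s)" "pair_tendsto m n B P" using d by (auto simp: degen_def)
  obtain S R where 1: "P \<in> pair_space m n" "P' \<in> pair_space m n" "unit_mat m S" "unit_mat n R" "pair_hom P P' S R"
    using iso by (auto simp: pair_iso_def)
  obtain T where T: "T \<in> carrier_mat n n" "R * T = 1\<^sub>m n" "T * R = 1\<^sub>m n" using 1(4) by (auto simp: unit_mat_def)
  note u = unit_mat_carrier[OF 1(3)] unit_mat_carrier[OF 1(4)]
  define B' where "B' s = (S * fst (B s) * T, S * snd (B s) * T)" for s
  have Bs: "fst (B s) \<in> carrier_mat m n" "snd (B s) \<in> carrier_mat m n" for s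
    using pair_iso_space(2)[OF B(1)[of s]] by (auto simp: pair_space_iff)
  have P: "fst P \<in> carrier_mat m n" "snd P \<in> carrier_mat m n" "fst P' \<in> carrier_mat m n" "snd P' \<in> carrier_mat m n"
    using 1 by (auto simp: pair_space_iff)
  have cancel: "X * R * T = X" "X * T * R = X" if "X \<in> carrier_mat m n" for X
    using that T u assoc_mult_mat[of X m n R n T n] assoc_mult_mat[of X m n T n R n] right_mult_one_mat[OF that]
    by auto
  have P': "fst P' = S * fst P * T" "snd P' = S * snd P * T"
    using 1(5) cancel(1)[OF P(3)] cancel(1)[OF P(4)] by (simp_all add: pair_hom_def)
  have "pair_iso m n (B s) (B' s)" for s
  proof (rule pair_isoI[of _ _ _ _ S R, OF _ _ 1(3,4)])
    show "B s \<in> pair_space m n" "B' s \<in> pair_space m n" using Bs[of s] u T by (auto simp: pair_space_iff B'_def)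
    show "pair_hom (B s) (B' s) S R"
      using cancel(2)[of "S * fst (B s)"] cancel(2)[of "S * snd (B s)"] Bs[of s] u
      by (simp add: pair_hom_def B'_def)
  qed
  then have "pair_iso m n Q (B' s)" for s using pair_iso_trans[OF B(1)] by blast
  moreover have "pair_tendsto m n B' P'"
    unfolding pair_tendsto_def P' B'_def fst_conv snd_conv
    using B(2) unfolding pair_tendsto_def
    by (intro allI impI conjI tendsto_mat_mult[OF u(1) Bs(1) P(1) T(1)] tendsto_mat_mult[OF u(1) Bs(2) P(2) T(1)]) blast+
  ultimately show ?thesis using 1(2) by (auto simp: degen_def)
qed

text \<open>The closure of an orbit is invariant under equivalence (\<open>degen_iso_left\<close>),
  so a single point of the other orbit decides.\<close>

lemma orbit_le_iff_degen:
  assumes "P \<in> pair_space m n" "Q \<in> pair_space m n"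
  shows "orbit_le m n P Q \<longleftrightarrow> degen m n P Q"
proof
  assume "orbit_le m n P Q"
  moreover have "P \<in> pair_orbit P" using mem_pair_orbit_iff[OF assms(1)] pair_iso_refl[OF assms(1)] by simp
  ultimately have "P \<in> pair_topology m n closure_of pair_orbit Q" by (auto simp: orbit_le_def)
  then show "degen m n P Q" using mem_closure_orbit_iff[OF assms(2)] by simp
next
  assume "degen m n P Q"
  then have "P' \<in> pair_topology m n closure_of pair_orbit Q" if "P' \<in> pair_orbit P" for P'
    using that degen_iso_left mem_closure_orbit_iff[OF assms(2)] mem_pair_orbit_iff[OF assms(1)] by blast
  then show "orbit_le m n P Q" by (auto simp: orbit_le_def)
qed

lemma orbit_le_trans:
  assumes "orbit_le m n P Q" "orbit_le m n Q T" shows "orbit_le m n P T"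
proof -
  have "pair_topology m n closure_of pair_orbit Q \<subseteq> pair_topology m n closure_of pair_orbit T"
    using assms(2) unfolding orbit_le_def by (intro closure_of_minimal) auto
  then show ?thesis using assms(1) by (auto simp: orbit_le_def)
qed

lemma degen_tr:
  assumes "degen m n P Q" shows "degen n m (tr P) (tr Q)"
proof -
  obtain B where P: "P \<in> pair_space m n" and B: "\<And>s. pair_iso m n Q (B s)" "pair_tendsto m n B P"
    using assms by (auto simp: degen_def)
  have "B s \<in> pair_space m n" for s using pair_iso_space(2)[OF B(1)] .
  then have Bd: "dim_row (fst (B s)) = m" "dim_col (fst (B s)) = n" "dim_row (snd (B s)) = m" "dim_col (snd (B s)) = n" for s
    by (auto simp: pair_space_iff)
  have "pair_iso n m (tr Q) (tr (B s))" for s by (rule tr_iso[OF B(1)])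
  moreover have "pair_tendsto n m (\<lambda>s. tr (B s)) (tr P)"
    using B(2) P Bd by (auto simp: pair_tendsto_def tr_def pair_space_iff)
  ultimately show ?thesis using tr_space[OF P] unfolding degen_def by (intro conjI exI[of _ "\<lambda>s. tr (B s)"]) simp_all
qed

section \<open>Semicontinuity of the invariants\<close>

lemma bounded_convergent_subsequence:
  fixes y :: "nat \<Rightarrow> 'a \<Rightarrow> complex"
  assumes "finite K" "\<And>s q. q \<in> K \<Longrightarrow> norm (y s q) \<le> 1"
  shows "\<exists>f y0. strict_mono (f :: nat \<Rightarrow> nat) \<and> (\<forall>q \<in> K. (\<lambda>s. y (f s) q) \<longlonglongrightarrow> y0 q)"
  using assms
proof (induction K rule: finite_induct)
  case empty
  show ?case by (intro exI[of _ id] exI) (simp add: strict_mono_def)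
next
  case (insert p K)
  obtain f y0 where f: "strict_mono f" "\<forall>q \<in> K. (\<lambda>s. y (f s) q) \<longlonglongrightarrow> y0 q"
    using insert.IH insert.prems by auto
  have sc: "seq_compact (cball (0 :: complex) 1)" using compact_cball compact_imp_seq_compact by blast
  have "\<forall>s. y (f s) p \<in> cball 0 1" using insert.prems by simp
  from seq_compactE[OF sc this] obtain l g where g: "strict_mono g" "((\<lambda>s. y (f s) p) \<circ> g) \<longlonglongrightarrow> l"
    by metis
  have "(\<lambda>s. y (f (g s)) q) \<longlonglongrightarrow> (y0(p := l)) q" if "q \<in> insert p K" for q
  proof (cases "q = p")
    case True
    then show ?thesis using g(2) by (simp add: o_def)
  next
    case False
    then have "(\<lambda>s. y (f s) q) \<longlonglongrightarrow> y0 q" using f that by simp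
    then show ?thesis using LIMSEQ_subseq_LIMSEQ[OF _ g(1)] False by (fastforce simp: o_def)
  qed
  then show ?case using strict_mono_o[OF f(1) g(1)] by (intro exI[of _ "f \<circ> g"] exI[of _ "y0(p := l)"]) (simp add: o_def)
qed

lemma ev_tendsto:
  assumes B: "\<And>s. B s \<in> pair_space m n" "P \<in> pair_space m n" and t: "pair_tendsto m n B P"
  shows "pair_tendsto m n (\<lambda>s. ev a (B s)) (ev a P)"
proof (cases a)
  case (Finite c)
  have d: "dim_row (fst (B s)) = m" "dim_col (fst (B s)) = n" "dim_row (snd (B s)) = m" "dim_col (snd (B s)) = n"
    "dim_row (fst P) = m" "dim_col (fst P) = n" "dim_row (snd P) = m" "dim_col (snd P) = n" for s
    using B(1)[of s] B(2) by (auto simp: pair_space_iff)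
  show ?thesis using t unfolding pair_tendsto_def by (auto simp: Finite d intro!: tendsto_intros)
qed (use t in simp)

text \<open>Compactness. If it failed for every \<open>s\<close>, nonzero solutions vanishing on
  \<open>C\<close>, normalised to maximum 1, would have a subsequence converging to a solution for
  \<open>P\<close> that vanishes on \<open>C\<close>. This limit is zero, against the
  normalisation.\<close>

lemma coord_inj_stable:
  assumes B: "\<And>s. B s \<in> pair_space m n" and P: "P \<in> pair_space m n" and t: "pair_tendsto m n B P"
    and inj: "coord_inj fl k P C" and C: "C \<subseteq> {..<k} \<times> {..<n}"
  shows "\<exists>s. coord_inj fl k (B s) C"
proof (rule ccontr)
  assume "\<nexists>s. coord_inj fl k (B s) C"
  have dB: "dim_row (fst (B s)) = m" "dim_col (fst (B s)) = n" "dim_row (snd (B s)) = m" "dim_col (snd (B s)) = n" for s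
    using B[of s] by (auto simp: pair_space_iff)
  have dP: "dim_row (fst P) = m" "dim_col (fst P) = n" "dim_row (snd P) = m" "dim_col (snd P) = n"
    using P by (auto simp: pair_space_iff)
  let ?K = "{..<k} \<times> {..<n}"
  have "\<forall>s. \<exists>u. chain_sol fl k (B s) u \<and> (\<forall>(c, q) \<in> C. u c q = 0) \<and> (\<exists>p \<in> ?K. u (fst p) (snd p) \<noteq> 0)"
  proof
    fix s
    have "\<not> coord_inj fl k (B s) C" using \<open>\<nexists>s. coord_inj fl k (B s) C\<close> by simp
    then obtain u c q where "chain_sol fl k (B s) u" "\<forall>(c, q) \<in> C. u c q = 0" "c < k" "q < n" "u c q \<noteq> 0"
      unfolding coord_inj_def dB not_all not_imp by (elim exE conjE)
    then show "\<exists>u. chain_sol fl k (B s) u \<and> (\<forall>(c, q) \<in> C. u c q = 0) \<and> (\<exists>p \<in> ?K. u (fst p) (snd p) \<noteq> 0)"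
      by (intro exI[of _ u] conjI bexI[of _ "(c, q)"]) simp_all
  qed
  from choice[OF this] obtain u where "\<forall>s. chain_sol fl k (B s) (u s) \<and> (\<forall>(c, q) \<in> C. u s c q = 0) \<and>
      (\<exists>p \<in> ?K. u s (fst p) (snd p) \<noteq> 0)" by (rule exE)
  then have u: "chain_sol fl k (B s) (u s)" "\<forall>(c, q) \<in> C. u s c q = 0" "\<exists>p \<in> ?K. u s (fst p) (snd p) \<noteq> 0" for s
    by simp_all
  define M where "M s = Max ((\<lambda>p. norm (u s (fst p) (snd p))) ` ?K)" for s
  have M_ge: "norm (u s c q) \<le> M s" if "c < k" "q < n" for s c q
    unfolding M_def using that by (intro Max_ge) (auto intro!: image_eqI[of _ _ "(c, q)"])
  have M_pos: "0 < M s" for s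
  proof -
    obtain c q where "c < k" "q < n" "u s c q \<noteq> 0" using u(3)[of s] by auto
    then show ?thesis using M_ge[of c q s] by (meson less_le_trans zero_less_norm_iff)
  qed
  have M_att: "\<exists>p \<in> ?K. norm (u s (fst p) (snd p)) = M s" for s
  proof -
    have "?K \<noteq> {}" using u(3)[of s] by blast
    then have "M s \<in> (\<lambda>p. norm (u s (fst p) (snd p))) ` ?K"
      unfolding M_def by (intro Max_in) auto
    then obtain p where p: "p \<in> ?K" "M s = norm (u s (fst p) (snd p))" by (rule imageE)
    from p(2)[symmetric] p(1) show ?thesis by (rule bexI)
  qed
  define y where "y s c q = (1 / of_real (M s)) * u s c q" for s c q
  have y_norm: "norm (y s c q) = norm (u s c q) / M s" for s c q
    using M_pos[of s] by (simp add: y_def norm_mult norm_divide)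
  \<comment> \<open>A multiple of a solution is taken as a linear combination with one term, indexed
    by the unit type.\<close>
  have y_sol: "chain_sol fl k (B s) (y s)" for s
    using chain_sol_sum[of "{()}" fl k "B s" "\<lambda>_. u s" "\<lambda>_. 1 / of_real (M s)"] u(1) by (simp add: y_def[abs_def])
  have bd: "norm (y s (fst p) (snd p)) \<le> 1" if "p \<in> ?K" for s p
    using M_ge[of "fst p" "snd p" s] M_pos[of s] that by (auto simp: y_norm divide_le_eq_1)
  have "\<exists>f y0. strict_mono (f :: nat \<Rightarrow> nat) \<and> (\<forall>p \<in> ?K. (\<lambda>s. y (f s) (fst p) (snd p)) \<longlonglongrightarrow> y0 p)"
  proof (rule bounded_convergent_subsequence)
    show "finite ?K" by simp
  qed (rule bd)
  then obtain f w where f: "strict_mono f" and w: "\<forall>p \<in> ?K. (\<lambda>s. y (f s) (fst p) (snd p)) \<longlonglongrightarrow> w p"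
    by (elim exE conjE)
  define v where "v c q = w (c, q)" for c q
  have v: "(\<lambda>s. y (f s) c q) \<longlonglongrightarrow> v c q" if "c < k" "q < n" for c q
    using w[rule_format, of "(c, q)"] that by (simp add: v_def)
  have ent: "(\<lambda>s. fst (B (f s)) $$ (r, q)) \<longlonglongrightarrow> fst P $$ (r, q)" "(\<lambda>s. snd (B (f s)) $$ (r, q)) \<longlonglongrightarrow> snd P $$ (r, q)"
    if "r < m" "q < n" for r q
    using t that LIMSEQ_subseq_LIMSEQ[OF _ f, of "\<lambda>s. fst (B s) $$ (r, q)"]
      LIMSEQ_subseq_LIMSEQ[OF _ f, of "\<lambda>s. snd (B s) $$ (r, q)"] by (simp_all add: pair_tendsto_def o_def)
  have lim: "(\<lambda>s. mapp (fst (B (f s))) (y (f s) c) r) \<longlonglongrightarrow> mapp (fst P) (v c) r"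
    "(\<lambda>s. mapp (snd (B (f s))) (y (f s) c) r) \<longlonglongrightarrow> mapp (snd P) (v c) r" if "r < m" "c < k" for r c
    unfolding mapp_def dB dP using that by (auto intro!: tendsto_sum tendsto_mult ent v)
  have v_sol: "chain_sol fl k P v"
    unfolding chain_sol_def dP
  proof (intro allI impI conjI)
    fix r assume r: "r < m"
    note sol = y_sol[unfolded chain_sol_def dB, rule_format, OF r]
    { assume k: "0 < k"
      show "mapp (fst P) (v 0) r = 0"
      proof -
        have "mapp (fst (B (f s))) (y (f s) 0) r = 0" for s using sol[of "f s"] k by simp
        then show ?thesis using lim(1)[OF r k] by (simp add: LIMSEQ_const_iff)
      qed
      show "mapp (snd P) (v (k - 1)) r = 0" if fl: fl
      proof -
        have "mapp (snd (B (f s))) (y (f s) (k - 1)) r = 0" for s using sol[of "f s"] k fl by simp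
        then show ?thesis using lim(2)[OF r, of "k - 1"] k by (simp add: LIMSEQ_const_iff)
      qed }
    fix c assume c: "Suc c < k"
    then have "mapp (fst (B (f s))) (y (f s) (Suc c)) r = mapp (snd (B (f s))) (y (f s) c) r" for s
      using sol[of "f s"] by simp
    then have "(\<lambda>s. mapp (snd (B (f s))) (y (f s) c) r) \<longlonglongrightarrow> mapp (fst P) (v (Suc c)) r"
      using lim(1)[OF r c] by simp
    from LIMSEQ_unique[OF this lim(2)[OF r]] c show "mapp (fst P) (v (Suc c)) r = mapp (snd P) (v c) r"
      by simp
  qed
  have v_zero: "\<forall>(c, q) \<in> C. v c q = 0"
  proof safe
    fix c q assume cq: "(c, q) \<in> C"
    have "y s c q = 0" for s using bspec[OF u(2) cq, of s] by (simp add: y_def)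
    moreover have "c < k" "q < n" using cq C by auto
    ultimately show "v c q = 0" using v[of c q] by (simp add: LIMSEQ_const_iff)
  qed
  have inj': "chain_sol fl k P v \<longrightarrow> (\<forall>(c, q) \<in> C. v c q = 0) \<longrightarrow> (\<forall>c<k. \<forall>q<n. v c q = 0)"
    using inj unfolding coord_inj_def dP by (rule spec)
  have v0: "v c q = 0" if "c < k" "q < n" for c q
    using mp[OF mp[OF inj' v_sol] v_zero] that by simp
  have "\<forall>\<^sub>F s in sequentially. norm (y (f s) (fst p) (snd p)) < 1" if p: "p \<in> ?K" for p
  proof -
    have pk: "fst p < k" "snd p < n" using p by auto
    have "(\<lambda>s. norm (y (f s) (fst p) (snd p))) \<longlonglongrightarrow> norm (v (fst p) (snd p))"
      by (rule tendsto_norm[OF v[OF pk]])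
    then show ?thesis by (rule order_tendstoD(2)) (simp add: v0[OF pk])
  qed
  then have "\<forall>\<^sub>F s in sequentially. \<forall>p \<in> ?K. norm (y (f s) (fst p) (snd p)) < 1"
    by (intro eventually_ball_finite ballI) simp_all
  then obtain N where "\<forall>s\<ge>N. \<forall>p \<in> ?K. norm (y (f s) (fst p) (snd p)) < 1"
    unfolding eventually_sequentially by (rule exE)
  then have s: "\<forall>p \<in> ?K. norm (y (f N) (fst p) (snd p)) < 1" by simp
  obtain p where p: "p \<in> ?K" "norm (u (f N) (fst p) (snd p)) = M (f N)"
    using M_att[of "f N"] by (rule bexE)
  have "norm (y (f N) (fst p) (snd p)) = 1" using p(2) M_pos[of "f N"] by (simp add: y_norm)
  then show False using bspec[OF s p(1)] by simp
qed

text \<open>A coordinate set of the exact size for \<open>xs\<close> still determines the solutions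
  for some \<open>B s\<close> by \<open>coord_inj_stable\<close>. Since \<open>B s\<close> is
  equivalent to \<open>direct_sum ys\<close>, its size bounds the invariant of
  \<open>ys\<close>.\<close>

lemma degen_inv:
  assumes d: "degen m n (direct_sum xs) (direct_sum ys)"
    and xs: "\<forall>x \<in> set xs. valid_summand x" and ys: "\<forall>x \<in> set ys. valid_summand x"
  shows "inv_L k ys \<le> inv_L k xs" "inv_D a k ys \<le> inv_D a k xs"
proof -
  let ?P = "direct_sum xs"
  obtain B where P: "?P \<in> pair_space m n" and B: "\<And>s. pair_iso m n (direct_sum ys) (B s)" "pair_tendsto m n B ?P"
    using d by (auto simp: degen_def)
  note Bs = pair_iso_space(2)[OF B(1)]
  have gen: "\<exists>s C. coord_inj fl k (ev a (B s)) C \<and> finite C \<and> card C = N" if c: "coords fl k (ev a ?P) N" for fl a N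
  proof -
    obtain C where C: "C \<subseteq> {..<k} \<times> {..<n}" "coord_inj fl k (ev a ?P) C" "card C = N"
      using c ev_space[OF P, of a] by (auto simp: coords_def pair_space_iff)
    obtain s where "coord_inj fl k (ev a (B s)) C"
      using coord_inj_stable[OF ev_space[OF Bs] ev_space[OF P] ev_tendsto[OF Bs P B(2)] C(2,1)] by (rule exE)
    moreover have "finite C" using C(1) by (auto intro: finite_subset)
    ultimately show ?thesis using C(3) by (intro exI conjI)
  qed
  obtain s C where C: "coord_inj True k (ev (Finite 0) (B s)) C" "finite C" "card C = inv_L k xs"
    using gen[OF coords_direct_sum(1)[OF xs]] by (elim exE conjE)
  show "inv_L k ys \<le> inv_L k xs"
    using inv_bounds(1)[OF pair_iso_sym[OF B(1)] ys C(2,1)] C(3) by simp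
  obtain s C where C: "coord_inj False k (ev a (B s)) C" "finite C" "card C = inv_D a k xs"
    using gen[where a = a, OF coords_direct_sum(2)[OF xs]] by (elim exE conjE)
  show "inv_D a k ys \<le> inv_D a k xs"
    using inv_bounds(2)[OF pair_iso_sym[OF B(1)] ys C(2,1)] C(3) by simp
qed

lemma degen_iso_right:
  assumes "degen m n P Q" "pair_iso m n Q Q'" shows "degen m n P Q'"
proof -
  obtain B where "P \<in> pair_space m n" "\<And>s. pair_iso m n Q (B s)" "pair_tendsto m n B P"
    using assms(1) by (auto simp: degen_def)
  moreover from this(2) have "pair_iso m n Q' (B s)" for s
    using pair_iso_trans[OF pair_iso_sym[OF assms(2)]] by simp
  ultimately show ?thesis unfolding degen_def by (intro conjI exI[of _ B]) simp_all
qed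

lemma degen_inv_LT:
  assumes d: "degen m n (direct_sum xs) (direct_sum ys)"
    and xs: "\<forall>x \<in> set xs. valid_summand x" and ys: "\<forall>x \<in> set ys. valid_summand x"
  shows "inv_LT k ys \<le> inv_LT k xs"
proof -
  obtain B where P: "direct_sum xs \<in> pair_space m n" and B: "pair_iso m n (direct_sum ys) (B 0)"
    using d by (auto simp: degen_def)
  have cx: "row_count xs = m" "col_count xs = n" using P by (auto simp: pair_space_iff)
  have cy: "row_count ys = m" "col_count ys = n" using pair_iso_space(1)[OF B] by (auto simp: pair_space_iff)
  note dx = tr_direct_sum[of xs, unfolded cx] and dy = tr_direct_sum[of ys, unfolded cy]
  have "degen n m (direct_sum (map dual xs)) (direct_sum (map dual ys))"
    by (rule degen_iso_right[OF degen_iso_left[OF dx degen_tr[OF d]] dy])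
  from degen_inv(1)[OF this, of k] show ?thesis using xs ys by (simp add: inv_L_dual)
qed

definition inv_ge :: "summand list \<Rightarrow> summand list \<Rightarrow> bool" where
  "inv_ge xs ys \<longleftrightarrow> (\<forall>k. inv_LT k ys \<le> inv_LT k xs) \<and> (\<forall>k. inv_L k ys \<le> inv_L k xs) \<and>
     (\<forall>a k. inv_D a k ys \<le> inv_D a k xs)"

lemma degen_inv_ge:
  assumes "degen m n (direct_sum xs) (direct_sum ys)"
    "\<forall>x \<in> set xs. valid_summand x" "\<forall>x \<in> set ys. valid_summand x"
  shows "inv_ge xs ys"
  using degen_inv[OF assms] degen_inv_LT[OF assms] by (simp add: inv_ge_def)

section \<open>Perturbing a single block\<close>

text \<open>The class \<open>X\<close> over \<open>Q\<close>, seen as a class over a sum of three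
  parts: \<open>v\<close> zero columns before it and \<open>w\<close> after it, for the summands on
  either side of \<open>Q\<close>.\<close>

definition padded_block :: "nat \<Rightarrow> nat \<Rightarrow> nat \<Rightarrow> nat \<Rightarrow> matrix_pair \<Rightarrow> matrix_pair" where
  "padded_block a v b w X =
    (mat a (v + (b + w)) (\<lambda>(r, c). if v \<le> c \<and> c < v + b then fst X $$ (r, c - v) else 0),
     mat a (v + (b + w)) (\<lambda>(r, c). if v \<le> c \<and> c < v + b then snd X $$ (r, c - v) else 0))"

lemma padded_block_space [simp]: "padded_block a v b w X \<in> pair_space a (v + (b + w))"
  by (simp add: padded_block_def pair_space_def)

definition scale_pair :: "complex \<Rightarrow> matrix_pair \<Rightarrow> matrix_pair" where
  "scale_pair e X = (e \<cdot>\<^sub>m fst X, e \<cdot>\<^sub>m snd X)"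

lemma scale_pair_space: "X \<in> pair_space m n \<Longrightarrow> scale_pair e X \<in> pair_space m n"
  by (simp add: scale_pair_def pair_space_iff)

text \<open>The scalar \<open>1 / e\<close> is an automorphism of \<open>Q\<close>, and pulling back
  along it multiplies the class by \<open>e\<close>.\<close>

lemma ut_scale:
  assumes P: "P \<in> pair_space a b" and Q: "Q \<in> pair_space c d" and X: "X \<in> pair_space a d" and e: "e \<noteq> 0"
  shows "pair_iso (a + c) (b + d) (ut P X Q) (ut P (scale_pair e X) Q)"
proof -
  have c: "fst P \<in> carrier_mat a b" "snd P \<in> carrier_mat a b" "fst Q \<in> carrier_mat c d" "snd Q \<in> carrier_mat c d"
    "fst X \<in> carrier_mat a d" "snd X \<in> carrier_mat a d" using P Q X by (auto simp: pair_space_iff)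
  show ?thesis
  proof (rule ut_iso[OF P P Q Q X scale_pair_space[OF X]])
    show "unit_mat a (1\<^sub>m a)" "unit_mat b (1\<^sub>m b)" by simp_all
    show "unit_mat c ((1 / e) \<cdot>\<^sub>m 1\<^sub>m c)" "unit_mat d ((1 / e) \<cdot>\<^sub>m 1\<^sub>m d)"
      using e by (simp_all add: unit_mat_smult)
    show "0\<^sub>m a c \<in> carrier_mat a c" "0\<^sub>m b d \<in> carrier_mat b d" by simp_all
    show "pair_hom P P (1\<^sub>m a) (1\<^sub>m b)" using c by (simp add: pair_hom_def)
    show "pair_hom Q Q ((1 / e) \<cdot>\<^sub>m 1\<^sub>m c) ((1 / e) \<cdot>\<^sub>m 1\<^sub>m d)"
      using c by (simp add: pair_hom_def mult_smult_assoc_mat[of _ c c] mult_smult_distrib[of _ c d _ d])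
    show "1\<^sub>m a * fst X + 0\<^sub>m a c * fst Q = fst P * 0\<^sub>m b d + fst (scale_pair e X) * ((1 / e) \<cdot>\<^sub>m 1\<^sub>m d)"
      using c e by (auto simp: scale_pair_def mult_smult_distrib[of _ a d _ d] mult_smult_assoc_mat[of _ a d _ d]
          intro!: eq_matI)
    show "1\<^sub>m a * snd X + 0\<^sub>m a c * snd Q = snd P * 0\<^sub>m b d + snd (scale_pair e X) * ((1 / e) \<cdot>\<^sub>m 1\<^sub>m d)"
      using c e by (auto simp: scale_pair_def mult_smult_distrib[of _ a d _ d] mult_smult_assoc_mat[of _ a d _ d]
          intro!: eq_matI)
  qed
qed

text \<open>Sends a position in the block order P, Q, V, W to the corresponding position in the
  order P, V, Q, W; \<open>a\<close>, \<open>b\<close>, \<open>v\<close> are the sizes of P, Q,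
  V.\<close>

definition mid_swap :: "nat \<Rightarrow> nat \<Rightarrow> nat \<Rightarrow> nat \<Rightarrow> nat" where
  "mid_swap a v b i = (if i < a then i else if i < a + b then i + v else if i < a + b + v then i - b else i)"

lemma bij_mid_swap: "bij_betw (mid_swap a v b) {..<a + (v + (b + w))} {..<a + (v + (b + w))}"
proof (rule bij_betw_byWitness[where f' = "mid_swap a b v"])
  have inv: "mid_swap a b v (mid_swap a v b i) = i" for i v b
    by (cases "i < a"; cases "i < a + b"; cases "i < a + b + v") (auto simp: mid_swap_def)
  have le: "mid_swap a v b i < a + (v + (b + w))" if "i < a + (v + (b + w))" for i v b
    using that by (cases "i < a"; cases "i < a + b"; cases "i < a + b + v") (auto simp: mid_swap_def)
  show "\<forall>i\<in>{..<a + (v + (b + w))}. mid_swap a b v (mid_swap a v b i) = i"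
    "\<forall>i\<in>{..<a + (v + (b + w))}. mid_swap a v b (mid_swap a b v i) = i"
    by (simp_all add: inv)
  show "mid_swap a v b ` {..<a + (v + (b + w))} \<subseteq> {..<a + (v + (b + w))}"
    using le by auto
  show "mid_swap a b v ` {..<a + (v + (b + w))} \<subseteq> {..<a + (v + (b + w))}"
    using le[of _ b v] by (auto simp: add.left_commute)
qed

lemma four_block_swap_middle:
  assumes c: "A \<in> carrier_mat a a'" "V \<in> carrier_mat v v'" "M \<in> carrier_mat b b'" "W \<in> carrier_mat w w'"
    "X \<in> carrier_mat a b'"
    and i: "i < a + (v + (b + w))" and j: "j < a' + (v' + (b' + w'))"
  shows "four_block_mat (four_block_mat A X (0\<^sub>m b a') M) (0\<^sub>m (a + b) (v' + w')) (0\<^sub>m (v + w) (a' + b'))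
      (four_block_mat V (0\<^sub>m v w') (0\<^sub>m w v') W) $$ (i, j) =
    four_block_mat A (mat a (v' + (b' + w')) (\<lambda>(r, c). if v' \<le> c \<and> c < v' + b' then X $$ (r, c - v') else 0))
      (0\<^sub>m (v + (b + w)) a')
      (four_block_mat V (0\<^sub>m v (b' + w')) (0\<^sub>m (b + w) v') (four_block_mat M (0\<^sub>m b w') (0\<^sub>m w b') W))
      $$ (mid_swap a v b i, mid_swap a' v' b' j)"
proof -
  have d: "dim_row A = a" "dim_col A = a'" "dim_row V = v" "dim_col V = v'" "dim_row M = b" "dim_col M = b'"
    "dim_row W = w" "dim_col W = w'" "dim_row X = a" "dim_col X = b'"
    using c by auto
  consider "i < a" | "\<not> i < a" "i < a + b" | "\<not> i < a + b" "i < a + b + v" | "\<not> i < a + b + v" by blast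
  then show ?thesis
  proof cases
    case 1
    then show ?thesis using i j
      by (cases "j < a'"; cases "j < a' + b'"; cases "j < a' + b' + v'") (auto simp: mid_swap_def d ac_simps)
  next
    case 2
    then show ?thesis using i j
      by (cases "j < a'"; cases "j < a' + b'"; cases "j < a' + b' + v'") (auto simp: mid_swap_def d ac_simps)
  next
    case 3
    then show ?thesis using i j
      by (cases "j < a'"; cases "j < a' + b'"; cases "j < a' + b' + v'") (auto simp: mid_swap_def d ac_simps)
  next
    case 4
    then show ?thesis using i j
      by (cases "j < a'"; cases "j < a' + b'"; cases "j < a' + b' + v'") (auto simp: mid_swap_def d ac_simps)
  qed
qed

lemma ut_swap_middle:
  assumes P: "P \<in> pair_space a a'" and V: "V \<in> pair_space v v'" and Q: "Q \<in> pair_space b b'"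
    and W: "W \<in> pair_space w w'" and X: "X \<in> pair_space a b'"
  shows "pair_iso (a + (v + (b + w))) (a' + (v' + (b' + w')))
    (ut P (padded_block a v' b' w' X) (dsum V (dsum Q W))) (dsum (ut P X Q) (dsum V W))"
proof (rule pair_iso_perm[OF _ bij_mid_swap bij_mid_swap])
  show "ut P (padded_block a v' b' w' X) (dsum V (dsum Q W)) \<in> pair_space (a + (v + (b + w))) (a' + (v' + (b' + w')))"
    by (intro ut_space dsum_space P V Q W)
  have "dsum (ut P X Q) (dsum V W) \<in> pair_space (a + b + (v + w)) (a' + b' + (v' + w'))"
    by (intro ut_space dsum_space P V Q W)
  then show "dsum (ut P X Q) (dsum V W) \<in> pair_space (a + (v + (b + w))) (a' + (v' + (b' + w')))"
    by (simp add: ac_simps)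
  have d: "dim_row (fst P) = a" "dim_row (fst Q) = b" "dim_row (fst V) = v" "dim_row (fst W) = w"
    "dim_row (snd P) = a" "dim_row (snd Q) = b" "dim_row (snd V) = v" "dim_row (snd W) = w"
    "dim_col (fst P) = a'" "dim_col (fst Q) = b'" "dim_col (fst V) = v'" "dim_col (fst W) = w'"
    "dim_col (snd P) = a'" "dim_col (snd Q) = b'" "dim_col (snd V) = v'" "dim_col (snd W) = w'"
    using P V Q W by (auto simp: pair_space_iff)
  have c: "fst P \<in> carrier_mat a a'" "snd P \<in> carrier_mat a a'" "fst V \<in> carrier_mat v v'" "snd V \<in> carrier_mat v v'"
    "fst Q \<in> carrier_mat b b'" "snd Q \<in> carrier_mat b b'" "fst W \<in> carrier_mat w w'" "snd W \<in> carrier_mat w w'"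
    "fst X \<in> carrier_mat a b'" "snd X \<in> carrier_mat a b'"
    using P V Q W X by (auto simp: pair_space_iff)
  fix i j assume ij: "i < a + (v + (b + w))" "j < a' + (v' + (b' + w'))"
  show "fst (dsum (ut P X Q) (dsum V W)) $$ (i, j) =
      fst (ut P (padded_block a v' b' w' X) (dsum V (dsum Q W))) $$ (mid_swap a v b i, mid_swap a' v' b' j)"
    using four_block_swap_middle[OF c(1,3,5,7,9) ij]
    by (simp add: dsum_def ut_def zero_pair_def padded_block_def d)
  show "snd (dsum (ut P X Q) (dsum V W)) $$ (i, j) =
      snd (ut P (padded_block a v' b' w' X) (dsum V (dsum Q W))) $$ (mid_swap a v b i, mid_swap a' v' b' j)"
    using four_block_swap_middle[OF c(2,4,6,8,10) ij]
    by (simp add: dsum_def ut_def zero_pair_def padded_block_def d)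
qed

lemma dsum_ut_entry:
  assumes U: "U \<in> pair_space u u'" and A: "A \<in> pair_space a a'" and R: "R \<in> pair_space c c'" and Y: "Y \<in> pair_space a c'"
    and r: "r < u + (a + c)" and q: "q < u' + (a' + c')"
  shows "fst (dsum U (ut A Y R)) $$ (r, q) = fst (dsum U (dsum A R)) $$ (r, q) +
      (if u \<le> r \<and> r < u + a \<and> u' + a' \<le> q then fst Y $$ (r - u, q - (u' + a')) else 0)"
    and "snd (dsum U (ut A Y R)) $$ (r, q) = snd (dsum U (dsum A R)) $$ (r, q) +
      (if u \<le> r \<and> r < u + a \<and> u' + a' \<le> q then snd Y $$ (r - u, q - (u' + a')) else 0)"
proof -
  have d: "dim_row (fst U) = u" "dim_row (fst A) = a" "dim_row (fst R) = c" "dim_row (fst Y) = a"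
    "dim_row (snd U) = u" "dim_row (snd A) = a" "dim_row (snd R) = c" "dim_row (snd Y) = a"
    "dim_col (fst U) = u'" "dim_col (fst A) = a'" "dim_col (fst R) = c'" "dim_col (fst Y) = c'"
    "dim_col (snd U) = u'" "dim_col (snd A) = a'" "dim_col (snd R) = c'" "dim_col (snd Y) = c'"
    using U A R Y by (auto simp: pair_space_iff)
  show "fst (dsum U (ut A Y R)) $$ (r, q) = fst (dsum U (dsum A R)) $$ (r, q) +
      (if u \<le> r \<and> r < u + a \<and> u' + a' \<le> q then fst Y $$ (r - u, q - (u' + a')) else 0)"
    using r q by (cases "r < u"; cases "r < u + a"; cases "q < u'"; cases "q < u' + a'")
      (auto simp: dsum_def ut_def zero_pair_def d)
  show "snd (dsum U (ut A Y R)) $$ (r, q) = snd (dsum U (dsum A R)) $$ (r, q) +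
      (if u \<le> r \<and> r < u + a \<and> u' + a' \<le> q then snd Y $$ (r - u, q - (u' + a')) else 0)"
    using r q by (cases "r < u"; cases "r < u + a"; cases "q < u'"; cases "q < u' + a'")
      (auto simp: dsum_def ut_def zero_pair_def d)
qed

text \<open>The scaled class is inserted where the strip of \<open>a\<close> meets the strip of
  \<open>b\<close>. Moving \<open>vs\<close> out of the way displays an extension of
  \<open>b\<close> by \<open>a\<close> next to unchanged summands, and by \<open>ut_scale\<close>
  its equivalence class does not depend on the scale.\<close>

lemma block_perturbation:
  fixes us vs ws zs :: "summand list" and a b :: summand
  defines "xs \<equiv> us @ a # vs @ b # ws"
  assumes ext: "sum_extension a b zs"
  shows "\<exists>B. (\<forall>s. pair_iso (row_count xs) (col_count xs) (direct_sum (us @ zs @ vs @ ws)) (B s) \<and>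
        differs_only_in_block xs (length us) (Suc (length us + length vs)) (B s)) \<and>
      pair_tendsto (row_count xs) (col_count xs) B (direct_sum xs)"
proof -
  let ?m = "row_count xs" and ?n = "col_count xs"
  let ?A = "summand_pair a" and ?Q = "summand_pair b"
  let ?U = "direct_sum us" and ?V = "direct_sum vs" and ?W = "direct_sum ws"
  let ?R = "dsum ?V (dsum ?Q ?W)"
  let ?v = "col_count vs" and ?b = "summand_cols b" and ?w = "col_count ws"
  have cx: "?m = row_count us + (summand_rows a + (row_count vs + (summand_rows b + row_count ws)))"
    "?n = col_count us + (summand_cols a + (col_count vs + (summand_cols b + col_count ws)))"
    by (simp_all add: xs_def row_count_simps col_count_simps)
  obtain X where X: "X \<in> pair_space (summand_rows a) (summand_cols b)"
    and iso: "pair_iso (summand_rows a + summand_rows b) (summand_cols a + summand_cols b) (ut ?A X ?Q) (direct_sum zs)"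
    using ext unfolding sum_extension_def extension_of_def by (elim conjE bexE)
  define e :: "nat \<Rightarrow> complex" where "e s = of_real (inverse (real (Suc s)))" for s
  define Y where "Y s = padded_block (summand_rows a) ?v ?b ?w (scale_pair (e s) X)" for s
  define B where "B s = dsum ?U (ut ?A (Y s) ?R)" for s
  have e: "e s \<noteq> 0" for s
    unfolding e_def of_real_eq_0_iff by simp
  have e_lim: "e \<longlonglongrightarrow> 0"
    using tendsto_of_real[OF LIMSEQ_inverse_real_of_nat, where 'a = complex] unfolding e_def[abs_def] of_real_0 .
  note sp = summand_space direct_sum_in_pair_space
  have R: "?R \<in> pair_space (row_count vs + (summand_rows b + row_count ws)) (?v + (?b + ?w))"
    by (intro dsum_space sp)
  have Y: "Y s \<in> pair_space (summand_rows a) (?v + (?b + ?w))" for s by (simp add: Y_def)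
  have xs_eq: "direct_sum xs = dsum ?U (dsum ?A ?R)"
    by (simp add: xs_def direct_sum_append direct_sum_Cons)
  have iso_B: "pair_iso ?m ?n (direct_sum (us @ zs @ vs @ ws)) (B s)" for s
  proof -
    have 1: "pair_iso (summand_rows a + summand_rows b + (row_count vs + row_count ws))
        (summand_cols a + summand_cols b + (?v + ?w)) (dsum (ut ?A (scale_pair (e s) X) ?Q) (dsum ?V ?W))
        (dsum (direct_sum zs) (dsum ?V ?W))"
      by (intro dsum_cong pair_iso_refl dsum_space sp
          pair_iso_trans[OF pair_iso_sym[OF ut_scale[OF sp(1) sp(1) X e]] iso])
    have 2: "pair_iso (summand_rows a + (row_count vs + (summand_rows b + row_count ws)))
        (summand_cols a + (?v + (?b + ?w))) (ut ?A (Y s) ?R) (dsum (ut ?A (scale_pair (e s) X) ?Q) (dsum ?V ?W))"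
      unfolding Y_def by (rule ut_swap_middle) (intro sp scale_pair_space X)+
    have 3: "pair_iso (summand_rows a + (row_count vs + (summand_rows b + row_count ws)))
        (summand_cols a + (?v + (?b + ?w))) (ut ?A (Y s) ?R) (dsum (direct_sum zs) (dsum ?V ?W))"
      by (rule pair_iso_trans[OF 2]) (use 1 in \<open>simp add: ac_simps\<close>)
    have "pair_iso ?m ?n (B s) (dsum ?U (dsum (direct_sum zs) (dsum ?V ?W)))"
      unfolding B_def cx by (rule dsum_cong[OF pair_iso_refl[OF sp(2)] 3])
    then show ?thesis by (simp add: direct_sum_append pair_iso_sym)
  qed
  define blk where "blk r q \<longleftrightarrow> row_count us \<le> r \<and> r < row_count us + summand_rows a \<and>
      col_count us + summand_cols a + ?v \<le> q \<and> q < col_count us + summand_cols a + ?v + ?b" for r q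
  let ?r = "\<lambda>r. r - row_count us" and ?q = "\<lambda>q. q - (col_count us + summand_cols a) - ?v"
  have Xd: "dim_row (fst X) = summand_rows a" "dim_col (fst X) = ?b" "dim_row (snd X) = summand_rows a" "dim_col (snd X) = ?b"
    using X by (auto simp: pair_space_iff)
  have ent: "fst (B s) $$ (r, q) = fst (direct_sum xs) $$ (r, q) + (if blk r q then e s * fst X $$ (?r r, ?q q) else 0)"
    "snd (B s) $$ (r, q) = snd (direct_sum xs) $$ (r, q) + (if blk r q then e s * snd X $$ (?r r, ?q q) else 0)"
    if rq: "r < ?m" "q < ?n" for s r q
  proof -
    note E = dsum_ut_entry[OF sp(2) sp(1) R Y rq[unfolded cx], of s, folded B_def xs_eq]
    have lt: "q - (col_count us + summand_cols a) < ?v + (?b + ?w)" if "col_count us + summand_cols a \<le> q"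
      using that rq(2) by (simp add: cx)
    show "fst (B s) $$ (r, q) = fst (direct_sum xs) $$ (r, q) + (if blk r q then e s * fst X $$ (?r r, ?q q) else 0)"
      unfolding E(1) using lt by (auto simp: blk_def Y_def padded_block_def scale_pair_def Xd)
    show "snd (B s) $$ (r, q) = snd (direct_sum xs) $$ (r, q) + (if blk r q then e s * snd X $$ (?r r, ?q q) else 0)"
      unfolding E(2) using lt by (auto simp: blk_def Y_def padded_block_def scale_pair_def Xd)
  qed
  have pos: "block_positions xs (length us) (Suc (length us + length vs)) = {(r, q). blk r q}"
    by (auto simp: block_positions_def xs_def blk_def row_count_simps col_count_simps)
  have "differs_only_in_block xs (length us) (Suc (length us + length vs)) (B s)" for s
    unfolding differs_only_in_block_def pos using pair_iso_space(2)[OF iso_B[of s]] by (auto simp: ent)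
  moreover have "pair_tendsto ?m ?n B (direct_sum xs)"
    unfolding pair_tendsto_def
  proof (intro allI impI)
    fix r q assume rq: "r < ?m" "q < ?n"
    have z: "(\<lambda>s. x + (if blk r q then e s * y else 0)) \<longlonglongrightarrow> x" for x y
      using tendsto_add[OF tendsto_const tendsto_mult_left_zero[OF e_lim], of x y] by (cases "blk r q") auto
    show "(\<lambda>s. fst (B s) $$ (r, q)) \<longlonglongrightarrow> fst (direct_sum xs) $$ (r, q) \<and>
        (\<lambda>s. snd (B s) $$ (r, q)) \<longlonglongrightarrow> snd (direct_sum xs) $$ (r, q)"
      unfolding ent[OF rq] using z by simp
  qed
  ultimately show ?thesis using iso_B by (intro exI[of _ B]) simp
qed

section \<open>Moves between canonical pairs\<close>

fun LT_size :: "summand \<Rightarrow> nat" where "LT_size (LT m) = m" | "LT_size _ = 0"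
fun L_size :: "summand \<Rightarrow> nat" where "L_size (L n) = n" | "L_size _ = 0"
fun D_size :: "summand \<Rightarrow> nat" where "D_size (D a k) = k" | "D_size _ = 0"

text \<open>Numbers (\<open>n\<close>) and total sizes (\<open>t\<close>) of the summands of each
  type. For large \<open>k\<close> the invariants are affine functions of \<open>k\<close> with
  coefficients built from these and from \<open>reg\<close>, the total size at one
  eigenvalue.\<close>

definition nLT :: "summand list \<Rightarrow> nat" where "nLT xs = length (filter is_LT xs)"
definition nL :: "summand list \<Rightarrow> nat" where "nL xs = length (filter is_L xs)"
definition tLT :: "summand list \<Rightarrow> nat" where "tLT xs = sum_list (map LT_size xs)"
definition tL :: "summand list \<Rightarrow> nat" where "tL xs = sum_list (map L_size xs)"
definition tD :: "summand list \<Rightarrow> nat" where "tD xs = sum_list (map D_size xs)"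
definition reg :: "ext_complex \<Rightarrow> summand list \<Rightarrow> nat" where
  "reg a xs = sum_list (map (\<lambda>x. if is_D a x then D_size x else 0) xs)"

lemma size_simps [simp]:
  "nLT [] = 0" "nLT (x # xs) = (if is_LT x then 1 else 0) + nLT xs"
  "nL [] = 0" "nL (x # xs) = (if is_L x then 1 else 0) + nL xs"
  "tLT [] = 0" "tLT (x # xs) = LT_size x + tLT xs"
  "tL [] = 0" "tL (x # xs) = L_size x + tL xs"
  "tD [] = 0" "tD (x # xs) = D_size x + tD xs"
  "reg a [] = 0" "reg a (x # xs) = (if is_D a x then D_size x else 0) + reg a xs"
  by (simp_all add: nLT_def nL_def tLT_def tL_def tD_def reg_def)

text \<open>Truncation can only increase \<open>k + 1 - m\<close>; there is equality as soon as no
  size exceeds \<open>k + 1\<close>, which is the next lemma.\<close>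

lemma inv_LT_lower: "(k + 1) * nLT xs \<le> inv_LT k xs + tLT xs"
proof (induction xs)
  case (Cons x xs)
  then show ?case by (cases x) auto
qed simp

lemma inv_LT_eq: "(\<And>m. LT m \<in> set xs \<Longrightarrow> m \<le> k + 1) \<Longrightarrow> inv_LT k xs + tLT xs = (k + 1) * nLT xs"
proof (induction xs)
  case (Cons x xs)
  have IH: "inv_LT k xs + tLT xs = (k + 1) * nLT xs" using Cons.prems by (intro Cons.IH) auto
  have "LT_size x \<le> k + 1" using Cons.prems by (cases x) auto
  then show ?case using IH by (cases x) auto
qed simp

lemma inv_LT_add: "inv_LT (j + d) xs \<le> inv_LT j xs + d * nLT xs"
proof (induction xs)
  case (Cons x xs)
  then show ?case by (cases x) auto
qed simp

lemma inv_L_lower: "(k + 1) * nL xs \<le> inv_L k xs + tL xs"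
proof (induction xs)
  case (Cons x xs)
  then show ?case by (cases x) auto
qed simp

lemma inv_L_eq: "(\<And>m. L m \<in> set xs \<Longrightarrow> m \<le> k + 1) \<Longrightarrow> inv_L k xs + tL xs = (k + 1) * nL xs"
proof (induction xs)
  case (Cons x xs)
  have IH: "inv_L k xs + tL xs = (k + 1) * nL xs" using Cons.prems by (intro Cons.IH) auto
  have "L_size x \<le> k + 1" using Cons.prems by (cases x) auto
  then show ?case using IH by (cases x) auto
qed simp

lemma inv_L_add: "inv_L (j + d) xs \<le> inv_L j xs + d * nL xs"
proof (induction xs)
  case (Cons x xs)
  then show ?case by (cases x) auto
qed simp

lemma inv_D_upper: "inv_D a k xs \<le> k * nL xs + reg a xs"
proof (induction xs)
  case (Cons x xs)
  then show ?case by (cases x) auto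
qed simp

lemma inv_D_eq: "(\<And>l. D a l \<in> set xs \<Longrightarrow> l \<le> k) \<Longrightarrow> inv_D a k xs = k * nL xs + reg a xs"
proof (induction xs)
  case (Cons x xs)
  have IH: "inv_D a k xs = k * nL xs + reg a xs" using Cons.prems by (intro Cons.IH) auto
  have "is_D a x \<Longrightarrow> D_size x \<le> k" using Cons.prems by (cases x) auto
  then show ?case using IH by (cases x) auto
qed simp

lemma row_count_sizes: "\<forall>x \<in> set xs. valid_summand x \<Longrightarrow> row_count xs + nL xs = tLT xs + tD xs + tL xs"
proof (induction xs)
  case (Cons x xs)
  then show ?case by (cases x) auto
qed simp

lemma tD_sum_reg:
  assumes "finite S" "\<And>a k. D a k \<in> set xs \<Longrightarrow> a \<in> S"
  shows "tD xs = (\<Sum>a\<in>S. reg a xs)"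
  using assms(2)
proof (induction xs)
  case (Cons x xs)
  have IH: "tD xs = (\<Sum>a\<in>S. reg a xs)" using Cons.prems by (intro Cons.IH) auto
  have "D_size x = (\<Sum>a\<in>S. if is_D a x then D_size x else 0)"
  proof (cases x)
    case (D b k)
    then have "b \<in> S" using Cons.prems by auto
    then show ?thesis using D assms(1) by simp
  qed simp_all
  then show ?case using IH by (simp add: sum.distrib)
qed simp

lemma size_le_counts:
  "x \<in> set xs \<Longrightarrow> valid_summand x \<Longrightarrow> LT_size x \<le> row_count xs \<and> L_size x \<le> col_count xs \<and> D_size x \<le> row_count xs"
proof (induction xs)
  case (Cons y ys)
  then show ?case by (cases "x = y"; cases x) auto
qed simp

text \<open>As a function of \<open>k\<close>, the truncated \<open>k + 1 - m\<close> is a ramp with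
  its kink at \<open>m - 1\<close>. The second difference of \<open>inv_LT\<close> therefore counts
  the summands of one size.\<close>

lemma count_LT:
  assumes "\<forall>x \<in> set xs. valid_summand x"
  shows "count (mset xs) (LT 1) = inv_LT 1 xs" "inv_LT 0 xs = 0"
    and "count (mset xs) (LT (k + 2)) + 2 * inv_LT (k + 1) xs = inv_LT (k + 2) xs + inv_LT k xs"
  using assms
proof (induction xs)
  case (Cons x xs)
  { case 1 then show ?case using Cons.IH(1) by (cases x) auto }
  { case 2 then show ?case using Cons.IH(2) by (cases x) auto }
  { case 3 then show ?case using Cons.IH(3) by (cases x) auto }
qed simp_all

lemma count_L:
  assumes "\<forall>x \<in> set xs. valid_summand x"
  shows "count (mset xs) (L 1) = inv_L 1 xs" "inv_L 0 xs = 0"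
    and "count (mset xs) (L (k + 2)) + 2 * inv_L (k + 1) xs = inv_L (k + 2) xs + inv_L k xs"
  using assms
proof (induction xs)
  case (Cons x xs)
  { case 1 then show ?case using Cons.IH(1) by (cases x) auto }
  { case 2 then show ?case using Cons.IH(2) by (cases x) auto }
  { case 3 then show ?case using Cons.IH(3) by (cases x) auto }
qed simp_all

lemma inv_D_zero: "inv_D a 0 xs = 0"
proof (induction xs)
  case (Cons x xs)
  then show ?case by (cases x) auto
qed simp

text \<open>The increment of \<open>inv_D a\<close> from \<open>j - 1\<close> to \<open>j\<close> is
  the number of blocks at \<open>a\<close> of size at least \<open>j\<close>, plus the number of
  \<open>L\<close> summands. The increments at \<open>u\<close> and at \<open>v + 1\<close> differ
  by the number of blocks with sizes from \<open>u\<close> to \<open>v\<close>.\<close>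

lemma count_D:
  assumes "1 \<le> u" "u \<le> v"
  shows "length (filter (\<lambda>x. is_D a x \<and> u \<le> D_size x \<and> D_size x \<le> v) xs) + inv_D a (v + 1) xs + inv_D a (u - 1) xs
    = inv_D a v xs + inv_D a u xs"
proof (induction xs)
  case (Cons x xs)
  show ?case
  proof (cases x)
    case (D b l)
    have "(if u \<le> l \<and> l \<le> v then 1 else 0) + min (v + 1) l + min (u - 1) l = min v l + min u l"
      using assms by (cases "u \<le> l"; cases "l \<le> v") (auto simp: min_def)
    then show ?thesis using Cons.IH D by (cases "b = a"; cases "u \<le> l"; cases "l \<le> v") auto
  next
    case (L n)
    then show ?thesis using Cons.IH assms by simp
  qed (use Cons in simp)
qed simp

lemma count_D_filter:
  assumes "\<forall>x \<in> set xs. valid_summand x" "1 \<le> k"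
  shows "count (mset xs) (D a k) + inv_D a (k + 1) xs + inv_D a (k - 1) xs = 2 * inv_D a k xs"
proof -
  have "count (mset xs) (D a k) = length (filter (\<lambda>x. is_D a x \<and> k \<le> D_size x \<and> D_size x \<le> k) xs)"
  proof (induction xs)
    case (Cons x xs)
    then show ?case by (cases x) auto
  qed simp
  then show ?thesis using count_D[of k k a xs] assms(2) by simp
qed

lemma mset_eq_of_inv:
  assumes xs: "\<forall>x \<in> set xs. valid_summand x" and ys: "\<forall>x \<in> set ys. valid_summand x"
    and LT: "\<And>k. inv_LT k xs = inv_LT k ys" and L: "\<And>k. inv_L k xs = inv_L k ys"
    and D: "\<And>a k. inv_D a k xs = inv_D a k ys"
  shows "mset xs = mset ys"
proof (rule multiset_eqI)
  fix x
  have inval: "count (mset zs) x = 0" if "\<not> valid_summand x" "\<forall>x \<in> set zs. valid_summand x" for zs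
    using that by (auto simp: count_eq_zero_iff)
  consider "\<not> valid_summand x" | "x = LT 1" | k where "x = LT (k + 2)" | "x = L 1" | k where "x = L (k + 2)"
    | a k where "x = D a k" "1 \<le> k"
  proof (cases x)
    case (LT m)
    then show thesis using that(1,2) that(3)[of "m - 2"] by (cases "m = 0"; cases "m = 1") auto
  next
    case (L m)
    then show thesis using that(1,4) that(5)[of "m - 2"] by (cases "m = 0"; cases "m = 1") auto
  next
    case (D a k)
    then show thesis using that(1) that(6)[of a k] by (cases "k = 0") auto
  qed
  then show "count (mset xs) x = count (mset ys) x"
  proof cases
    case 1
    show ?thesis unfolding inval[OF 1 xs] inval[OF 1 ys] ..
  next
    case 2
    then show ?thesis using count_LT(1)[OF xs] count_LT(1)[OF ys] LT by simp
  next
    case (3 k)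
    then show ?thesis using count_LT(3)[OF xs, of k] count_LT(3)[OF ys, of k] LT by simp
  next
    case 4
    then show ?thesis using count_L(1)[OF xs] count_L(1)[OF ys] L by simp
  next
    case (5 k)
    then show ?thesis using count_L(3)[OF xs, of k] count_L(3)[OF ys, of k] L by simp
  next
    case (6 a k)
    then show ?thesis using count_D_filter[OF xs 6(2), of a] count_D_filter[OF ys 6(2), of a] D by simp
  qed
qed

text \<open>A summand \<open>D p 0\<close> in the result of a move is empty; it is discarded when the move is carried out.\<close>

inductive move :: "summand \<Rightarrow> summand \<Rightarrow> summand list \<Rightarrow> bool" where
  LT_LT: "1 \<le> a \<Longrightarrow> a < b \<Longrightarrow> move (LT a) (LT (Suc b)) [LT (Suc a), LT b]"
| L_L: "1 \<le> a \<Longrightarrow> a < b \<Longrightarrow> move (L (Suc b)) (L a) [L (Suc a), L b]"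
| LT_D: "1 \<le> m \<Longrightarrow> move (LT m) (D p (Suc k)) [LT (Suc m), D p k]"
| D_L: "1 \<le> n \<Longrightarrow> move (D p (Suc k)) (L n) [L (Suc n), D p k]"
| D_D: "Suc l \<le> k \<Longrightarrow> move (D p (Suc l)) (D p k) [D p (Suc k), D p l]"
| LT_L: "1 \<le> m \<Longrightarrow> 1 \<le> n \<Longrightarrow> distinct (map fst es) \<Longrightarrow> \<forall>(p, k) \<in> set es. 1 \<le> k \<Longrightarrow>
    sum_list (map snd es) = m + n - 1 \<Longrightarrow> move (LT m) (L n) (D_list es)"

lemma move_extension: "move a b zs \<Longrightarrow> sum_extension a b zs"
proof (induction rule: move.induct)
  case (LT_LT a b)
  then show ?case by (simp add: LT_LT_extension)
next
  case (L_L a b)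
  then show ?case using sum_extension_dual[OF LT_LT_extension[of a b]] by simp
next
  case (LT_D m p k)
  then show ?case by (rule LT_D_extension)
next
  case (D_L n p k)
  then show ?case using sum_extension_dual[OF LT_D_extension[of n p k]] by simp
next
  case (D_D l k p)
  then show ?case by (simp add: D_D_extension)
next
  case (LT_L m n es)
  then show ?case by (rule LT_L_extension)
qed

section \<open>Runs of strict inequality between the invariants, and the moves they allow\<close>

lemma first_run:
  fixes P :: "nat \<Rightarrow> bool"
  assumes "\<not> P 0" "P k"
  shows "\<exists>u\<ge>1. \<not> P (u - 1) \<and> P u \<and> ((\<forall>i\<ge>u. P i) \<or> (\<exists>v\<ge>u. (\<forall>i. u \<le> i \<and> i \<le> v \<longrightarrow> P i) \<and> \<not> P (v + 1)))"
proof -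
  obtain w where w: "\<forall>i\<le>w. \<not> P i" "P (Suc w)" using ex_least_nat_less[OF assms(2,1)] by blast
  show ?thesis
  proof (intro exI[of _ "Suc w"] conjI)
    show "\<not> P (Suc w - 1)" using w(1) by simp
    show "(\<forall>i\<ge>Suc w. P i) \<or> (\<exists>v\<ge>Suc w. (\<forall>i. Suc w \<le> i \<and> i \<le> v \<longrightarrow> P i) \<and> \<not> P (v + 1))"
    proof (rule disjCI)
      let ?v = "LEAST j. \<not> P (Suc w + j)"
      assume no: "\<not> (\<exists>v\<ge>Suc w. (\<forall>i. Suc w \<le> i \<and> i \<le> v \<longrightarrow> P i) \<and> \<not> P (v + 1))"
      have all: "\<forall>i. Suc w \<le> i \<and> i \<le> Suc w + d \<longrightarrow> P i" for d
      proof (induction d)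
        case 0
        then show ?case using w(2) by (metis Nat.add_0_right order_antisym_conv)
      next
        case (Suc d)
        then have "P (Suc w + d + 1)" using no by (metis le_add1)
        then show ?case using Suc by (metis Suc_eq_plus1 add_Suc_right le_SucE)
      qed
      show "\<forall>i\<ge>Suc w. P i"
      proof (intro allI impI)
        fix i assume "Suc w \<le> i"
        then show "P i" using all[of "i - Suc w"] by simp
      qed
    qed
  qed (use w in simp_all)
qed

lemma bounded_has_greatest:
  fixes P :: "nat \<Rightarrow> bool"
  assumes "P r" "\<And>s. P s \<Longrightarrow> s \<le> b"
  shows "\<exists>r. P r \<and> (\<forall>s. P s \<longrightarrow> s \<le> r)"
  using GreatestI_nat[of P r b] Greatest_le_nat[of P _ b] assms by (intro exI[of _ "Greatest P"]) simp

text \<open>After replacing \<open>a\<close>, \<open>b\<close> by \<open>zs\<close> the invariants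
  still dominate those of \<open>ys\<close>; the inequalities are written additively to stay clear
  of truncated subtraction.\<close>

definition admissible :: "summand list \<Rightarrow> summand list \<Rightarrow> summand \<Rightarrow> summand \<Rightarrow> summand list \<Rightarrow> bool" where
  "admissible xs ys a b zs \<longleftrightarrow> move a b zs \<and> {#a, b#} \<subseteq># mset xs \<and>
     (\<forall>k. inv_LT k ys + inv_LT k [a, b] \<le> inv_LT k xs + inv_LT k zs) \<and>
     (\<forall>k. inv_L k ys + inv_L k [a, b] \<le> inv_L k xs + inv_L k zs) \<and>
     (\<forall>p k. inv_D p k ys + inv_D p k [a, b] \<le> inv_D p k xs + inv_D p k zs)"

lemma two_elements: "a \<in> set xs \<Longrightarrow> b \<in> set xs \<Longrightarrow> a \<noteq> b \<Longrightarrow> {#a, b#} \<subseteq># mset xs"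
  by (simp add: insert_subset_eq_iff in_diff_count)

locale invariant_gap =
  fixes xs ys :: "summand list"
  assumes val_xs: "\<forall>x \<in> set xs. valid_summand x" and val_ys: "\<forall>x \<in> set ys. valid_summand x"
    and rows: "row_count ys = row_count xs" and cols: "col_count ys = col_count xs"
    and ge: "inv_ge xs ys"
begin

abbreviation "gap_LT k \<equiv> inv_LT k ys < inv_LT k xs"
abbreviation "gap_L k \<equiv> inv_L k ys < inv_L k xs"
abbreviation "gap_D p k \<equiv> inv_D p k ys < inv_D p k xs"

lemma ge_LT: "inv_LT k ys \<le> inv_LT k xs" and ge_L: "inv_L k ys \<le> inv_L k xs"
  and ge_D: "inv_D p k ys \<le> inv_D p k xs"
  using ge by (simp_all add: inv_ge_def)

text \<open>Where a run of gaps begins, the difference of the invariants bends upwards, so its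
  second difference is positive. By \<open>count_LT\<close>, \<open>xs\<close> then has more
  summands of that size than \<open>ys\<close>, hence at least one.\<close>

lemma LT_first:
  assumes "1 \<le> u" "\<not> gap_LT (u - 1)" "gap_LT u"
  shows "LT u \<in> set xs"
proof -
  have "0 < count (mset xs) (LT u)"
  proof (cases "u = 1")
    case True
    then show ?thesis using assms(3) unfolding True count_LT(1)[OF val_xs] by simp
  next
    case False
    define w where "w = u - 2"
    have u: "u = w + 2" "u - 1 = w + 1" using False assms(1) by (simp_all add: w_def)
    show ?thesis using assms(2)[unfolded u(2)] assms(3)[unfolded u(1)] count_LT(3)[OF val_xs, of w]
        count_LT(3)[OF val_ys, of w] ge_LT[of w] ge_LT[of "w + 1"] unfolding u(1) by linarith
  qed
  then show ?thesis using count_eq_zero_iff[of "mset xs" "LT u"] by force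
qed

text \<open>Where a run ends, the difference falls to zero and cannot fall further, so it bends
  upwards again, with the kink at \<open>v + 1\<close>.\<close>

lemma LT_last:
  assumes "gap_LT v" "\<not> gap_LT (v + 1)"
  shows "LT (v + 2) \<in> set xs"
proof -
  have "0 < count (mset xs) (LT (v + 2))"
    using assms count_LT(3)[OF val_xs, of v] count_LT(3)[OF val_ys, of v] ge_LT[of "v + 2"]
        ge_LT[of "v + 1"] by linarith
  then show ?thesis using count_eq_zero_iff[of "mset xs" "LT (v + 2)"] by force
qed

lemma L_first:
  assumes "1 \<le> u" "\<not> gap_L (u - 1)" "gap_L u"
  shows "L u \<in> set xs"
proof -
  have "0 < count (mset xs) (L u)"
  proof (cases "u = 1")
    case True
    then show ?thesis using assms(3) unfolding True count_L(1)[OF val_xs] by simp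
  next
    case False
    define w where "w = u - 2"
    have u: "u = w + 2" "u - 1 = w + 1" using False assms(1) by (simp_all add: w_def)
    show ?thesis using assms(2)[unfolded u(2)] assms(3)[unfolded u(1)] count_L(3)[OF val_xs, of w]
        count_L(3)[OF val_ys, of w] ge_L[of w] ge_L[of "w + 1"] unfolding u(1) by linarith
  qed
  then show ?thesis using count_eq_zero_iff[of "mset xs" "L u"] by force
qed

lemma L_last:
  assumes "gap_L v" "\<not> gap_L (v + 1)"
  shows "L (v + 2) \<in> set xs"
proof -
  have "0 < count (mset xs) (L (v + 2))"
    using assms count_L(3)[OF val_xs, of v] count_L(3)[OF val_ys, of v] ge_L[of "v + 2"]
        ge_L[of "v + 1"] by linarith
  then show ?thesis using count_eq_zero_iff[of "mset xs" "L (v + 2)"] by force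
qed

text \<open>Enlarging \<open>LT u\<close> lowers \<open>inv_LT\<close> by one for all
  \<open>k\<close> from \<open>u\<close> on, and shrinking the other summand restores it from
  \<open>v + 1\<close> on. The net loss lies exactly on the run.\<close>

lemma LT_LT_admissible:
  assumes "1 \<le> u" "u \<le> v" "LT u \<in> set xs" "LT (v + 2) \<in> set xs" "\<forall>i. u \<le> i \<and> i \<le> v \<longrightarrow> gap_LT i"
  shows "admissible xs ys (LT u) (LT (Suc (v + 1))) [LT (Suc u), LT (v + 1)]"
  unfolding admissible_def
proof (intro conjI allI)
  show "move (LT u) (LT (Suc (v + 1))) [LT (Suc u), LT (v + 1)]" using assms(1,2) by (intro move.LT_LT) auto
  show "{#LT u, LT (Suc (v + 1))#} \<subseteq># mset xs" using assms by (intro two_elements) auto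
  fix k
  show "inv_LT k ys + inv_LT k [LT u, LT (Suc (v + 1))] \<le> inv_LT k xs + inv_LT k [LT (Suc u), LT (v + 1)]"
    using assms(2) assms(5)[rule_format, of k] ge_LT[of k] by (cases "u \<le> k"; cases "k \<le> v") simp_all
qed (simp_all add: ge_L ge_D)

lemma L_L_admissible:
  assumes "1 \<le> u" "u \<le> v" "L u \<in> set xs" "L (v + 2) \<in> set xs" "\<forall>i. u \<le> i \<and> i \<le> v \<longrightarrow> gap_L i"
  shows "admissible xs ys (L (Suc (v + 1))) (L u) [L (Suc u), L (v + 1)]"
  unfolding admissible_def
proof (intro conjI allI)
  show "move (L (Suc (v + 1))) (L u) [L (Suc u), L (v + 1)]" using assms(1,2) by (intro move.L_L) auto
  show "{#L (Suc (v + 1)), L u#} \<subseteq># mset xs" using assms by (intro two_elements) auto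
  fix k
  show "inv_L k ys + inv_L k [L (Suc (v + 1)), L u] \<le> inv_L k xs + inv_L k [L (Suc u), L (v + 1)]"
    using assms(2) assms(5)[rule_format, of k] ge_L[of k] by (cases "u \<le> k"; cases "k \<le> v") simp_all
qed (simp_all add: ge_LT ge_D)

lemma shrink_D:
  assumes "\<forall>i\<ge>Suc r. gap_D p i"
  shows "inv_D q k ys + D_num q k (D p (Suc r)) \<le> inv_D q k xs + D_num q k (D p r)"
  using assms[rule_format, of k] ge_D[of q k] by (cases "q = p"; cases "Suc r \<le> k") auto

text \<open>Enlarging \<open>LT m\<close> lowers \<open>inv_LT\<close> for all \<open>k\<close> from
  \<open>m\<close> on, and shrinking the block lowers \<open>inv_D p\<close> from
  \<open>Suc r\<close> on. Neither loss is ever made up, so both gaps have to be endless.\<close>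

lemma LT_D_admissible:
  assumes "1 \<le> m" "LT m \<in> set xs" "\<forall>i\<ge>m. gap_LT i" "D p (Suc r) \<in> set xs" "\<forall>i\<ge>Suc r. gap_D p i"
  shows "admissible xs ys (LT m) (D p (Suc r)) [LT (Suc m), D p r]"
  unfolding admissible_def
proof (intro conjI allI)
  show "move (LT m) (D p (Suc r)) [LT (Suc m), D p r]" using assms(1) by (rule move.LT_D)
  show "{#LT m, D p (Suc r)#} \<subseteq># mset xs" using assms by (intro two_elements) auto
  fix q k
  show "inv_LT k ys + inv_LT k [LT m, D p (Suc r)] \<le> inv_LT k xs + inv_LT k [LT (Suc m), D p r]"
    using assms(3)[rule_format, of k] ge_LT[of k] by (cases "m \<le> k") simp_all
  show "inv_D q k ys + inv_D q k [LT m, D p (Suc r)] \<le> inv_D q k xs + inv_D q k [LT (Suc m), D p r]"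
    using shrink_D[OF assms(5), of q k] by simp
qed (simp add: ge_L)

lemma D_L_admissible:
  assumes "1 \<le> m" "L m \<in> set xs" "\<forall>i\<ge>m. gap_L i" "D p (Suc r) \<in> set xs" "\<forall>i\<ge>Suc r. gap_D p i"
  shows "admissible xs ys (D p (Suc r)) (L m) [L (Suc m), D p r]"
  unfolding admissible_def
proof (intro conjI allI)
  show "move (D p (Suc r)) (L m) [L (Suc m), D p r]" using assms(1) by (rule move.D_L)
  show "{#D p (Suc r), L m#} \<subseteq># mset xs" using assms by (intro two_elements) auto
  fix q k
  show "inv_L k ys + inv_L k [D p (Suc r), L m] \<le> inv_L k xs + inv_L k [L (Suc m), D p r]"
    using assms(3)[rule_format, of k] ge_L[of k] by (cases "m \<le> k") simp_all
  show "inv_D q k ys + inv_D q k [D p (Suc r), L m] \<le> inv_D q k xs + inv_D q k [L (Suc m), D p r]"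
    using shrink_D[OF assms(5), of q k] by simp
qed (simp add: ge_LT)

text \<open>Shrinking the smaller block costs one from \<open>Suc r\<close> on, and enlarging the
  other one returns it from \<open>s + 1\<close> on, so only sizes between the two blocks are
  affected.\<close>

lemma D_D_admissible:
  assumes "Suc r \<le> s" "{#D p (Suc r), D p s#} \<subseteq># mset xs" "\<forall>i. Suc r \<le> i \<and> i \<le> s \<longrightarrow> gap_D p i"
  shows "admissible xs ys (D p (Suc r)) (D p s) [D p (Suc s), D p r]"
  unfolding admissible_def
proof (intro conjI allI)
  show "move (D p (Suc r)) (D p s) [D p (Suc s), D p r]" using assms(1) by (rule move.D_D)
  show "{#D p (Suc r), D p s#} \<subseteq># mset xs" by (rule assms)
  fix q k
  show "inv_D q k ys + inv_D q k [D p (Suc r), D p s] \<le> inv_D q k xs + inv_D q k [D p (Suc s), D p r]"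
    using assms(1) assms(3)[rule_format, of k] ge_D[of q k] by (cases "q = p"; cases "Suc r \<le> k"; cases "k \<le> s") auto
qed (simp_all add: ge_LT ge_L)

definition "bound = row_count xs + col_count xs"

lemma size_bound:
  "LT m \<in> set xs \<Longrightarrow> m \<le> bound" "LT m \<in> set ys \<Longrightarrow> m \<le> bound"
  "L n \<in> set xs \<Longrightarrow> n \<le> bound" "L n \<in> set ys \<Longrightarrow> n \<le> bound"
  "D p k \<in> set xs \<Longrightarrow> k \<le> bound" "D p k \<in> set ys \<Longrightarrow> k \<le> bound"
  using size_le_counts[of _ xs] size_le_counts[of _ ys] val_xs val_ys rows cols
  by (fastforce simp: bound_def)+

lemma large_LT:
  assumes "bound \<le> k"
  shows "inv_LT k xs + tLT xs = (k + 1) * nLT xs" "inv_LT k ys + tLT ys = (k + 1) * nLT ys"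
   by (rule inv_LT_eq, drule size_bound, use assms in linarith)+

lemma large_L:
  assumes "bound \<le> k"
  shows "inv_L k xs + tL xs = (k + 1) * nL xs" "inv_L k ys + tL ys = (k + 1) * nL ys"
   by (rule inv_L_eq, drule size_bound, use assms in linarith)+

lemma large_D:
  assumes "bound \<le> k"
  shows "inv_D p k xs = k * nL xs + reg p xs" "inv_D p k ys = k * nL ys + reg p ys"
   by (rule inv_D_eq, drule size_bound, use assms in linarith)+

text \<open>For large \<open>k\<close> the invariant grows with slope \<open>nLT\<close>, so the
  dominated sum cannot have the larger slope.\<close>

lemma nLT_ge: "nLT ys \<le> nLT xs"
proof (rule ccontr)
  assume "\<not> ?thesis"
  then have c: "nLT xs + 1 \<le> nLT ys" by simp
  let ?k = "bound + tLT ys"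
  have "(?k + 1) * (nLT xs + 1) \<le> (?k + 1) * nLT ys" using c by (rule mult_le_mono2)
  then show False using large_LT[of ?k] ge_LT[of ?k] by simp
qed

lemma defect: "nLT xs + nL ys = nLT ys + nL xs"
  using row_col_defect[OF val_xs] row_col_defect[OF val_ys] rows cols by (simp add: nLT_def nL_def)

lemma sizes: "row_count xs + nL xs = tLT xs + tD xs + tL xs" "row_count xs + nL ys = tLT ys + tD ys + tL ys"
  using row_count_sizes[OF val_xs] row_count_sizes[OF val_ys] rows by simp_all

text \<open>From a suitable \<open>k\<close> on, \<open>inv_D p\<close> of \<open>xs\<close> is
  affine with slope \<open>nL xs\<close>, while that of \<open>ys\<close> stays below its line with
  slope \<open>nL ys\<close>; \<Delta> is the difference of the slopes. Equality of the invariants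
  at \<open>k\<close> compares the constant terms. The second inequality is the form in which the
  sizes of new Jordan blocks are estimated.\<close>

lemma no_tail:
  assumes nt: "\<And>r. D p r \<in> set xs \<Longrightarrow> \<exists>k\<ge>r. \<not> gap_D p k" and delta: "nL xs = nL ys + \<Delta>"
  shows "reg p xs \<le> reg p ys" "reg p xs + \<Delta> * l \<le> reg p ys + \<Delta> * (inv_D p l xs - inv_D p l ys)"
proof -
  \<comment> \<open>A place without gap at or beyond the largest block of \<open>xs\<close> for
    \<open>p\<close>; without any such block, \<open>k = 0\<close> serves, where all
    \<open>inv_D\<close> vanish.\<close>
  obtain k where k: "\<And>r. D p r \<in> set xs \<Longrightarrow> r \<le> k" "\<not> gap_D p k"
  proof (cases "\<exists>r. D p r \<in> set xs")
    case True
    then obtain q where q: "D p q \<in> set xs" by (rule exE)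
    have "\<exists>r. D p r \<in> set xs \<and> (\<forall>s. D p s \<in> set xs \<longrightarrow> s \<le> r)"
      by (rule bounded_has_greatest[where P = "\<lambda>r. D p r \<in> set xs", OF q]) (rule size_bound(5))
    then obtain r where r: "D p r \<in> set xs" "\<forall>s. D p s \<in> set xs \<longrightarrow> s \<le> r" by (elim exE conjE)
    obtain k where k: "r \<le> k" "\<not> gap_D p k" using nt[OF r(1)] by (elim exE conjE)
    show ?thesis
    proof (rule that)
      show "s \<le> k" if "D p s \<in> set xs" for s using r(2)[rule_format, OF that] k(1) by linarith
    qed (rule k(2))
  next
    case False
    then show ?thesis using that[of 0] by (simp add: inv_D_zero)
  qed
  have x: "inv_D p j xs = j * nL xs + reg p xs" if "k \<le> j" for j
    by (rule inv_D_eq, drule k(1)) (use that in linarith)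
  have y: "inv_D p j ys \<le> j * nL ys + reg p ys" for j by (rule inv_D_upper)
  have *: "reg p xs + \<Delta> * k \<le> reg p ys"
    using x[of k] y[of k] k(2) by (simp add: delta algebra_simps)
  then show "reg p xs \<le> reg p ys" by simp
  show "reg p xs + \<Delta> * l \<le> reg p ys + \<Delta> * (inv_D p l xs - inv_D p l ys)"
  proof (cases "l \<le> k")
    case True
    then have "\<Delta> * l \<le> \<Delta> * k" by simp
    then show ?thesis using * by linarith
  next
    case False
    show ?thesis
    proof (cases "\<Delta> = 0")
      case True
      then show ?thesis using * by simp
    next
      case nz: False
      have "reg p xs + \<Delta> * l \<le> reg p ys + (inv_D p l xs - inv_D p l ys)"
        using x[of l] y[of l] False ge_D[of p l] by (simp add: delta algebra_simps)
      also have "\<dots> \<le> reg p ys + \<Delta> * (inv_D p l xs - inv_D p l ys)" using nz by simp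
      finally show ?thesis .
    qed
  qed
qed

end

abbreviation D_family :: "(ext_complex \<Rightarrow> nat) \<Rightarrow> ext_complex list \<Rightarrow> (ext_complex \<times> nat) list" where
  "D_family \<kappa> ps \<equiv> map (\<lambda>p. (p, \<kappa> p)) (filter (\<lambda>p. 1 \<le> \<kappa> p) ps)"

lemma D_family_inv:
  "distinct ps \<Longrightarrow> inv_D a k (D_list (D_family \<kappa> ps)) = (if a \<in> set ps then min k (\<kappa> a) else 0)"
  by (induction ps) auto

lemma D_family_sum: "sum_list (map snd (D_family \<kappa> ps)) = sum_list (map \<kappa> ps)"
  by (induction ps) auto

lemma D_list_inv: "inv_LT k (D_list es) = 0" "inv_L k (D_list es) = 0"
  by (induction es) auto

context invariant_gap
begin

text \<open>\<open>Finite 0\<close> is always included, so that there is a point to take the surplus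
  size in \<open>LT_L_admissible\<close>.\<close>

definition "D_points = insert (Finite 0) {p. \<exists>k. D p k \<in> set xs \<union> set ys}"

lemma finite_D_points: "finite D_points"
proof -
  have "{p. \<exists>k. D p k \<in> set xs \<union> set ys} \<subseteq> (\<lambda>x. case x of D p k \<Rightarrow> p | _ \<Rightarrow> Finite 0) ` (set xs \<union> set ys)"
    by (force intro: image_eqI)
  then show ?thesis unfolding D_points_def by (simp add: finite_subset)
qed

lemma tD_eq: "tD xs = (\<Sum>p\<in>D_points. reg p xs)" "tD ys = (\<Sum>p\<in>D_points. reg p ys)"
proof -
  show "tD xs = (\<Sum>p\<in>D_points. reg p xs)"
    by (rule tD_sum_reg[OF finite_D_points]) (auto simp: D_points_def)
  show "tD ys = (\<Sum>p\<in>D_points. reg p ys)"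
    by (rule tD_sum_reg[OF finite_D_points]) (auto simp: D_points_def)
qed

lemma reg_outside: "p \<notin> D_points \<Longrightarrow> reg p xs = 0" "p \<notin> D_points \<Longrightarrow> reg p ys = 0"
  unfolding D_points_def reg_def by (auto simp: sum_list_eq_0_iff elim!: is_D.elims)

text \<open>The largest \<open>LT m\<close> and \<open>L n\<close> are removed. Their loss begins
  only where \<open>inv_LT\<close> and \<open>inv_L\<close> of \<open>xs\<close> are already affine,
  with slopes larger by \<Delta> than the bounds for \<open>ys\<close>, and so it is covered. In
  \<open>inv_D p\<close> the loss of \<open>L n\<close> is \<open>k\<close>; what the gap does not
  cover is at most \<open>reg p ys - reg p xs\<close> divided by \<Delta>, and a new block at
  \<open>p\<close> of this size makes up for it.\<close>

lemma LT_L_admissible: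
  assumes nt: "\<And>p r. D p r \<in> set xs \<Longrightarrow> \<exists>k\<ge>r. \<not> gap_D p k"
    and delta: "nL xs = nL ys + \<Delta>" "nLT xs = nLT ys + \<Delta>" "1 \<le> \<Delta>"
  shows "\<exists>m n zs. admissible xs ys (LT m) (L n) zs"
proof -
  have "\<exists>m. LT m \<in> set xs"
  proof -
    have "nLT xs \<noteq> 0" using delta by linarith
    then have "filter is_LT xs \<noteq> []" unfolding nLT_def by (rule contrapos_nn) simp
    then obtain x where x: "x \<in> set xs" "is_LT x" unfolding filter_empty_conv by blast
    from x(2) obtain m where "x = LT m" by (cases x) simp_all
    with x(1) have "LT m \<in> set xs" by simp
    then show ?thesis by (rule exI)
  qed
  then obtain m0 where m0: "LT m0 \<in> set xs" by (rule exE)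
  have "\<exists>m. LT m \<in> set xs \<and> (\<forall>m'. LT m' \<in> set xs \<longrightarrow> m' \<le> m)"
    by (rule bounded_has_greatest[where P = "\<lambda>r. LT r \<in> set xs", OF m0]) (rule size_bound(1))
  then obtain m where m: "LT m \<in> set xs" "\<forall>m'. LT m' \<in> set xs \<longrightarrow> m' \<le> m" by (elim exE conjE)
  have "\<exists>n. L n \<in> set xs"
  proof -
    have "nL xs \<noteq> 0" using delta by linarith
    then have "filter is_L xs \<noteq> []" unfolding nL_def by (rule contrapos_nn) simp
    then obtain x where x: "x \<in> set xs" "is_L x" unfolding filter_empty_conv by blast
    from x(2) obtain m where "x = L m" by (cases x) simp_all
    with x(1) have "L m \<in> set xs" by simp
    then show ?thesis by (rule exI)
  qed
  then obtain n0 where n0: "L n0 \<in> set xs" by (rule exE)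
  have "\<exists>n. L n \<in> set xs \<and> (\<forall>n'. L n' \<in> set xs \<longrightarrow> n' \<le> n)"
    by (rule bounded_has_greatest[where P = "\<lambda>r. L r \<in> set xs", OF n0]) (rule size_bound(3))
  then obtain n where n: "L n \<in> set xs" "\<forall>n'. L n' \<in> set xs \<longrightarrow> n' \<le> n" by (elim exE conjE)
  have m1: "1 \<le> m" and n1: "1 \<le> n" using bspec[OF val_xs m(1)] bspec[OF val_xs n(1)] by simp_all
  have LTx: "inv_LT k xs + tLT xs = (k + 1) * nLT xs" if "m \<le> k + 1" for k
    by (rule inv_LT_eq, drule m(2)[rule_format]) (use that in linarith)
  have Lx: "inv_L k xs + tL xs = (k + 1) * nL xs" if "n \<le> k + 1" for k
    by (rule inv_L_eq, drule n(2)[rule_format]) (use that in linarith)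
  have tLT_le: "tLT xs \<le> tLT ys + m * \<Delta>"
    using LTx[of "m - 1"] inv_LT_lower[of "m - 1" ys] ge_LT[of "m - 1"] m1 delta(2) by (simp add: algebra_simps)
  have tL_le: "tL xs \<le> tL ys + n * \<Delta>"
    using Lx[of "n - 1"] inv_L_lower[of "n - 1" ys] ge_L[of "n - 1"] n1 delta(1) by (simp add: algebra_simps)
  \<comment> \<open>sizes that keep every \<open>inv_D p\<close> above that of \<open>ys\<close>, by \<open>no_tail\<close>; surplus goes to the point \<open>0\<close>\<close>
  define \<kappa>0 where "\<kappa>0 p = (reg p ys - reg p xs) div \<Delta>" for p
  let ?N = "m + n - 1"
  have "\<Delta> * (\<Sum>p\<in>D_points. \<kappa>0 p) \<le> (\<Sum>p\<in>D_points. reg p ys - reg p xs)"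
    unfolding sum_distrib_left \<kappa>0_def by (intro sum_mono) simp
  also have "\<dots> = tD ys - tD xs"
    unfolding tD_eq by (rule sum_subtractf_nat) (rule no_tail(1)[OF nt delta(1)])
  \<comment> \<open>Both sums have the same number of rows, so what \<open>ys\<close> has more in
    Jordan blocks is what \<open>xs\<close> has more in \<open>LT\<close> and \<open>L\<close>. By
    the choice of the largest sizes this is at most \<Delta> times \<open>m + n\<close>, less
    \<Delta> for the difference in \<open>nL\<close>.\<close>
  also have "\<dots> \<le> \<Delta> * ?N"
  proof -
    have "\<Delta> * ?N + \<Delta> = m * \<Delta> + n * \<Delta>" using m1 by (cases m) (simp_all add: algebra_simps)
    then show ?thesis using sizes tLT_le tL_le delta(1) by linarith
  qed
  finally have sum_le: "(\<Sum>p\<in>D_points. \<kappa>0 p) \<le> ?N" using delta(3) by simp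
  define \<kappa> where "\<kappa> = \<kappa>0(Finite 0 := \<kappa>0 (Finite 0) + (?N - (\<Sum>p\<in>D_points. \<kappa>0 p)))"
  have F0: "Finite 0 \<in> D_points" by (simp add: D_points_def)
  have "(\<Sum>p\<in>D_points. \<kappa> p) = \<kappa> (Finite 0) + (\<Sum>p\<in>D_points - {Finite 0}. \<kappa>0 p)"
    using sum.remove[OF finite_D_points F0, of \<kappa>] by (simp add: \<kappa>_def)
  also have "\<dots> = (\<Sum>p\<in>D_points. \<kappa>0 p) + (?N - (\<Sum>p\<in>D_points. \<kappa>0 p))"
    using sum.remove[OF finite_D_points F0, of \<kappa>0] by (simp add: \<kappa>_def)
  finally have sum_\<kappa>: "(\<Sum>p\<in>D_points. \<kappa> p) = ?N" using sum_le by simp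
  have \<kappa>_ge: "\<kappa>0 p \<le> \<kappa> p" for p by (simp add: \<kappa>_def)
  obtain ps where ps: "set ps = D_points" "distinct ps" using finite_distinct_list[OF finite_D_points] by blast
  define es where "es = D_family \<kappa> ps"
  have inv_es: "inv_D p k (D_list es) = min k (\<kappa> p)" for p k
  proof (cases "p \<in> D_points")
    case True
    then show ?thesis unfolding es_def D_family_inv[OF ps(2)] ps(1) by simp
  next
    case False
    have "reg p ys = 0" using False by (rule reg_outside)
    then have "\<kappa> p = 0" using False F0 by (auto simp: \<kappa>_def \<kappa>0_def)
    then show ?thesis unfolding es_def D_family_inv[OF ps(2)] ps(1) by simp
  qed
  have "admissible xs ys (LT m) (L n) (D_list es)"
    unfolding admissible_def
  proof (intro conjI allI)
    show "move (LT m) (L n) (D_list es)"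
    proof (rule move.LT_L[OF m1 n1])
      show "distinct (map fst es)" using ps(2) by (simp add: es_def o_def)
      show "\<forall>(p, k) \<in> set es. 1 \<le> k" by (auto simp: es_def)
      show "sum_list (map snd es) = m + n - 1"
        unfolding es_def D_family_sum sum_\<kappa>[symmetric] ps(1)[symmetric]
        by (rule sum_list_distinct_conv_sum_set[OF ps(2)])
    qed
    show "{#LT m, L n#} \<subseteq># mset xs" using m n by (intro two_elements) auto
    fix p k
    have "inv_LT k ys + (k + 1 - m) \<le> inv_LT k xs"
    proof (cases "m \<le> k + 1")
      case True
      define d where "d = k + 1 - m"
      have k: "k = (m - 1) + d" using True m1 by (simp add: d_def)
      have "inv_LT k ys \<le> inv_LT (m - 1) ys + d * nLT ys" unfolding k by (rule inv_LT_add)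
      moreover have "inv_LT k xs = inv_LT (m - 1) xs + d * nLT xs"
        using LTx[of k] LTx[of "m - 1"] True m1 k by (simp add: algebra_simps)
      moreover have "d \<le> d * \<Delta>" using delta(3) by simp
      moreover have "d * nLT xs = d * nLT ys + d * \<Delta>" by (simp add: delta(2) algebra_simps)
      ultimately show ?thesis using ge_LT[of "m - 1"] unfolding d_def[symmetric] by linarith
    qed (simp add: ge_LT)
    then show "inv_LT k ys + inv_LT k [LT m, L n] \<le> inv_LT k xs + inv_LT k (D_list es)" by (simp add: D_list_inv)
    have "inv_L k ys + (k + 1 - n) \<le> inv_L k xs"
    proof (cases "n \<le> k + 1")
      case True
      define d where "d = k + 1 - n"
      have k: "k = (n - 1) + d" using True n1 by (simp add: d_def)
      have "inv_L k ys \<le> inv_L (n - 1) ys + d * nL ys" unfolding k by (rule inv_L_add)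
      moreover have "inv_L k xs = inv_L (n - 1) xs + d * nL xs"
        using Lx[of k] Lx[of "n - 1"] True n1 k by (simp add: algebra_simps)
      moreover have "d \<le> d * \<Delta>" using delta(3) by simp
      moreover have "d * nL xs = d * nL ys + d * \<Delta>" by (simp add: delta(1) algebra_simps)
      ultimately show ?thesis using ge_L[of "n - 1"] unfolding d_def[symmetric] by linarith
    qed (simp add: ge_L)
    then show "inv_L k ys + inv_L k [LT m, L n] \<le> inv_L k xs + inv_L k (D_list es)" by (simp add: D_list_inv)
    have "inv_D p k ys + k \<le> inv_D p k xs + \<kappa> p"
    proof (cases "k \<le> inv_D p k xs - inv_D p k ys")
      case True
      then show ?thesis using ge_D[of p k] by linarith
    next
      case False
      let ?g = "inv_D p k xs - inv_D p k ys"
      have "\<Delta> * k = \<Delta> * (k - ?g) + \<Delta> * ?g"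
        using False by (simp add: add_mult_distrib2[symmetric])
      then have "\<Delta> * (k - ?g) \<le> reg p ys - reg p xs"
        using no_tail(2)[OF nt delta(1), of p k] by linarith
      \<comment> \<open>The rounding in \<kappa>0 does no harm, because \<open>k - ?g\<close> is an
        integer.\<close>
      then have "k - ?g \<le> \<kappa>0 p"
        unfolding \<kappa>0_def using delta(3) by (simp add: less_eq_div_iff_mult_less_eq mult.commute)
      then show ?thesis using \<kappa>_ge[of p] ge_D[of p k] by linarith
    qed
    then have "inv_D p k ys + k \<le> inv_D p k xs + min k (\<kappa> p)" using ge_D[of p k] by (simp add: min_def)
    then show "inv_D p k ys + inv_D p k [LT m, L n] \<le> inv_D p k xs + inv_D p k (D_list es)" by (simp add: inv_es)
  qed
  then show ?thesis by (intro exI)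
qed

text \<open>If the first run of gaps ended, its two ends would supply the summands for an admissible
  move between two \<open>LT\<close>. So it is endless.\<close>

lemma LT_tail:
  assumes none: "\<nexists>a b zs. admissible xs ys a b zs" and k: "gap_LT k"
  shows "\<exists>u\<ge>1. LT u \<in> set xs \<and> (\<forall>i\<ge>u. gap_LT i)"
proof -
  have "\<not> gap_LT 0" using count_LT(2)[OF val_xs] by simp
  from first_run[of gap_LT, OF this k] obtain u where u: "1 \<le> u" "\<not> gap_LT (u - 1)" "gap_LT u"
    and run: "(\<forall>i\<ge>u. gap_LT i) \<or> (\<exists>v\<ge>u. (\<forall>i. u \<le> i \<and> i \<le> v \<longrightarrow> gap_LT i) \<and> \<not> gap_LT (v + 1))"
    by (elim exE conjE)
  from run show ?thesis
  proof (elim disjE exE conjE)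
    assume "\<forall>i\<ge>u. gap_LT i"
    then show ?thesis using LT_first[OF u] u(1) by (intro exI[of _ u] conjI)
  next
    fix v assume v: "u \<le> v" "\<forall>i. u \<le> i \<and> i \<le> v \<longrightarrow> gap_LT i" "\<not> gap_LT (v + 1)"
    have "gap_LT v" using v(1,2) by simp
    from LT_LT_admissible[OF u(1) v(1) LT_first[OF u] LT_last[OF this v(3)] v(2)] none show ?thesis by simp
  qed
qed

lemma L_tail:
  assumes none: "\<nexists>a b zs. admissible xs ys a b zs" and k: "gap_L k"
  shows "\<exists>u\<ge>1. L u \<in> set xs \<and> (\<forall>i\<ge>u. gap_L i)"
proof -
  have "\<not> gap_L 0" using count_L(2)[OF val_xs] by simp
  from first_run[of gap_L, OF this k] obtain u where u: "1 \<le> u" "\<not> gap_L (u - 1)" "gap_L u"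
    and run: "(\<forall>i\<ge>u. gap_L i) \<or> (\<exists>v\<ge>u. (\<forall>i. u \<le> i \<and> i \<le> v \<longrightarrow> gap_L i) \<and> \<not> gap_L (v + 1))"
    by (elim exE conjE)
  from run show ?thesis
  proof (elim disjE exE conjE)
    assume "\<forall>i\<ge>u. gap_L i"
    then show ?thesis using L_first[OF u] u(1) by (intro exI[of _ u] conjI)
  next
    fix v assume v: "u \<le> v" "\<forall>i. u \<le> i \<and> i \<le> v \<longrightarrow> gap_L i" "\<not> gap_L (v + 1)"
    have "gap_L v" using v(1,2) by simp
    from L_L_admissible[OF u(1) v(1) L_first[OF u] L_last[OF this v(3)] v(2)] none show ?thesis by simp
  qed
qed

text \<open>By \<open>LT_tail\<close> or \<open>L_tail\<close> the given gap yields an endless one;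
  together with an endless gap from a block of \<open>xs\<close> on, it would allow a move that
  shrinks this block.\<close>

lemma no_D_tail:
  assumes none: "\<nexists>a b zs. admissible xs ys a b zs" and k: "gap_LT k \<or> gap_L k" and r: "D p r \<in> set xs"
  shows "\<exists>k\<ge>r. \<not> gap_D p k"
proof (rule ccontr)
  assume "\<not> ?thesis"
  then have gap: "\<forall>i\<ge>r. gap_D p i" by simp
  obtain r' where r': "r = Suc r'" using bspec[OF val_xs r] by (cases r) auto
  from k show False
  proof
    assume "gap_LT k"
    from LT_tail[OF none this] obtain u where "1 \<le> u" "LT u \<in> set xs" "\<forall>i\<ge>u. gap_LT i" by (elim exE conjE)
    from LT_D_admissible[OF this r[unfolded r'] gap[unfolded r']] none show False by simp
  next
    assume "gap_L k"
    from L_tail[OF none this] obtain u where "1 \<le> u" "L u \<in> set xs" "\<forall>i\<ge>u. gap_L i" by (elim exE conjE)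
    from D_L_admissible[OF this r[unfolded r'] gap[unfolded r']] none show False by simp
  qed
qed

text \<open>Equal \<open>nL\<close> and \<open>reg\<close> make the gap vanish for large
  \<open>k\<close>, so the first run ends. The gap rises by at least one on entering the run and
  falls by at least one on leaving it; by \<open>count_D\<close>, \<open>xs\<close> then has two
  blocks with sizes in the run, and these are moved apart.\<close>

lemma D_pair_admissible:
  assumes eq: "nL xs = nL ys" "reg p xs = reg p ys" and k: "gap_D p k"
  shows "\<exists>a b zs. admissible xs ys a b zs"
proof -
  have no: "\<not> gap_D p (bound + i)" for i using large_D[of "bound + i" p] eq by simp
  have "\<not> gap_D p 0" by (simp add: inv_D_zero)
  from first_run[of "gap_D p", OF this k] obtain u where u: "1 \<le> u" "\<not> gap_D p (u - 1)" "gap_D p u"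
    and run: "(\<forall>i\<ge>u. gap_D p i) \<or> (\<exists>v\<ge>u. (\<forall>i. u \<le> i \<and> i \<le> v \<longrightarrow> gap_D p i) \<and> \<not> gap_D p (v + 1))"
    by (elim exE conjE)
  have "\<not> (\<forall>i\<ge>u. gap_D p i)"
  proof
    assume "\<forall>i\<ge>u. gap_D p i"
    then have "gap_D p (bound + u)" by simp
    with no[of u] show False by (rule notE)
  qed
  with run obtain v where v: "u \<le> v" "\<forall>i. u \<le> i \<and> i \<le> v \<longrightarrow> gap_D p i" "\<not> gap_D p (v + 1)"
    by (elim disjE exE conjE) (rule notE)
  let ?f = "\<lambda>x. is_D p x \<and> u \<le> D_size x \<and> D_size x \<le> v"
  have "gap_D p v" using v(1,2) by simp
  then have "2 \<le> length (filter ?f xs)"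
    using count_D[OF u(1) v(1), of p xs] count_D[OF u(1) v(1), of p ys] u(2,3) v(3)
      ge_D[of p "u - 1"] ge_D[of p "v + 1"] by linarith
  then obtain a b cs where f: "filter ?f xs = a # b # cs"
    unfolding numeral_2_eq_2 Suc_le_length_iff by (elim exE conjE) simp
  have "a \<in> set (filter ?f xs)" "b \<in> set (filter ?f xs)" unfolding f by simp_all
  then have ab: "?f a" "?f b" by simp_all
  have "mset (filter ?f xs) \<subseteq># mset xs" by (simp add: mset_filter)
  then have "add_mset a (add_mset b (mset cs)) \<subseteq># mset xs" unfolding f by simp
  moreover have "{#a, b#} \<subseteq># add_mset a (add_mset b (mset cs))" by simp
  ultimately have sub: "{#a, b#} \<subseteq># mset xs" by (rule subset_mset.order_trans[rotated])
  obtain r where a: "a = D p r" using ab(1) by (cases a) simp_all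
  obtain s where b: "b = D p s" using ab(2) by (cases b) simp_all
  have rs: "a = D p r" "b = D p s" "u \<le> r" "r \<le> v" "u \<le> s" "s \<le> v"
    using ab unfolding a b by simp_all
  have step: "\<exists>a b zs. admissible xs ys a b zs"
    if st: "u \<le> i" "i \<le> j" "j \<le> v" "{#D p i, D p j#} \<subseteq># mset xs" for i j
  proof -
    obtain i' where i': "i = Suc i'" using u(1) st(1) by (cases i) auto
    have "\<forall>k. Suc i' \<le> k \<and> k \<le> j \<longrightarrow> gap_D p k"
    proof (intro allI impI)
      fix k assume "Suc i' \<le> k \<and> k \<le> j"
      then have "u \<le> k \<and> k \<le> v" using st(1,3) i' by linarith
      with v(2)[rule_format, of k] show "gap_D p k" by blast
    qed
    from D_D_admissible[OF st(2)[unfolded i'] st(4)[unfolded i'] this]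
    have "admissible xs ys (D p (Suc i')) (D p j) [D p (Suc j), D p i']" .
    then show ?thesis by (intro exI)
  qed
  show ?thesis
  proof (cases "r \<le> s")
    case True
    show ?thesis by (rule step[OF rs(3) True rs(6) sub[unfolded rs(1,2)]])
  next
    case False
    then have "s \<le> r" by simp
    from step[OF rs(5) this rs(4) sub[unfolded rs(1,2) add_mset_commute[of "D p r"]]] show ?thesis .
  qed
qed

text \<open>If \<open>xs\<close> has more \<open>LT\<close> than \<open>ys\<close>, there is a gap
  for large \<open>k\<close>, \<open>no_D_tail\<close> applies and a trade of \<open>LT\<close> and
  \<open>L\<close> for Jordan blocks is admissible. Otherwise, without a move, a gap in
  \<open>inv_LT\<close> or \<open>inv_L\<close> would be endless and make a total size of
  \<open>xs\<close> strictly smaller, while no other total is larger: this contradicts equal numbers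
  of rows. Hence only Jordan invariants can differ, with equal \<open>reg\<close>, and
  \<open>D_pair_admissible\<close> applies.\<close>

lemma admissible_exists:
  assumes ne: "mset xs \<noteq> mset ys"
  shows "\<exists>a b zs. admissible xs ys a b zs"
proof (rule ccontr)
  assume none: "\<not> ?thesis"
  define \<Delta> where "\<Delta> = nLT xs - nLT ys"
  have delta: "nLT xs = nLT ys + \<Delta>" "nL xs = nL ys + \<Delta>"
    using nLT_ge defect by (simp_all add: \<Delta>_def)
  show False
  proof (cases "\<Delta> = 0")
    case False
    \<comment> \<open>Beyond all sizes, so that \<open>inv_LT\<close> of \<open>xs\<close> is
      affine, and large enough for the surplus \<open>(K + 1) * \<Delta>\<close> to outweigh
      \<open>tLT xs\<close>.\<close>
    define K where "K = bound + tLT xs"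
    have K: "bound \<le> K" "tLT xs \<le> K" by (simp_all add: K_def)
    have "gap_LT K"
    proof (rule ccontr)
      assume "\<not> gap_LT K"
      moreover have "inv_LT K ys \<le> K * nLT ys"
        using inv_LT_add[of 0 K ys] count_LT(2)[OF val_ys] by simp
      moreover define c where "c = (K + 1) * \<Delta>"
      moreover have "inv_LT K xs + tLT xs = (K * nLT ys + nLT ys) + c"
        unfolding large_LT(1)[OF K(1)] delta(1) c_def by (simp add: algebra_simps)
      moreover have "K + 1 \<le> c"
        unfolding c_def using mult_le_mono2[of 1 \<Delta> "K + 1"] False by simp
      ultimately show False using K(2) by linarith
    qed
    then have g: "gap_LT K \<or> gap_L K" by (rule disjI1)
    have "\<exists>m n zs. admissible xs ys (LT m) (L n) zs"
    proof (rule LT_L_admissible[OF _ delta(2,1)])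
      show "1 \<le> \<Delta>" using False by simp
    qed (rule no_D_tail[OF none g])
    then obtain m n zs
      where "admissible xs ys (LT m) (L n) zs" by (elim exE)
    then have "\<exists>a b zs. admissible xs ys a b zs" by (intro exI)
    with none show False by (rule notE)
  next
    case True
    have eq: "nLT xs = nLT ys" "nL xs = nL ys" using delta True by simp_all
    have sz: "tLT xs + tD xs + tL xs = tLT ys + tD ys + tL ys" using sizes eq by simp
    have LT_le: "tLT xs \<le> tLT ys" using large_LT[of bound] ge_LT[of bound] eq by simp
    have L_le: "tL xs \<le> tL ys" using large_L[of bound] ge_L[of bound] eq by simp
    have no_gap: "\<not> (gap_LT k \<or> gap_L k)" for k
    proof
      assume k: "gap_LT k \<or> gap_L k"
      have "reg p xs \<le> reg p ys" for p
        by (rule no_tail(1)[OF _ delta(2)]) (rule no_D_tail[OF none k])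
      then have D_le: "tD xs \<le> tD ys" unfolding tD_eq by (intro sum_mono)
      from k show False
      proof
        assume "gap_LT k"
        from LT_tail[OF none this] obtain u where u: "\<forall>i\<ge>u. gap_LT i" by (elim exE conjE)
        have "gap_LT (bound + u)" using u by simp
        then have "tLT xs < tLT ys" using large_LT[of "bound + u"] eq by simp
        then show False using sz D_le L_le by simp
      next
        assume "gap_L k"
        from L_tail[OF none this] obtain u where u: "\<forall>i\<ge>u. gap_L i" by (elim exE conjE)
        have "gap_L (bound + u)" using u by simp
        then have "tL xs < tL ys" using large_L[of "bound + u"] eq by simp
        then show False using sz D_le LT_le by simp
      qed
    qed
    have LT: "inv_LT k xs = inv_LT k ys" and L: "inv_L k xs = inv_L k ys" for k
      using no_gap[of k] ge_LT[of k] ge_L[of k] by linarith+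
    have "tLT xs = tLT ys" "tL xs = tL ys" using large_LT[of bound] large_L[of bound] eq LT L by simp_all
    then have tD: "tD ys = tD xs" using sz by linarith
    have reg_le: "reg p ys \<le> reg p xs" for p
      using ge_D[of p bound] unfolding large_D[OF order_refl] eq by linarith
    have reg_S: "reg p ys = reg p xs" if p: "p \<in> D_points" for p
    proof (rule sum_mono_inv[OF _ _ p finite_D_points])
      show "(\<Sum>p\<in>D_points. reg p ys) = (\<Sum>p\<in>D_points. reg p xs)" using tD unfolding tD_eq .
    qed (rule reg_le)
    have reg_eq: "reg p xs = reg p ys" for p
    proof (cases "p \<in> D_points")
      case True
      from reg_S[OF this] show ?thesis by (rule sym)
    next
      case False
      then have "reg p xs = 0" by (rule reg_outside)
      then show ?thesis using reg_le[of p] by linarith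
    qed
    have D: "inv_D p k xs = inv_D p k ys" for p k
    proof (rule ccontr)
      assume "\<not> ?thesis"
      then have "gap_D p k" using ge_D[of p k] by linarith
      from D_pair_admissible[OF eq(2) reg_eq this] none show False by (rule notE[rotated])
    qed
    show False by (rule notE[OF ne mset_eq_of_inv[OF val_xs val_ys LT L D]])
  qed
qed

end

section \<open>Termination and iteration of the moves\<close>

definition weight :: "nat \<Rightarrow> summand list \<Rightarrow> nat" where
  "weight N xs = (\<Sum>k\<le>N. inv_LT k xs + inv_L k xs)"

text \<open>Only the moves between two Jordan blocks leave \<open>weight\<close> unchanged, and they increase \<open>sq\<close>.\<close>

definition sq :: "summand list \<Rightarrow> nat" where
  "sq xs = sum_list (map (\<lambda>x. (D_size x)\<^sup>2) xs)"

lemma sq_simps [simp]: "sq [] = 0" "sq (x # xs) = (D_size x)\<^sup>2 + sq xs" "sq (xs @ ys) = sq xs + sq ys"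
  by (simp_all add: sq_def)

lemma sq_le: "sq xs \<le> (row_count xs)\<^sup>2"
proof (induction xs)
  case (Cons x xs)
  have "D_size x \<le> summand_rows x" by (cases x) simp_all
  then have "(D_size x)\<^sup>2 \<le> (summand_rows x)\<^sup>2" by (rule power_mono) simp
  moreover have "(row_count (x # xs))\<^sup>2 = (summand_rows x)\<^sup>2 + (row_count xs)\<^sup>2 + 2 * summand_rows x * row_count xs"
    by (simp only: row_count_simps power2_sum)
  moreover have "sq (x # xs) = (D_size x)\<^sup>2 + sq xs" by simp
  ultimately show ?case using Cons.IH by linarith
qed simp

lemma weight_strict:
  assumes "\<And>k. inv_LT k zs + inv_L k zs \<le> inv_LT k xs + inv_L k xs"
    and "j \<le> N" "inv_LT j zs + inv_L j zs < inv_LT j xs + inv_L j xs"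
  shows "weight N zs < weight N xs"
  unfolding weight_def
proof (rule sum_strict_mono_ex1)
  show "\<forall>k\<in>{..N}. inv_LT k zs + inv_L k zs \<le> inv_LT k xs + inv_L k xs" using assms(1) by blast
  show "\<exists>k\<in>{..N}. inv_LT k zs + inv_L k zs < inv_LT k xs + inv_L k xs"
    by (rule bexI[of _ j]) (use assms(2,3) in simp_all)
qed simp

text \<open>Every move that involves \<open>LT\<close> or \<open>L\<close> lowers one of their
  invariants already at \<open>k\<close> equal to the size of a summand it replaces; for this the
  cut-off \<open>N\<close> must not be smaller. Moving two Jordan blocks apart changes none of these
  invariants and increases the sum of squares.\<close>

lemma move_measure:
  assumes "move a b zs" "LT_size a \<le> N" "L_size b \<le> N"
  shows "weight N zs < weight N [a, b] \<or> weight N zs = weight N [a, b] \<and> sq [a, b] < sq zs"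
  using assms
proof (induction rule: move.induct)
  case (LT_LT a b)
  have "weight N [LT (Suc a), LT b] < weight N [LT a, LT (Suc b)]"
    by (rule weight_strict[of _ _ a]) (use LT_LT(2,3) in simp_all)
  then show ?case ..
next
  case (L_L a b)
  have "weight N [L (Suc a), L b] < weight N [L (Suc b), L a]"
    by (rule weight_strict[of _ _ a]) (use L_L(2,4) in simp_all)
  then show ?case ..
next
  case (LT_D m p k)
  have "weight N [LT (Suc m), D p k] < weight N [LT m, D p (Suc k)]"
    by (rule weight_strict[of _ _ m]) (use LT_D(2) in simp_all)
  then show ?case ..
next
  case (D_L n p k)
  have "weight N [L (Suc n), D p k] < weight N [D p (Suc k), L n]"
    by (rule weight_strict[of _ _ n]) (use D_L(3) in simp_all)
  then show ?case ..
next
  case (D_D l k p)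
  have "(Suc l)\<^sup>2 + k\<^sup>2 < (Suc k)\<^sup>2 + l\<^sup>2" using D_D(1) by (simp add: power2_eq_square)
  then have "sq [D p (Suc l), D p k] < sq [D p (Suc k), D p l]" by (simp only: sq_simps D_size.simps add_0_right)
  moreover have "weight N [D p (Suc k), D p l] = weight N [D p (Suc l), D p k]" by (simp add: weight_def)
  ultimately show ?case by simp
next
  case (LT_L m n es)
  have "weight N (D_list es) < weight N [LT m, L n]"
    by (rule weight_strict[of _ _ m]) (use LT_L(6) in \<open>simp_all add: D_list_inv\<close>)
  then show ?case ..
qed

lemma summand_pair_D_zero: "summand_pair (D p 0) = zero_pair 0 0"
  by (cases p) (auto simp: zero_pair_def jordan_block_def intro!: eq_matI)

lemma filter_valid:
  assumes "\<forall>x \<in> set xs. valid_summand x \<or> (\<exists>p. x = D p 0)"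
  shows "direct_sum (filter valid_summand xs) = direct_sum xs"
    and "inv_LT k (filter valid_summand xs) = inv_LT k xs"
    and "inv_L k (filter valid_summand xs) = inv_L k xs"
    and "inv_D p k (filter valid_summand xs) = inv_D p k xs"
    and "sq (filter valid_summand xs) = sq xs"
  using assms
proof (induction xs)
  case (Cons x xs)
  { case 1
    have x: "valid_summand x \<or> (\<exists>p. x = D p 0)" using 1 by simp
    have "direct_sum (filter valid_summand xs) = direct_sum xs" by (rule Cons.IH(1)) (use 1 in simp)
    with x show ?case by (auto simp: direct_sum_Cons summand_pair_D_zero dsum_zero_left[OF direct_sum_in_pair_space]) }
  { case 2
    have x: "valid_summand x \<or> (\<exists>p. x = D p 0)" using 2 by simp
    have "inv_LT k (filter valid_summand xs) = inv_LT k xs" by (rule Cons.IH(2)) (use 2 in simp)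
    with x show ?case by (auto ) }
  { case 3
    have x: "valid_summand x \<or> (\<exists>p. x = D p 0)" using 3 by simp
    have "inv_L k (filter valid_summand xs) = inv_L k xs" by (rule Cons.IH(3)) (use 3 in simp)
    with x show ?case by (auto ) }
  { case 4
    have x: "valid_summand x \<or> (\<exists>p. x = D p 0)" using 4 by simp
    have "inv_D p k (filter valid_summand xs) = inv_D p k xs" by (rule Cons.IH(4)) (use 4 in simp)
    with x show ?case by (auto ) }
  { case 5
    have x: "valid_summand x \<or> (\<exists>p. x = D p 0)" using 5 by simp
    have "sq (filter valid_summand xs) = sq xs" by (rule Cons.IH(5)) (use 5 in simp)
    with x show ?case by (auto ) }
qed simp_all

lemma move_sizes: "move a b zs \<Longrightarrow> z \<in> set zs \<Longrightarrow> valid_summand z \<or> (\<exists>p. z = D p 0)"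
proof (induction rule: move.induct)
  case (LT_D m p k)
  then show ?case by (cases k) auto
next
  case (D_L n p k)
  then show ?case by (cases k) auto
next
  case (D_D l k p)
  then show ?case by (cases l) auto
qed auto

text \<open>All invariants are additive, so the replacement changes them by the difference between
  \<open>zs\<close> and \<open>[a, b]\<close>. The preserved numbers of rows and columns are read
  off the perturbed pairs.\<close>

lemma splice:
  assumes mv: "move a b zs" and xs: "xs = us @ a # vs @ b # ws" and val: "\<forall>x \<in> set xs. valid_summand x"
    and T: "T = filter valid_summand (us @ zs @ vs @ ws)"
  shows "\<forall>x \<in> set T. valid_summand x" "row_count T = row_count xs" "col_count T = col_count xs"
    and "inv_LT k T + inv_LT k [a, b] = inv_LT k xs + inv_LT k zs"
    and "inv_L k T + inv_L k [a, b] = inv_L k xs + inv_L k zs"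
    and "inv_D p k T + inv_D p k [a, b] = inv_D p k xs + inv_D p k zs"
    and "sq T + sq [a, b] = sq xs + sq zs"
    and "\<exists>B. (\<forall>s. pair_iso (row_count xs) (col_count xs) (direct_sum T) (B s) \<and>
        differs_only_in_block xs (length us) (Suc (length us + length vs)) (B s)) \<and>
      pair_tendsto (row_count xs) (col_count xs) B (direct_sum xs)"
proof -
  have "\<forall>x \<in> set (us @ zs @ vs @ ws). valid_summand x \<or> (\<exists>p. x = D p 0)"
    using move_sizes[OF mv] val unfolding xs by auto
  note f = filter_valid[of "us @ zs @ vs @ ws", OF this, folded T]
  show "\<forall>x \<in> set T. valid_summand x" unfolding T set_filter by blast
  show B: "\<exists>B. (\<forall>s. pair_iso (row_count xs) (col_count xs) (direct_sum T) (B s) \<and>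
        differs_only_in_block xs (length us) (Suc (length us + length vs)) (B s)) \<and>
      pair_tendsto (row_count xs) (col_count xs) B (direct_sum xs)"
    using block_perturbation[OF move_extension[OF mv], of us vs ws] unfolding xs[symmetric] f(1) .
  then obtain B where "\<forall>s. pair_iso (row_count xs) (col_count xs) (direct_sum T) (B s) \<and>
        differs_only_in_block xs (length us) (Suc (length us + length vs)) (B s)"
    "pair_tendsto (row_count xs) (col_count xs) B (direct_sum xs)" by (elim exE conjE)
  then have "pair_iso (row_count xs) (col_count xs) (direct_sum T) (B 0)" by simp
  from pair_iso_space(1)[OF this] show "row_count T = row_count xs" "col_count T = col_count xs"
    by (auto simp: pair_space_iff)
  show "inv_LT k T + inv_LT k [a, b] = inv_LT k xs + inv_LT k zs" unfolding f(2) xs by simp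
  show "inv_L k T + inv_L k [a, b] = inv_L k xs + inv_L k zs" unfolding f(3) xs by simp
  show "inv_D p k T + inv_D p k [a, b] = inv_D p k xs + inv_D p k zs" unfolding f(4) xs by simp
  show "sq T + sq [a, b] = sq xs + sq zs" unfolding f(5) xs by simp
qed

context invariant_gap
begin

lemma admissible_splice:
  assumes adm: "admissible xs ys a b zs" and xs: "xs = us @ a # vs @ b # ws"
    and T: "T = filter valid_summand (us @ zs @ vs @ ws)"
  shows "invariant_gap T ys" "degen (row_count xs) (col_count xs) (direct_sum xs) (direct_sum T)"
    and "bound \<le> N \<Longrightarrow> weight N T < weight N xs \<or> weight N T = weight N xs \<and> sq xs < sq T"
proof -
  have mv: "move a b zs" using adm by (simp add: admissible_def)
  note s = splice[OF mv xs val_xs T]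
  show "invariant_gap T ys"
  proof
    show "inv_ge T ys"
      unfolding inv_ge_def
    proof (intro conjI allI)
      fix p k
      have "inv_LT k ys + inv_LT k [a, b] \<le> inv_LT k xs + inv_LT k zs" using adm unfolding admissible_def by blast
      then show "inv_LT k ys \<le> inv_LT k T" using s(4)[of k] by linarith
      have "inv_L k ys + inv_L k [a, b] \<le> inv_L k xs + inv_L k zs" using adm unfolding admissible_def by blast
      then show "inv_L k ys \<le> inv_L k T" using s(5)[of k] by linarith
      have "inv_D p k ys + inv_D p k [a, b] \<le> inv_D p k xs + inv_D p k zs" using adm unfolding admissible_def by blast
      then show "inv_D p k ys \<le> inv_D p k T" using s(6)[of p k] by linarith
    qed
  qed (use s(1-3) val_ys rows cols in simp_all)
  from s(8) obtain B where "\<forall>s. pair_iso (row_count xs) (col_count xs) (direct_sum T) (B s) \<and>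
        differs_only_in_block xs (length us) (Suc (length us + length vs)) (B s)"
    "pair_tendsto (row_count xs) (col_count xs) B (direct_sum xs)" by (elim exE conjE)
  then show "degen (row_count xs) (col_count xs) (direct_sum xs) (direct_sum T)"
    unfolding degen_def by (intro conjI direct_sum_in_pair_space exI[of _ B]) simp_all
  assume N: "bound \<le> N"
  have "weight N T + weight N [a, b] = weight N xs + weight N zs"
    unfolding weight_def sum.distrib[symmetric]
  proof (rule sum.cong[OF refl])
    show "inv_LT k T + inv_L k T + (inv_LT k [a, b] + inv_L k [a, b]) =
        inv_LT k xs + inv_L k xs + (inv_LT k zs + inv_L k zs)" for k
      using s(4)[of k] s(5)[of k] by linarith
  qed
  moreover have "weight N zs < weight N [a, b] \<or> weight N zs = weight N [a, b] \<and> sq [a, b] < sq zs"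
  proof (rule move_measure[OF mv])
    have ab: "a \<in> set xs" "b \<in> set xs" by (simp_all add: xs)
    show "LT_size a \<le> N" using size_bound(1) ab(1) N by (cases a) (auto intro: le_trans)
    show "L_size b \<le> N" using size_bound(3) ab(2) N by (cases b) (auto intro: le_trans)
  qed
  ultimately show "weight N T < weight N xs \<or> weight N T = weight N xs \<and> sq xs < sq T"
    using s(7) by linarith
qed

end

lemma degen_of_iso:
  assumes "pair_iso m n P Q" shows "degen m n P Q"
  unfolding degen_def
proof (intro conjI exI[of _ "\<lambda>_. P"] allI)
  show "P \<in> pair_space m n" by (rule pair_iso_space(1)[OF assms])
  show "pair_iso m n Q P" by (rule pair_iso_sym[OF assms])
qed (simp add: pair_tendsto_def)

lemma degen_trans:
  assumes "degen m n P Q" "degen m n Q T" "T \<in> pair_space m n"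
  shows "degen m n P T"
proof -
  have "P \<in> pair_space m n" "Q \<in> pair_space m n" using assms(1,2) by (simp_all add: degen_def)
  then show ?thesis using orbit_le_trans[of m n P Q T] assms by (simp add: orbit_le_iff_degen)
qed

lemma inv_perm:
  assumes "mset xs = mset ys"
  shows "inv_LT k xs = inv_LT k ys" "inv_L k xs = inv_L k ys" "inv_D p k xs = inv_D p k ys"
proof -
  have "sum_list (map f xs) = sum_list (map f ys)" for f :: "summand \<Rightarrow> nat"
    using assms sum_mset_sum_list[of "map f xs"] sum_mset_sum_list[of "map f ys"] by simp
  then show "inv_LT k xs = inv_LT k ys" "inv_L k xs = inv_L k ys" "inv_D p k xs = inv_D p k ys"
    by (simp_all add: inv_LT_def inv_L_def inv_D_def)
qed

lemma measure_perm:
  assumes "mset xs = mset ys"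
  shows "sq xs = sq ys" "weight N xs = weight N ys"
proof -
  show "sq xs = sq ys" unfolding sq_def
    using assms sum_mset_sum_list[of "map (\<lambda>x. (D_size x)\<^sup>2) xs"] sum_mset_sum_list[of "map (\<lambda>x. (D_size x)\<^sup>2) ys"]
    by simp
  show "weight N xs = weight N ys" unfolding weight_def inv_perm[OF assms] ..
qed

lemma invariant_gap_perm:
  assumes "invariant_gap xs ys" "mset xs = mset xs'"
  shows "invariant_gap xs' ys"
proof -
  interpret invariant_gap xs ys by (rule assms)
  show ?thesis
  proof
    show "\<forall>x \<in> set xs'. valid_summand x" using val_xs mset_eq_setD[OF assms(2)] by simp
    show "row_count ys = row_count xs'" using rows row_count_mset[OF assms(2)] by simp
    show "col_count ys = col_count xs'" using cols col_count_mset[OF assms(2)] by simp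
    show "inv_ge xs' ys" using ge unfolding inv_ge_def inv_perm[OF assms(2)] .
  qed (rule val_ys)
qed

text \<open>Each admissible move leads to an orbit whose closure contains the previous one and
  preserves dominance over \<open>ys\<close>. This cannot go on forever: \<open>weight\<close>
  drops, or it stays and \<open>sq\<close> rises, which is bounded by the square of the number of
  rows.\<close>

lemma invariant_gap_degen:
  assumes "invariant_gap xs ys" "row_count xs = m" "col_count xs = n"
  shows "degen m n (direct_sum xs) (direct_sum ys)"
  using assms
proof (induction xs rule: wf_induct_rule[OF wf_measures[of "[weight (m + n), \<lambda>xs. m\<^sup>2 - sq xs]"]])
  case (1 xs)
  interpret invariant_gap xs ys by (rule 1)
  show ?case
  proof (cases "mset xs = mset ys")
    case True
    then show ?thesis using degen_of_iso[OF direct_sum_perm[OF True]] 1(3,4) by simp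
  next
    case False
    from admissible_exists[OF this] obtain a b zs where adm: "admissible xs ys a b zs" by (elim exE)
    then have "{#a, b#} \<subseteq># mset xs" by (simp add: admissible_def)
    then obtain M where M: "mset xs = {#a, b#} + M" by (rule subset_mset.less_eqE)
    obtain rs where rs: "mset rs = M" using ex_mset by (rule exE)
    \<comment> \<open>Only the equivalence class matters here, so \<open>a\<close> and
      \<open>b\<close> may be put in front.\<close>
    define xs' where "xs' = [] @ a # [] @ b # rs"
    have perm: "mset xs = mset xs'" by (simp add: xs'_def M rs)
    interpret x: invariant_gap xs' ys by (rule invariant_gap_perm[OF 1(2) perm])
    have adm': "admissible xs' ys a b zs"
      using adm unfolding admissible_def perm inv_perm[OF perm] .
    define T where "T = filter valid_summand ([] @ zs @ [] @ rs)"
    note sp = x.admissible_splice[OF adm' xs'_def T_def]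
    have mn: "row_count xs' = m" "col_count xs' = n"
      unfolding row_count_mset[OF perm, symmetric] col_count_mset[OF perm, symmetric] by (rule 1(3), rule 1(4))
    have iso: "pair_iso m n (direct_sum xs') (direct_sum xs)"
      using direct_sum_perm[OF perm[symmetric]] unfolding mn .
    have d: "degen m n (direct_sum xs) (direct_sum T)"
      by (rule degen_iso_left[OF iso sp(2)[unfolded mn]])
    have Tc: "row_count T = m" "col_count T = n"
      using invariant_gap.rows[OF sp(1)] invariant_gap.cols[OF sp(1)] unfolding rows cols 1(3,4) by simp_all
    have "sq T \<le> m\<^sup>2" using sq_le[of T] unfolding Tc .
    moreover have "weight (m + n) T < weight (m + n) xs \<or> weight (m + n) T = weight (m + n) xs \<and> sq xs < sq T"
      using sp(3)[of "m + n"] unfolding x.bound_def mn measure_perm[OF perm] by (simp only: order_refl)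
    ultimately have "(T, xs) \<in> measures [weight (m + n), \<lambda>xs. m\<^sup>2 - sq xs]" by auto
    from 1(1)[OF this sp(1) Tc] have "degen m n (direct_sum T) (direct_sum ys)" .
    moreover have "direct_sum ys \<in> pair_space m n"
      using direct_sum_in_pair_space[of ys] unfolding rows cols 1(3,4) .
    ultimately show ?thesis by (rule degen_trans[OF d])
  qed
qed

section \<open>The canonical order of the summands, and the immediate successors\<close>

fun canon_le :: "summand \<Rightarrow> summand \<Rightarrow> bool" where
  "canon_le (LT a) (LT b) = (a \<le> b)"
| "canon_le (LT a) _ = True"
| "canon_le (D p k) (D q l) = (p = q \<longrightarrow> k \<le> l)"
| "canon_le (D p k) (L n) = True"
| "canon_le (L a) (L b) = (b \<le> a)"
| "canon_le _ _ = False"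

text \<open>In every move the subobject \<open>a\<close> comes before the quotient \<open>b\<close>
  in the canonical order. The two can be related backwards only as Jordan blocks of equal size with
  the same eigenvalue. Blocks of different eigenvalues are related both ways by
  \<open>canon_le\<close>, but no move involves them.\<close>

lemma move_canon: "move a b zs \<Longrightarrow> canon_le b a \<Longrightarrow> a = b"
  by (induction rule: move.induct) auto

lemma canonical_sorted:
  assumes "sorted ms" "\<forall>(a, ks) \<in> set gs. sorted ks" "distinct (map fst gs)" "sorted ns"
  shows "sorted_wrt canon_le (canonical_summands ms gs ns)"
proof -
  have D: "x \<in> set (concat (map D_summands gs)) \<Longrightarrow> \<exists>p k. x = D p k \<and> p \<in> fst ` set gs" for x and gs :: "(ext_complex \<times> nat list) list"
    by (induction gs) (auto simp: image_iff)
  have "sorted_wrt canon_le (map LT ms)" using assms(1) by (simp add: sorted_wrt_map)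
  moreover have "sorted_wrt canon_le (map L (rev ns))"
    using assms(4) by (simp add: sorted_wrt_map sorted_wrt_rev)
  moreover have "sorted_wrt canon_le (concat (map D_summands gs))" using assms(2,3)
  proof (induction gs)
    case (Cons g gs)
    obtain p ks where g: "g = (p, ks)" by fastforce
    have "sorted_wrt canon_le (map (D p) ks)" using Cons.prems g by (simp add: sorted_wrt_map)
    moreover have "canon_le x y" if xy: "x \<in> set (map (D p) ks)" "y \<in> set (concat (map D_summands gs))" for x y
    proof -
      obtain q l where y: "y = D q l" "q \<in> fst ` set gs" using D[OF xy(2)] by (elim exE conjE)
      have "p \<notin> fst ` set gs" using Cons.prems g by simp
      then have "p \<noteq> q" using y(2) by metis
      moreover obtain k where "x = D p k" using xy(1) by auto
      ultimately show ?thesis by (simp add: y(1))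
    qed
    ultimately show ?case using Cons g by (simp add: sorted_wrt_append)
  qed simp
  moreover have "canon_le x y" if "x \<in> set (map LT ms)" "y \<in> set (concat (map D_summands gs) @ map L (rev ns))" for x y
    using that D[of y gs] by fastforce
  moreover have "canon_le x y" if "x \<in> set (concat (map D_summands gs))" "y \<in> set (map L (rev ns))" for x y
    using that D[of x gs] by fastforce
  ultimately show ?thesis unfolding canonical_summands_def sorted_wrt_append by blast
qed

text \<open>If \<open>b\<close> came first, sortedness would give \<open>R b a\<close>, hence
  \<open>a = b\<close>, and then the two occurrences can be named in either order.\<close>

lemma ordered_split:
  assumes "sorted_wrt R xs" "{#a, b#} \<subseteq># mset xs" "R b a \<Longrightarrow> a = b"
  shows "\<exists>us vs ws. xs = us @ a # vs @ b # ws"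
  using assms(1,2)
proof (induction xs)
  case (Cons x xs)
  show ?case
  proof (cases "x = a")
    case True
    have "{#b#} \<subseteq># mset xs" using Cons.prems(2) True by simp
    from mset_subset_eqD[OF this, of b] have "b \<in> set xs" by simp
    then obtain vs ws where "xs = vs @ b # ws" by (meson split_list)
    then have "x # xs = [] @ a # vs @ b # ws" using True by simp
    then show ?thesis by (intro exI)
  next
    case xa: False
    have a: "a \<in> set xs" using mset_subset_eqD[OF Cons.prems(2), of a] xa by simp
    have xb: "x \<noteq> b"
    proof
      assume "x = b"
      then have "R b a" using Cons.prems(1) a by simp
      from assms(3)[OF this] show False using xa \<open>x = b\<close> by simp
    qed
    have "{#a, b#} \<subseteq># mset xs"
      using Cons.prems(2) xa xb by (auto simp: subseteq_mset_def split: if_splits)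
    then obtain us vs ws where "xs = us @ a # vs @ b # ws" using Cons by auto
    then have "x # xs = (x # us) @ a # vs @ b # ws" by simp
    then show ?thesis by (intro exI)
  qed
qed simp

theorem theorem4p1:
  fixes ms ns :: "nat list" and gs :: "(ext_complex \<times> nat list) list"
    and xs :: "summand list" and B :: matrix_pair
  assumes "sorted ms" and "\<forall>m \<in> set ms. 1 \<le> m"
    and "\<forall>(a, ks) \<in> set gs. sorted ks \<and> (\<forall>k \<in> set ks. 1 \<le> k)"
    and "distinct (map fst gs)"
    and "sorted ns" and "\<forall>n \<in> set ns. 1 \<le> n"
    and "xs = canonical_summands ms gs ns"
    and "B \<in> pair_space (row_count xs) (col_count xs)"
    and "immediate_successor (row_count xs) (col_count xs) (direct_sum xs) B"
  shows "\<exists>i < length xs. \<exists>j < length xs.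
    (i < j \<and> \<not> block_from_D xs gs i j \<or> block_from_D xs gs i j) \<and>
    orbit_by_small_perturbation xs i j B"
proof -
  let ?m = "row_count xs" and ?n = "col_count xs"
  have val_xs: "\<forall>x \<in> set xs. valid_summand x"
    using assms(2,3,6) unfolding assms(7) canonical_summands_def by fastforce
  have sorted: "sorted_wrt canon_le xs"
    unfolding assms(7) by (rule canonical_sorted) (use assms(1,3,4,5) in auto)
  note xs_space = direct_sum_in_pair_space[of xs]
  have less: "orbit_less ?m ?n (direct_sum xs) B"
    and no_between: "\<And>C. C \<in> pair_space ?m ?n \<Longrightarrow> orbit_less ?m ?n (direct_sum xs) C \<Longrightarrow> \<not> orbit_less ?m ?n C B"
    using assms(9) unfolding immediate_successor_def by blast+
  obtain ys where val_ys: "\<forall>y \<in> set ys. valid_summand y" and iso: "pair_iso ?m ?n B (direct_sum ys)"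
    using kronecker_canonical_form[OF assms(8)] by (elim exE conjE)
  have B: "orbit_le ?m ?n (direct_sum xs) B" "pair_orbit (direct_sum xs) \<noteq> pair_orbit B"
    using less by (simp_all add: orbit_less_def)
  then have "degen ?m ?n (direct_sum xs) (direct_sum ys)"
    using degen_iso_right[OF _ iso] by (simp add: orbit_le_iff_degen xs_space assms(8))
  then have ge: "inv_ge xs ys" by (rule degen_inv_ge[OF _ val_xs val_ys])
  have ys_counts: "row_count ys = ?m" "col_count ys = ?n"
    using pair_iso_space(2)[OF iso] by (auto simp: pair_space_iff)
  interpret invariant_gap xs ys
    by standard (rule val_xs val_ys ys_counts ge)+
  have "mset xs \<noteq> mset ys"
  proof
    assume "mset xs = mset ys"
    from pair_iso_trans[OF direct_sum_perm[OF this] pair_iso_sym[OF iso]]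
    show False using B(2) by (simp add: pair_orbit_eq_iff[OF xs_space assms(8)])
  qed
  from admissible_exists[OF this] obtain a b zs where adm: "admissible xs ys a b zs" by (elim exE)
  have mv: "move a b zs" and sub: "{#a, b#} \<subseteq># mset xs" using adm by (simp_all add: admissible_def)
  have "\<exists>us vs ws. xs = us @ a # vs @ b # ws"
    by (rule ordered_split[OF sorted sub]) (rule move_canon[OF mv])
  then obtain us vs ws
    where split: "xs = us @ a # vs @ b # ws" by (elim exE)
  define T where "T = filter valid_summand (us @ zs @ vs @ ws)"
  note sp = admissible_splice[OF adm split T_def]
  have T_counts: "row_count T = ?m" "col_count T = ?n" by (rule splice(2,3)[OF mv split val_xs T_def])+
  have val_T: "\<forall>x \<in> set T. valid_summand x" by (rule splice(1)[OF mv split val_xs T_def])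
  have T_space: "direct_sum T \<in> pair_space ?m ?n" using direct_sum_in_pair_space[of T] unfolding T_counts .
  \<comment> \<open>Equivalent pairs would have the same invariants, hence the same summands and the
    same measures, but the move has changed \<open>weight\<close> or \<open>sq\<close>.\<close>
  have "\<not> pair_iso ?m ?n (direct_sum xs) (direct_sum T)"
  proof
    assume iso_T: "pair_iso ?m ?n (direct_sum xs) (direct_sum T)"
    have "inv_ge T xs" by (rule degen_inv_ge[OF degen_of_iso[OF pair_iso_sym[OF iso_T]] val_T val_xs])
    moreover have "inv_ge xs T" by (rule degen_inv_ge[OF degen_of_iso[OF iso_T] val_xs val_T])
    ultimately have "mset xs = mset T"
      by (intro mset_eq_of_inv[OF val_xs val_T]) (simp_all add: inv_ge_def le_antisym)
    from measure_perm[OF this] sp(3)[OF order_refl] show False by simp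
  qed
  then have "orbit_less ?m ?n (direct_sum xs) (direct_sum T)"
    using sp(2) by (simp add: orbit_less_def orbit_le_iff_degen pair_orbit_eq_iff[OF xs_space T_space] xs_space T_space)
  \<comment> \<open>The orbit of \<open>T\<close> lies strictly above that of \<open>xs\<close> and,
    by iterating moves, below that of \<open>B\<close>; nothing lies strictly between, so it is the
    orbit of \<open>B\<close>.\<close>
  from no_between[OF T_space this] have "\<not> orbit_less ?m ?n (direct_sum T) B" .
  moreover have "degen ?m ?n (direct_sum T) B"
    by (rule degen_iso_right[OF invariant_gap_degen[OF sp(1) T_counts] pair_iso_sym[OF iso]])
  ultimately have orbit: "pair_orbit (direct_sum T) = pair_orbit B"
    by (simp add: orbit_less_def orbit_le_iff_degen T_space assms(8))
  let ?i = "length us" and ?j = "Suc (length us + length vs)"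
  from splice(8)[OF mv split val_xs T_def] obtain P
    where P: "\<forall>s. pair_iso ?m ?n (direct_sum T) (P s) \<and> differs_only_in_block xs ?i ?j (P s)"
      "pair_tendsto ?m ?n P (direct_sum xs)" by (elim exE conjE)
  have "orbit_by_small_perturbation xs ?i ?j B"
    unfolding orbit_by_small_perturbation_def
  proof (intro allI impI)
    fix \<delta> :: real assume "0 < \<delta>"
    from order_tendstoD(2)[OF pair_dist_tendsto[OF P(2)] this]
    obtain N where N: "\<forall>s\<ge>N. pair_dist ?m ?n (direct_sum xs) (P s) < \<delta>"
      unfolding eventually_sequentially by (rule exE)
    show "\<exists>Q \<in> pair_orbit B. differs_only_in_block xs ?i ?j Q \<and> pair_dist ?m ?n (direct_sum xs) Q < \<delta>"
    proof (intro bexI conjI)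
      show "P N \<in> pair_orbit B" using P(1) unfolding orbit[symmetric] mem_pair_orbit_iff[OF T_space] by simp
    qed (use N P(1) in simp_all)
  qed
  \<comment> \<open>Since \<open>?i < ?j\<close>, one of the two alternatives holds whether or not
    the block is from one of the groups.\<close>
  moreover have "?i < length xs" "?j < length xs" "?i < ?j" by (simp_all add: split)
  ultimately show ?thesis by blast
qed

end
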